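(* Let $c,d\ge0$ be constants. There exist constants $C,C'>0$ depending only on $c$ and $d$ such that the following holds. Let $f:\mathbb{R}\to\mathbb{R}$ be a $1$-periodic function which is of bounded variation on $[0,1]$ with $\int_0^1f(x)\,\mathrm{d}x=0$, and let $\alpha=[a_0;a_1,a_2,\ldots]$ be an irrational with convergents $p_k/q_k=[a_0;a_1,\ldots,a_k]$ such that $a_k\le ck^d$ for all $k\ge1$. For any integers $k\ge1$ and $M\ge3$ with $q_k\le M<q_{k+1}$, \[ \left|A_M-\sum_{\substack{m\in\mathbb{Z}\\0<|m|<M(\log M)^{2d+1}}}\left(1-\frac{|m|}{\lfloor M(\log M)^{2d+1}\rfloor}\right)\widehat f(m)\frac{e^{2\pi im\alpha}}{1-e^{2\pi im\alpha}}\right|\le C\,V(f)\max_{|\ell-k|\le C'\log k}a_\ell\cdot(\log\log M)^2 \] and \[ \left|B_M^2-\sum_{m=1}^M\frac{|\widehat f(m)|^2}{2\pi^2\|m\alpha\|^2}\right|\le C\left(V(f)\sqrt{\sum_{m=1}^M\frac{|\widehat f(m)|^2}{\|m\alpha\|^2}}+V(f)^2\max_{|\ell-k|\le C'\log k}a_\ell^2\cdot(\log\log M)^4\right). \]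
   Context: $V(f)$ denotes the total variation of $f$ on $[0,1]$ and $\widehat f(m)=\int_0^1f(x)e^{-2\pi imx}\,\mathrm{d}x$, $m\in\mathbb{Z}$, its Fourier coefficients. $S_N(\alpha,f)=\sum_{n=1}^Nf(n\alpha)$, $A_M=\frac1M\sum_{N=1}^MS_N(\alpha,f)$ and $B_M^2=\frac1M\sum_{N=1}^M(S_N(\alpha,f)-A_M)^2$. $\|\cdot\|$ denotes the distance from the nearest integer. In the maxima $\ell$ ranges over integers $\ell\ge1$. *)

theory Defs
  imports "HOL-Analysis.Analysis"
begin

definition partition_variations :: "(real \<Rightarrow> real) \<Rightarrow> real \<Rightarrow> real \<Rightarrow> real set" where
  "partition_variations f a b =
     {\<Sum>i<n. \<bar>f (t (Suc i)) - f (t i)\<bar> | (n::nat) (t :: nat \<Rightarrow> real).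
        t 0 = a \<and> t n = b \<and> (\<forall>i<n. t i \<le> t (Suc i))}"

definition bounded_variation :: "(real \<Rightarrow> real) \<Rightarrow> real \<Rightarrow> real \<Rightarrow> bool" where
  "bounded_variation f a b \<longleftrightarrow> bdd_above (partition_variations f a b)"

definition total_variation :: "(real \<Rightarrow> real) \<Rightarrow> real \<Rightarrow> real \<Rightarrow> real" where
  "total_variation f a b = Sup (partition_variations f a b)"

definition fourier_coeff :: "(real \<Rightarrow> real) \<Rightarrow> int \<Rightarrow> complex" where
  "fourier_coeff f m =
     integral {0..1} (\<lambda>x. of_real (f x) * exp (- (2 * of_real pi * \<i> * of_int m * of_real x)))"

definition int_dist :: "real \<Rightarrow> real" where
  "int_dist x = \<bar>x - of_int (round x)\<bar>"

text \<open>The complete quotients of the continued fraction expansion of an irrational \<open>\<alpha>\<close>; the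
  partial quotients \<open>a\<^sub>k\<close> are their integer parts.\<close>

primrec cf_complete :: "real \<Rightarrow> nat \<Rightarrow> real" where
  "cf_complete \<alpha> 0 = \<alpha>"
| "cf_complete \<alpha> (Suc k) = 1 / frac (cf_complete \<alpha> k)"

definition cf_quot :: "real \<Rightarrow> nat \<Rightarrow> int" where
  "cf_quot \<alpha> k = \<lfloor>cf_complete \<alpha> k\<rfloor>"

text \<open>The value of a finite continued fraction; the clause for the empty list is a dummy.\<close>

fun cf_value :: "int list \<Rightarrow> rat" where
  "cf_value [] = 0"
| "cf_value [a] = of_int a"
| "cf_value (a # b # as) = of_int a + 1 / cf_value (b # as)"

definition cf_convergent :: "real \<Rightarrow> nat \<Rightarrow> rat" where
  "cf_convergent \<alpha> k = cf_value (map (cf_quot \<alpha>) [0..<Suc k])"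

text \<open>\<open>quotient_of\<close> returns the reduced fraction with positive denominator.\<close>

definition cf_denom :: "real \<Rightarrow> nat \<Rightarrow> int" where
  "cf_denom \<alpha> k = snd (quotient_of (cf_convergent \<alpha> k))"

definition birkhoff_sum :: "real \<Rightarrow> (real \<Rightarrow> real) \<Rightarrow> nat \<Rightarrow> real" where
  "birkhoff_sum \<alpha> f N = (\<Sum>n=1..N. f (real n * \<alpha>))"

definition birkhoff_mean :: "real \<Rightarrow> (real \<Rightarrow> real) \<Rightarrow> nat \<Rightarrow> real" where
  "birkhoff_mean \<alpha> f M = 1 / real M * (\<Sum>N=1..M. birkhoff_sum \<alpha> f N)"

text \<open>This is \<open>B\<^sub>M\<^sup>2\<close> itself, not its square root.\<close>

definition birkhoff_variance :: "real \<Rightarrow> (real \<Rightarrow> real) \<Rightarrow> nat \<Rightarrow> real" where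
  "birkhoff_variance \<alpha> f M =
     1 / real M * (\<Sum>N=1..M. (birkhoff_sum \<alpha> f N - birkhoff_mean \<alpha> f M)\<^sup>2)"

end

theory Submission
  imports Defs
begin

text \<open>
Put \<open>e(x) = exp(2 \<pi> i x)\<close>, let \<open>V\<close> be the variation of \<open>f\<close>, \<open>L = log M\<close>, \<open>T = log log M\<close>,
\<open>H = \<lfloor>M L^(2d+1)\<rfloor>\<close> and \<open>U = L^(2d+4)\<close>, and write \<open>\<parallel>x\<parallel>\<close> for the distance to the nearest integer.

\<^emph>\<open>Smoothing.\<close> Since \<open>a_k \<le> c k^d\<close>, we have \<open>\<parallel>n \<alpha>\<parallel> \<ge> 1/(B n)\<close> for \<open>n \<le> 4H\<close> with \<open>B = O(L^d)\<close>. Hence the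
points \<open>n \<alpha>\<close>, \<open>n \<le> M\<close>, are \<open>1/(B M)\<close>-separated on the circle, and translating all of them by \<open>y\<close> changes
a Birkhoff sum by at most \<open>V (1 + \<parallel>y\<parallel> B M)\<close>. The Fejer kernel of order \<open>H\<close> has first absolute moment
\<open>O(log H / H)\<close>. With the above \<open>H\<close>, replacing \<open>f\<close> by its Fejer mean of order \<open>H\<close> therefore costs only
\<open>O(V)\<close>, for all \<open>N \<le> M\<close> at once (\<open>birkhoff_fejer_error\<close>, \<open>smoothing_error_le\<close>). The \<open>N\<close>-th Birkhoff sum
of the Fejer mean is \<open>D - \<Sum> c(m) e(N m \<alpha>)\<close>, where \<open>D = \<Sum> c(m)\<close> is the trigonometric sum of the first
estimate. As the \<open>m\<close>-th Fourier coefficient of \<open>f\<close> is at most \<open>V/(4|m|)\<close>, we have \<open>|c(m)| \<le> V g(m)\<close> with the resonance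
\<open>g(m) = 1/(|m| \<parallel>m \<alpha>\<parallel>)\<close>.

\<^emph>\<open>Separating the resonances.\<close> The average of \<open>e(N n \<alpha>)\<close> over \<open>N \<le> M\<close> has modulus at most
\<open>min(1, 1/(M \<parallel>n \<alpha>\<parallel>))\<close>. Call \<open>m\<close> strongly resonant if \<open>\<parallel>m \<alpha>\<parallel> < U/M\<close>; let \<open>F\<close> be the sum of \<open>g(m)\<close> over
\<open>0 < |m| \<le> 2H\<close> and \<open>W\<close> its part over the strongly resonant \<open>|m| \<le> H\<close>. The mean of \<open>\<Sum> c(m) e(N m \<alpha>)\<close> is at most
\<open>V (W + F/U)\<close>. Its mean square is a double sum over \<open>m, m'\<close>. The diagonal equals the quadratic sum of the
second estimate up to \<open>V\<^sup>2 (1 + W\<^sup>2 + F/U)\<close>, and the off-diagonal part is at most \<open>V\<^sup>2 (W\<^sup>2 + 10 F\<^sup>2/U)\<close>: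
unless both \<open>m\<close> and \<open>m'\<close> are strongly resonant, the triangle inequality makes two of the three distances
\<open>\<parallel>m \<alpha>\<parallel>\<close>, \<open>\<parallel>m' \<alpha>\<parallel>\<close>, \<open>\<parallel>(m - m') \<alpha>\<parallel>\<close> at least \<open>U/(2M)\<close>, which yields the factor \<open>1/U\<close>
(\<open>resonance_pair_le\<close>, \<open>birkhoff_mean_variance_bound\<close>). A crude bound \<open>F = O(L^(d+2))\<close> makes \<open>F\<^sup>2/U\<close>
bounded; this is what the exponent in \<open>U\<close> is for.

\<^emph>\<open>Strong resonances.\<close> Let \<open>A\<close> be the maximum of \<open>a_l\<close> over \<open>|l - k| \<le> C' log k\<close>. Strongly resonant \<open>m\<close> satisfy
\<open>m \<ge> M/(B U)\<close>, so \<open>O(T)\<close> dyadic blocks contain all of those up to \<open>H\<close>. Convergent denominators of that size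
have indices within \<open>O(T) = O(log k)\<close> of \<open>k\<close>, which gives the separation of the points \<open>m \<alpha>\<close> in these blocks
with \<open>O(A)\<close> instead of \<open>B\<close>. In each block the sum of \<open>g\<close> is at most \<open>O(A)\<close> times a harmonic sum of length
\<open>L^O(1)\<close>, that is \<open>O(A T)\<close>. Altogether \<open>W = O(A T\<^sup>2)\<close> (\<open>sum_resonances_le\<close>,
\<open>strong_resonance_sum_le_window\<close>), which proves the first estimate.

\<^emph>\<open>Variance.\<close> A perturbation of size \<open>O(V)\<close> changes a mean square \<open>\<tau>\<^sup>2\<close> by \<open>O(V \<tau> + V\<^sup>2)\<close>; with \<open>\<tau>\<^sup>2\<close> equal to
the quadratic sum up to \<open>O(V\<^sup>2 A\<^sup>2 T^4)\<close> this is the second estimate. The smoothing error must be \<open>O(V)\<close>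
and not merely \<open>O(A V)\<close> here, which is why \<open>H\<close> exceeds \<open>M\<close> by a power of \<open>L\<close> depending on \<open>d\<close>.
\<close>

section \<open>Distances to the nearest integer\<close>

lemma int_dist_le: "int_dist x \<le> \<bar>x - of_int n\<bar>"
  unfolding int_dist_def using round_diff_minimal[of x n] by simp

lemma int_dist_nonneg [simp]: "int_dist x \<ge> 0"
  by (simp add: int_dist_def)

lemma int_dist_le_half: "int_dist x \<le> 1/2"
  unfolding int_dist_def using of_int_round_abs_le[of x] by linarith

lemma int_dist_minus [simp]: "int_dist (- x) = int_dist x"
proof -
  have le: "int_dist (- y) \<le> int_dist y" for y
    using int_dist_le[of "- y" "- round y"] by (simp add: int_dist_def)
  show ?thesis using le[of x] le[of "- x"] by simp
qed

lemma int_dist_add_le: "int_dist (x + y) \<le> int_dist x + int_dist y"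
  using int_dist_le[of "x + y" "round x + round y"] unfolding int_dist_def by simp

lemma int_dist_pos: "\<alpha> \<notin> \<rat> \<Longrightarrow> n \<noteq> 0 \<Longrightarrow> int_dist (of_int n * \<alpha>) > 0"
proof (rule ccontr)
  assume \<alpha>: "\<alpha> \<notin> \<rat>" and n: "n \<noteq> 0" "\<not> int_dist (of_int n * \<alpha>) > 0"
  hence "int_dist (of_int n * \<alpha>) = 0" using int_dist_nonneg[of "of_int n * \<alpha>"] by linarith
  hence "of_int n * \<alpha> = of_int (round (of_int n * \<alpha>))" by (simp add: int_dist_def)
  hence "\<alpha> = of_int (round (of_int n * \<alpha>)) / of_int n" using n by (simp add: field_simps)
  hence "\<alpha> \<in> \<rat>" by (metis Rats_divide Rats_of_int)
  thus False using \<alpha> by simp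
qed

lemma sum_inverse_le_ln:
  assumes "n \<ge> 1" shows "(\<Sum>r=1..n. 1 / real r) \<le> 1 + ln (real n)"
  using assms
proof (induction n rule: nat_induct_at_least)
  case (Suc n)
  have "ln (real n / real (Suc n)) \<le> real n / real (Suc n) - 1"
    using Suc by (intro ln_le_minus_one) auto
  also have "\<dots> = - (1 / real (Suc n))" by (simp add: field_simps)
  finally have "1 / real (Suc n) \<le> ln (real (Suc n)) - ln (real n)"
    using Suc by (simp add: ln_div)
  thus ?case using Suc by simp
qed simp

text \<open>On either side of the nearest integer, each of the intervals \<open>[r \<delta>, (r+1) \<delta>)\<close>, \<open>r \<ge> 1\<close>, holds at most one of the
\<open>\<delta>\<close>-separated points, so the sum is dominated by two harmonic sums.\<close>

lemma sum_inverse_int_dist_le: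
  fixes t :: "'i \<Rightarrow> real"
  assumes S: "finite S" and \<delta>: "\<delta> > 0"
    and range: "\<And>i. i \<in> S \<Longrightarrow> \<delta> \<le> int_dist (t i) \<and> int_dist (t i) \<le> \<tau>"
    and sep: "\<And>i j. i \<in> S \<Longrightarrow> j \<in> S \<Longrightarrow> i \<noteq> j \<Longrightarrow> \<delta> \<le> int_dist (t i - t j)"
  shows "(\<Sum>i\<in>S. 1 / int_dist (t i)) \<le> 2 / \<delta> * (1 + ln (max 1 (\<tau> / \<delta>)))"
proof (cases "S = {}")
  case True thus ?thesis using \<delta> by simp
next
  case False
  define R where "R = nat \<lfloor>\<tau> / \<delta>\<rfloor>"
  define r where "r i = nat \<lfloor>int_dist (t i) / \<delta>\<rfloor>" for i
  \<comment> \<open>The pair (r, \<open>\<sigma>\<close>) records the interval and the side of the nearest integer.\<close>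
  define \<sigma> where "\<sigma> i = (t i \<ge> of_int (round (t i)))" for i
  have r: "1 \<le> r i" "r i \<le> R" "real (r i) \<le> int_dist (t i) / \<delta>" "int_dist (t i) / \<delta> < real (r i) + 1" if "i \<in> S" for i
  proof -
    have 1: "1 \<le> int_dist (t i) / \<delta>" using range[OF that] \<delta> by (simp add: field_simps)
    show "1 \<le> r i" "real (r i) \<le> int_dist (t i) / \<delta>" "int_dist (t i) / \<delta> < real (r i) + 1"
      unfolding r_def using 1 by linarith+
    show "r i \<le> R" unfolding r_def R_def using range[OF that] \<delta>
      by (intro nat_mono floor_mono divide_right_mono) auto
  qed
  obtain i0 where "i0 \<in> S" using False by auto
  hence R1: "R \<ge> 1" using r(1,2)[of i0] by linarith
  hence R2: "real R \<le> max 1 (\<tau> / \<delta>)" unfolding R_def by linarith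
  have inj: "inj_on (\<lambda>i. (r i, \<sigma> i)) S"
  proof (rule inj_onI, rule ccontr)
    fix i j assume ij: "i \<in> S" "j \<in> S" "(r i, \<sigma> i) = (r j, \<sigma> j)" "i \<noteq> j"
    have "\<delta> \<le> \<bar>(t i - t j) - of_int (round (t i) - round (t j))\<bar>"
      using sep[OF ij(1,2,4)] int_dist_le order_trans by blast
    also have "\<dots> = \<bar>int_dist (t i) - int_dist (t j)\<bar>"
      using ij(3) unfolding \<sigma>_def int_dist_def by auto
    also have "\<dots> < \<delta>"
    proof -
      have "\<bar>int_dist (t i) / \<delta> - int_dist (t j) / \<delta>\<bar> < 1"
        using r(3,4)[OF ij(1)] r(3,4)[OF ij(2)] ij(3) by auto
      hence "\<bar>(int_dist (t i) - int_dist (t j)) / \<delta>\<bar> < 1" by (simp add: diff_divide_distrib)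
      thus ?thesis using \<delta> by (simp add: abs_divide)
    qed
    finally show False by simp
  qed
  have "(\<Sum>i\<in>S. 1 / int_dist (t i)) \<le> (\<Sum>i\<in>S. 1 / \<delta> * (1 / real (r i)))"
  proof (rule sum_mono)
    fix i assume i: "i \<in> S"
    have "\<delta> * real (r i) \<le> int_dist (t i)" using r(3)[OF i] \<delta> by (simp add: field_simps)
    moreover have "\<delta> * real (r i) > 0" using r(1)[OF i] \<delta> by auto
    ultimately have "1 / int_dist (t i) \<le> 1 / (\<delta> * real (r i))" using frac_le[of 1 1] by simp
    thus "1 / int_dist (t i) \<le> 1 / \<delta> * (1 / real (r i))" by simp
  qed
  also have "\<dots> = (\<Sum>z\<in>(\<lambda>i. (r i, \<sigma> i)) ` S. 1 / \<delta> * (1 / real (fst z)))"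
    by (simp add: sum.reindex[OF inj])
  also have "\<dots> \<le> (\<Sum>z\<in>{1..R} \<times> (UNIV :: bool set). 1 / \<delta> * (1 / real (fst z)))"
    by (rule sum_mono2) (use r \<delta> in auto)
  also have "\<dots> = (\<Sum>k=1..R. \<Sum>b\<in>(UNIV::bool set). 1 / \<delta> * (1 / real k))"
    by (subst sum.cartesian_product) (simp add: case_prod_beta)
  also have "\<dots> = 2 / \<delta> * (\<Sum>k=1..R. 1 / real k)"
    by (simp add: sum_distrib_left)
  also have "\<dots> \<le> 2 / \<delta> * (1 + ln (real R))"
    using sum_inverse_le_ln[OF R1] \<delta> by (intro mult_left_mono) auto
  also have "\<dots> \<le> 2 / \<delta> * (1 + ln (max 1 (\<tau> / \<delta>)))"
    using R1 R2 \<delta> by (intro mult_left_mono add_left_mono) auto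
  finally show ?thesis .
qed

text \<open>Within a dyadic block \<open>[N, 2N)\<close> the points \<open>m \<alpha>\<close> are \<open>1/(2 D N)\<close>-separated, because differences of indices stay
below \<open>2N\<close>; each block then contributes \<open>O(D)\<close> times a logarithm. The floor \<open>Q\<^sub>0\<close> on the size of \<open>n\<close> lets \<open>D\<close> reflect
the Diophantine quality of \<open>\<alpha>\<close> at scales between \<open>Q\<^sub>0\<close> and \<open>H\<close> alone.\<close>

lemma sum_resonances_le:
  fixes D Q\<^sub>0 \<tau> :: real and H :: nat
  assumes D: "D > 0" and Q0: "0 < Q\<^sub>0" "Q\<^sub>0 \<le> real H" and \<tau>: "\<tau> \<ge> 0"
    and far: "\<And>n. 1 \<le> n \<Longrightarrow> n \<le> 2 * H \<Longrightarrow> 1 / (D * max (real n) Q\<^sub>0) \<le> int_dist (real n * \<alpha>)"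
  shows "(\<Sum>m | 1 \<le> m \<and> m \<le> H \<and> Q\<^sub>0 \<le> real m \<and> int_dist (real m * \<alpha>) \<le> \<tau>.
             1 / (real m * int_dist (real m * \<alpha>)))
         \<le> 4 * D * (1 + ln (max 1 (2 * D * real H * \<tau>))) * (2 + log 2 (real H / Q\<^sub>0))"
    (is "sum ?h ?S \<le> ?B * _")
proof -
  define lv where "lv = (\<lambda>m::nat. \<lfloor>log 2 (real m)\<rfloor>)"
  define I where "I = {\<lfloor>log 2 Q\<^sub>0\<rfloor>..\<lfloor>log 2 (real H)\<rfloor>}"
  have fin: "finite ?S" by (rule finite_subset[of _ "{..H}"]) auto
  have B0: "?B \<ge> 0" using D by (intro mult_nonneg_nonneg add_nonneg_nonneg) auto
  have sub: "lv ` ?S \<subseteq> I"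
  proof
    fix i assume "i \<in> lv ` ?S"
    then obtain m where m: "m \<in> ?S" "i = lv m" by auto
    thus "i \<in> I" using Q0 unfolding I_def lv_def by (auto intro!: floor_mono)
  qed
  have "sum ?h ?S = (\<Sum>i\<in>I. sum ?h {m \<in> ?S. lv m = i})"
    by (rule sum.group[symmetric]) (use fin sub in \<open>auto simp: I_def\<close>)
  also have "\<dots> \<le> (\<Sum>i\<in>I. ?B)"
  proof (rule sum_mono)
    fix i assume i: "i \<in> I"
    show "sum ?h {m \<in> ?S. lv m = i} \<le> ?B"
    proof (cases "{m \<in> ?S. lv m = i} = {}")
      case True thus ?thesis using B0 by (simp only: sum.empty)
    next
      case False
      then obtain m0 where m0: "m0 \<in> ?S" "lv m0 = i" by auto
      have i0: "i \<ge> 0" using m0 by (auto simp: lv_def)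
      define N :: nat where "N = 2 ^ nat i"
      have N: "N \<le> m \<and> m < 2 * N" if "m \<in> ?S" "lv m = i" for m
      proof -
        have "real_of_int i \<le> log 2 (real m)" "log 2 (real m) < real_of_int i + 1"
          using that unfolding lv_def by linarith+
        hence "2 powr i \<le> real m" "real m < 2 powr (i + 1)"
          using that by (auto simp: le_log_iff log_less_iff)
        hence "real N \<le> real m" "real m < 2 * real N"
          using i0 by (auto simp: N_def powr_add powr_real_of_int)
        thus ?thesis by linarith
      qed
      have N1: "N \<ge> 1" by (simp add: N_def)
      have NH: "N \<le> H" using N[OF m0] m0 by auto
      have Q2: "Q\<^sub>0 < 2 * real N"
      proof -
        have "log 2 Q\<^sub>0 < real_of_int i + 1" using i unfolding I_def by (simp, linarith)
        hence "Q\<^sub>0 < 2 powr (i + 1)" using Q0 by (simp add: log_less_iff)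
        thus ?thesis using i0 by (simp add: N_def powr_add powr_real_of_int)
      qed
      define \<delta> where "\<delta> = 1 / (2 * D * real N)"
      have \<delta>: "\<delta> > 0" using D N1 by (simp add: \<delta>_def)
      have far': "\<delta> \<le> int_dist (real n * \<alpha>)" if "1 \<le> n" "n \<le> 2 * N" for n
      proof -
        have "D * max (real n) Q\<^sub>0 \<le> D * (2 * real N)" using Q2 that D by (intro mult_left_mono) auto
        moreover have "D * max (real n) Q\<^sub>0 > 0" using D that by (intro mult_pos_pos) auto
        ultimately have "\<delta> \<le> 1 / (D * max (real n) Q\<^sub>0)" unfolding \<delta>_def
          using frac_le[of 1 1 "D * max (real n) Q\<^sub>0" "2 * D * real N"] by (simp add: mult_ac)
        also have "\<dots> \<le> int_dist (real n * \<alpha>)" using that NH by (intro far) auto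
        finally show ?thesis .
      qed
      have "sum ?h {m \<in> ?S. lv m = i} \<le> (\<Sum>m | m \<in> ?S \<and> lv m = i. 1 / real N * (1 / int_dist (real m * \<alpha>)))"
      proof (rule sum_mono)
        fix m assume m: "m \<in> {m \<in> ?S. lv m = i}"
        have "1 / real m \<le> 1 / real N" using N[of m] m N1 by (intro divide_left_mono) auto
        hence "1 / real m * (1 / int_dist (real m * \<alpha>)) \<le> 1 / real N * (1 / int_dist (real m * \<alpha>))"
          by (intro mult_right_mono) auto
        thus "?h m \<le> 1 / real N * (1 / int_dist (real m * \<alpha>))" by simp
      qed
      also have "\<dots> = 1 / real N * (\<Sum>m | m \<in> ?S \<and> lv m = i. 1 / int_dist (real m * \<alpha>))"
        by (simp add: sum_distrib_left)
      also have "\<dots> \<le> 1 / real N * (2 / \<delta> * (1 + ln (max 1 (\<tau> / \<delta>))))"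
      proof (intro mult_left_mono sum_inverse_int_dist_le)
        fix m assume m: "m \<in> {m. m \<in> ?S \<and> lv m = i}"
        show "\<delta> \<le> int_dist (real m * \<alpha>) \<and> int_dist (real m * \<alpha>) \<le> \<tau>"
          using m N[of m] far'[of m] by auto
        fix m' assume m': "m' \<in> {m. m \<in> ?S \<and> lv m = i}" and ne: "m \<noteq> m'"
        have b: "N \<le> m \<and> m < 2 * N" "N \<le> m' \<and> m' < 2 * N" using N m m' by auto
        show "\<delta> \<le> int_dist (real m * \<alpha> - real m' * \<alpha>)"
        proof (cases "m' < m")
          case True
          hence "real m * \<alpha> - real m' * \<alpha> = real (m - m') * \<alpha>" by (simp add: of_nat_diff algebra_simps)
          thus ?thesis using far'[of "m - m'"] True b by simp
        next
          case False
          hence "real m * \<alpha> - real m' * \<alpha> = - (real (m' - m) * \<alpha>)" by (simp add: of_nat_diff algebra_simps)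
          thus ?thesis using far'[of "m' - m"] False ne b by simp
        qed
      qed (use fin \<delta> in auto)
      also have "\<dots> = 4 * D * (1 + ln (max 1 (2 * D * real N * \<tau>)))"
        using N1 D by (simp add: \<delta>_def field_simps)
      also have "\<dots> \<le> ?B"
        using D \<tau> NH by (intro mult_left_mono add_left_mono ln_mono max.mono) (auto intro!: mult_left_mono mult_right_mono)
      finally show ?thesis .
    qed
  qed
  also have "\<dots> = ?B * real (card I)" by simp
  also have "\<dots> \<le> ?B * (2 + log 2 (real H / Q\<^sub>0))"
  proof (rule mult_left_mono[OF _ B0])
    have "log 2 Q\<^sub>0 \<le> log 2 (real H)" using Q0 by simp
    hence "real (card I) = real_of_int (\<lfloor>log 2 (real H)\<rfloor> - \<lfloor>log 2 Q\<^sub>0\<rfloor> + 1)"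
      using floor_mono[of "log 2 Q\<^sub>0" "log 2 (real H)"] by (simp add: I_def)
    also have "\<dots> \<le> log 2 (real H) - log 2 Q\<^sub>0 + 2" by linarith
    also have "\<dots> = 2 + log 2 (real H / Q\<^sub>0)" using Q0 by (simp add: log_divide)
    finally show "real (card I) \<le> 2 + log 2 (real H / Q\<^sub>0)" .
  qed
  finally show ?thesis .
qed

lemma sum_symmetric_int:
  fixes h :: "int \<Rightarrow> real"
  assumes "\<And>m. h (- m) = h m"
  shows "(\<Sum>m | m \<noteq> 0 \<and> \<bar>m\<bar> \<le> int H. h m) = 2 * (\<Sum>n=1..H. h (int n))"
proof -
  have e: "{m::int. m \<noteq> 0 \<and> \<bar>m\<bar> \<le> int H} = int ` {1..H} \<union> (\<lambda>n. - int n) ` {1..H}"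
  proof (intro equalityI subsetI)
    fix m assume "m \<in> {m::int. m \<noteq> 0 \<and> \<bar>m\<bar> \<le> int H}"
    hence "m \<in> int ` {1..H} \<or> - m \<in> int ` {1..H}"
      by (cases "m > 0") (auto simp: image_iff intro!: bexI[of _ "nat \<bar>m\<bar>"])
    thus "m \<in> int ` {1..H} \<union> (\<lambda>n. - int n) ` {1..H}" by force
  qed auto
  have "(\<Sum>m | m \<noteq> 0 \<and> \<bar>m\<bar> \<le> int H. h m) = sum h (int ` {1..H}) + sum h ((\<lambda>n. - int n) ` {1..H})"
    unfolding e by (rule sum.union_disjoint) auto
  also have "sum h (int ` {1..H}) = (\<Sum>n=1..H. h (int n))" by (subst sum.reindex) (auto simp: inj_on_def)
  also have "sum h ((\<lambda>n. - int n) ` {1..H}) = (\<Sum>n=1..H. h (int n))"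
    by (subst sum.reindex) (auto simp: inj_on_def assms)
  finally show ?thesis by simp
qed

section \<open>Periodic functions of bounded variation\<close>

lemma partition_variations_nonempty:
  assumes "a \<le> b" shows "partition_variations f a b \<noteq> {}"
proof -
  have "(\<Sum>i<(1::nat). \<bar>f ((\<lambda>i. if i = 0 then a else b) (Suc i)) - f ((\<lambda>i. if i = 0 then a else b) i)\<bar>) \<in> partition_variations f a b"
    unfolding partition_variations_def using assms
    by (intro CollectI exI[of _ "1::nat"] exI[of _ "\<lambda>i::nat. if i = 0 then a else b"]) simp
  thus ?thesis by blast
qed

lemma partition_variations_append:
  assumes "s \<in> partition_variations f a x" "x \<le> y"
  shows "s + \<bar>f y - f x\<bar> \<in> partition_variations f a y"
proof -
  obtain n t where t: "s = (\<Sum>i<n. \<bar>f (t (Suc i)) - f (t i)\<bar>)" "t 0 = a" "t n = x"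
      "\<forall>i<n. t i \<le> t (Suc i)"
    using assms(1) unfolding partition_variations_def by blast
  define t' where "t' = (\<lambda>i. if i \<le> n then t i else y)"
  have "(\<Sum>i<Suc n. \<bar>f (t' (Suc i)) - f (t' i)\<bar>) = s + \<bar>f y - f x\<bar>"
    using t(3) by (simp add: t(1) t'_def)
  moreover have "t' 0 = a" "t' (Suc n) = y" using t by (auto simp: t'_def)
  moreover have "\<forall>i<Suc n. t' i \<le> t' (Suc i)"
    using t assms(2) by (auto simp: t'_def less_Suc_eq)
  ultimately show ?thesis
    unfolding partition_variations_def
    by (intro CollectI exI[of _ "Suc n"] exI[of _ t']) simp
qed

lemma bounded_variation_initial:
  assumes "bounded_variation f a b" "x \<le> b"
  shows "bounded_variation f a x"
proof -
  have "s \<le> total_variation f a b" if "s \<in> partition_variations f a x" for s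
  proof -
    have "s + \<bar>f b - f x\<bar> \<le> total_variation f a b"
      unfolding total_variation_def
      using partition_variations_append[OF that assms(2)] assms(1)
      by (intro cSup_upper) (auto simp: bounded_variation_def)
    thus ?thesis by linarith
  qed
  thus ?thesis unfolding bounded_variation_def by (rule bdd_aboveI)
qed

lemma abs_diff_le_total_variation_diff:
  assumes "bounded_variation f a b" "a \<le> x" "x \<le> y" "y \<le> b"
  shows "\<bar>f y - f x\<bar> \<le> total_variation f a y - total_variation f a x"
proof -
  have "total_variation f a x \<le> total_variation f a y - \<bar>f y - f x\<bar>"
    unfolding total_variation_def[of f a x]
  proof (rule cSup_least)
    show "partition_variations f a x \<noteq> {}" by (rule partition_variations_nonempty[OF assms(2)])
    fix s assume "s \<in> partition_variations f a x"
    from partition_variations_append[OF this assms(3)]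
    have "s + \<bar>f y - f x\<bar> \<le> total_variation f a y"
      unfolding total_variation_def
      using bounded_variation_initial[OF assms(1,4)]
      by (intro cSup_upper) (auto simp: bounded_variation_def)
    thus "s \<le> total_variation f a y - \<bar>f y - f x\<bar>" by simp
  qed
  thus ?thesis by simp
qed

lemma total_variation_refl: "total_variation f a a = 0"
proof -
  have "s = 0" if s: "s \<in> partition_variations f a a" for s
  proof -
    obtain n t where t: "s = (\<Sum>i<n. \<bar>f (t (Suc i)) - f (t i)\<bar>)" "t 0 = a" "t n = a"
      "\<forall>i<n. t i \<le> t (Suc i)"
      using s unfolding partition_variations_def by blast
    have up: "i \<le> n \<Longrightarrow> a \<le> t i" for i
      by (induction i) (use t in \<open>auto intro: order_trans[OF _ t(4)[rule_format]]\<close>)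
    have "i \<le> n \<Longrightarrow> t (n - i) \<le> a" for i
    proof (induction i)
      case (Suc i)
      have "t (n - Suc i) \<le> t (Suc (n - Suc i))" using t(4) Suc.prems by auto
      moreover have "Suc (n - Suc i) = n - i" using Suc.prems by auto
      ultimately show ?case using Suc by auto
    qed (use t in simp)
    from this[of "n - _"] have down: "i \<le> n \<Longrightarrow> t i \<le> a" for i
      using diff_diff_cancel[of i n] by (metis diff_le_self)
    have "t i = a" if "i \<le> n" for i using up[OF that] down[OF that] by simp
    thus ?thesis by (simp add: t(1))
  qed
  hence "partition_variations f a a = {0}"
    using partition_variations_nonempty[of a a f] by blast
  thus ?thesis by (simp add: total_variation_def)
qed

text \<open>The variation of a 1-periodic function between \<open>0\<close> and \<open>x\<close>, continued to the whole line so that it is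
monotone and grows by \<open>V\<close> over each period.\<close>

definition periodic_variation :: "(real \<Rightarrow> real) \<Rightarrow> real \<Rightarrow> real" where
  "periodic_variation f x = total_variation f 0 (frac x) + total_variation f 0 1 * of_int \<lfloor>x\<rfloor>"

lemma periodic_of_int:
  fixes f :: "real \<Rightarrow> 'a"
  assumes "\<And>x. f (x + 1) = f x"
  shows "f (x + of_int n) = f x"
proof -
  have nat: "f (x + real n) = f x" for x and n :: nat
  proof (induction n)
    case (Suc n)
    have "f (x + real (Suc n)) = f ((x + real n) + 1)" by (simp add: add_ac)
    thus ?case using Suc assms by metis
  qed simp
  show ?thesis
  proof (cases "n \<ge> 0")
    case True thus ?thesis using nat[of x "nat n"] by simp
  next
    case False thus ?thesis using nat[of "x + of_int n" "nat (-n)"] by simp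
  qed
qed

text \<open>The intervals \<open>[x, x + y]\<close> do not overlap, so the increments of a monotone function over them telescope.\<close>

lemma sum_mono_increments_le:
  fixes g :: "real \<Rightarrow> real"
  assumes "mono g" "finite S" "0 \<le> y" "\<And>x x'. x \<in> S \<Longrightarrow> x' \<in> S \<Longrightarrow> x \<noteq> x' \<Longrightarrow> y \<le> \<bar>x - x'\<bar>"
    "\<And>x. x \<in> S \<Longrightarrow> a \<le> x" "\<And>x. x \<in> S \<Longrightarrow> x + y \<le> b" "a \<le> b"
  shows "(\<Sum>x\<in>S. g (x + y) - g x) \<le> g b - g a"
  using assms(2,4-7)
proof (induction S arbitrary: b rule: finite_linorder_max_induct)
  case empty
  thus ?case using monoD[OF assms(1)] by simp
next
  case (insert z S)
  have "(\<Sum>x\<in>S. g (x + y) - g x) \<le> g z - g a"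
  proof (rule insert.IH)
    fix x assume x: "x \<in> S"
    have "x < z" using insert.hyps x by auto
    hence "y \<le> \<bar>x - z\<bar>" by (intro insert.prems(1)) (use x in auto)
    thus "x + y \<le> z" using \<open>x < z\<close> by linarith
  qed (use insert.prems in auto)
  moreover have "g (z + y) \<le> g b" using insert.prems(3)[of z] monoD[OF assms(1)] by auto
  moreover have "(\<Sum>x\<in>insert z S. g (x + y) - g x) = (\<Sum>x\<in>S. g (x + y) - g x) + (g (z + y) - g z)"
    using insert.hyps by (subst sum.insert) auto
  ultimately show ?case by linarith
qed

locale bv_periodic =
  fixes f :: "real \<Rightarrow> real"
  assumes periodic: "f (x + 1) = f x"
    and bv: "bounded_variation f 0 1"
begin

abbreviation "V \<equiv> total_variation f 0 1"
abbreviation "v \<equiv> periodic_variation f"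

lemma periodic_frac: "f (frac x) = f x"
  using periodic_of_int[of f "frac x" "\<lfloor>x\<rfloor>"] periodic by (simp add: frac_def)

lemma v_add_1: "v (x + 1) = v x + V"
  by (simp add: periodic_variation_def algebra_simps frac_def)

lemma V_nonneg: "V \<ge> 0"
  using abs_diff_le_total_variation_diff[OF bv, of 0 1] total_variation_refl[of f 0] by simp

text \<open>All later uses of bounded variation go through this domination by the increments of one monotone function.\<close>

lemma abs_diff_le_v:
  assumes "x \<le> y" shows "\<bar>f y - f x\<bar> \<le> v y - v x"
proof -
  define m n where "m = \<lfloor>x\<rfloor>" and "n = \<lfloor>y\<rfloor>"
  have mn: "m \<le> n" using assms by (simp add: m_def n_def floor_mono)
  have fx: "frac x = x - m" "frac y = y - n" by (auto simp: frac_def m_def n_def)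
  have b: "0 \<le> frac x" "frac x \<le> 1" "0 \<le> frac y" "frac y \<le> 1"
    by (auto simp: less_imp_le[OF frac_lt_1])
  have vx: "v x = total_variation f 0 (frac x) + V * m" "v y = total_variation f 0 (frac y) + V * n"
    by (auto simp: periodic_variation_def m_def n_def)
  show ?thesis
  proof (cases "m = n")
    case True
    hence "frac x \<le> frac y" using fx assms by simp
    from abs_diff_le_total_variation_diff[OF bv b(1) this b(4)] True
    show ?thesis by (simp add: vx periodic_frac)
  next
    case False
    hence n1: "n - m \<ge> 1" using mn by linarith
    have f01: "f 1 = f 0" using periodic[of 0] by simp
    have "\<bar>f 1 - f (frac x)\<bar> \<le> V - total_variation f 0 (frac x)"
      using abs_diff_le_total_variation_diff[OF bv b(1) b(2)] by simp
    moreover have "\<bar>f (frac y) - f 0\<bar> \<le> total_variation f 0 (frac y)"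
      using abs_diff_le_total_variation_diff[OF bv order_refl b(3,4)] total_variation_refl[of f 0] by simp
    moreover have "V * (real_of_int (n - m)) \<ge> V * 1"
      using n1 V_nonneg by (intro mult_left_mono) (auto simp del: of_int_diff)
    ultimately show ?thesis using f01 by (simp add: vx periodic_frac algebra_simps)
  qed
qed

lemma v_mono: "mono v"
  using abs_diff_le_v by (fastforce intro: monoI)

lemma borel_measurable_v: "v \<in> borel_measurable borel"
  by (rule borel_measurable_mono[OF v_mono])

text \<open>Both \<open>v\<close> and \<open>v - f\<close> are monotone.\<close>

lemma borel_measurable_f [measurable]: "f \<in> borel_measurable borel"
proof -
  have "mono (\<lambda>x. v x - f x)"
    using abs_diff_le_v by (fastforce intro: monoI)
  hence "(\<lambda>x. v x - f x) \<in> borel_measurable borel" by (rule borel_measurable_mono)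
  hence "(\<lambda>x. v x - (v x - f x)) \<in> borel_measurable borel" using borel_measurable_v by measurable
  thus ?thesis by simp
qed

lemma abs_diff_le_V: "\<bar>f y - f x\<bar> \<le> V"
proof -
  define y' where "y' = y + of_int \<lceil>x - y\<rceil>"
  have "x \<le> y'" "y' \<le> x + 1" unfolding y'_def by linarith+
  have "\<bar>f y' - f x\<bar> \<le> v y' - v x" by (rule abs_diff_le_v) fact
  also have "\<dots> \<le> v (x + 1) - v x" using \<open>y' \<le> x + 1\<close> monoD[OF v_mono] by auto
  finally show ?thesis using periodic_of_int[of f y "\<lceil>x - y\<rceil>"] periodic by (simp add: y'_def v_add_1)
qed

lemma f_bounded: "\<bar>f x\<bar> \<le> \<bar>f 0\<bar> + V"
  using abs_diff_le_V[of x 0] by linarith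

text \<open>Translating by \<open>y\<close> not exceeding the separation sweeps out arcs that do not overlap, so the increments of \<open>v\<close> over
them add up to at most its growth over one period.\<close>

lemma sum_shift_le_V:
  fixes x :: "'i \<Rightarrow> real"
  assumes I: "finite I" and sep: "\<And>i j. i \<in> I \<Longrightarrow> j \<in> I \<Longrightarrow> i \<noteq> j \<Longrightarrow> \<delta> \<le> int_dist (x i - x j)"
    and \<delta>: "0 < \<delta>" "\<delta> \<le> 1" and y: "0 \<le> y" "y \<le> \<delta>"
  shows "(\<Sum>i\<in>I. \<bar>f (x i + y) - f (x i)\<bar>) \<le> V"
proof (cases "I = {}")
  case False
  define z where "z = (\<lambda>i. frac (x i))"
  have far: "\<delta> \<le> \<bar>z i - z j + of_int n\<bar>" if "i \<in> I" "j \<in> I" "i \<noteq> j" for i j n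
  proof -
    have "\<delta> \<le> int_dist (x i - x j)" using sep that by blast
    also have "\<dots> \<le> \<bar>(x i - x j) - of_int (\<lfloor>x i\<rfloor> - \<lfloor>x j\<rfloor> - n)\<bar>" by (rule int_dist_le)
    finally show ?thesis by (simp add: z_def frac_def algebra_simps)
  qed
  have inj: "inj_on z I"
  proof (rule inj_onI, rule ccontr)
    fix i j assume "i \<in> I" "j \<in> I" "z i = z j" "i \<noteq> j"
    thus False using far[of i j 0] \<delta> by simp
  qed
  have fz: "f (x i + y) = f (z i + y)" "f (x i) = f (z i)" for i
    using periodic_of_int[of f "z i + y" "\<lfloor>x i\<rfloor>"] periodic_of_int[of f "z i" "\<lfloor>x i\<rfloor>"] periodic
    by (auto simp: z_def frac_def algebra_simps)
  \<comment> \<open>Cutting the circle at one of the points keeps every arc inside one fundamental interval.\<close>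
  define a where "a = Min (z ` I)"
  have a: "a \<in> z ` I" "\<And>i. i \<in> I \<Longrightarrow> a \<le> z i"
    using I False unfolding a_def by (auto intro!: Min_in)
  have "(\<Sum>i\<in>I. \<bar>f (x i + y) - f (x i)\<bar>) \<le> (\<Sum>i\<in>I. v (z i + y) - v (z i))"
    unfolding fz by (intro sum_mono abs_diff_le_v) (use y in auto)
  also have "\<dots> = (\<Sum>t\<in>z ` I. v (t + y) - v t)"
    by (simp add: sum.reindex[OF inj])
  also have "\<dots> \<le> v (a + 1) - v a"
  proof (rule sum_mono_increments_le[OF v_mono])
    fix s t assume st: "s \<in> z ` I" "t \<in> z ` I" "s \<noteq> t"
    then obtain i j where "i \<in> I" "j \<in> I" "s = z i" "t = z j" "i \<noteq> j" by auto
    thus "y \<le> \<bar>s - t\<bar>" using far[of i j 0] y by simp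
  next
    fix t assume t: "t \<in> z ` I"
    then obtain i where i: "i \<in> I" "t = z i" by auto
    obtain j where j: "j \<in> I" "a = z j" using a by auto
    show "t + y \<le> a + 1"
    proof (cases "i = j")
      case True thus ?thesis using i j y \<delta> by simp
    next
      case False
      have "\<delta> \<le> \<bar>z j - z i + of_int 1\<bar>" using far[of j i 1] i j False by simp
      moreover have "0 \<le> z j" "z i < 1" by (auto simp: z_def frac_lt_1)
      ultimately show ?thesis using i j y by simp
    qed
  qed (use I a y in auto)
  also have "\<dots> = V" by (simp add: v_add_1)
  finally show ?thesis .
qed (use V_nonneg in simp)

text \<open>A longer translation is performed in about \<open>y/\<delta>\<close> short ones.\<close>

lemma sum_shift_le_steps:
  fixes x :: "'i \<Rightarrow> real"
  assumes I: "finite I" and sep: "\<And>i j. i \<in> I \<Longrightarrow> j \<in> I \<Longrightarrow> i \<noteq> j \<Longrightarrow> \<delta> \<le> int_dist (x i - x j)"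
    and \<delta>: "0 < \<delta>" "\<delta> \<le> 1" and y: "0 \<le> y"
  shows "(\<Sum>i\<in>I. \<bar>f (x i + y) - f (x i)\<bar>) \<le> V * (1 + y / \<delta>)"
proof (cases "y = 0")
  case False
  define J where "J = nat \<lceil>y / \<delta>\<rceil>"
  have yd: "y / \<delta> > 0" using False y \<delta> by simp
  have J: "real J \<ge> y / \<delta>" "real J \<le> 1 + y / \<delta>" "J > 0"
    unfolding J_def using yd by linarith+
  define s where "s = y / real J"
  have s: "0 \<le> s" "s \<le> \<delta>" using J y \<delta> yd by (auto simp: s_def field_simps)
  have "(\<Sum>i\<in>I. \<bar>f (x i + y) - f (x i)\<bar>) \<le> (\<Sum>i\<in>I. \<Sum>l<J. \<bar>f (x i + real l * s + s) - f (x i + real l * s)\<bar>)"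
  proof (rule sum_mono)
    fix i
    have "f (x i + y) - f (x i) = (\<Sum>l<J. f (x i + real (Suc l) * s) - f (x i + real l * s))"
      using sum_lessThan_telescope[of "\<lambda>l. f (x i + real l * s)" J] J(3) by (simp add: s_def)
    also have "\<bar>\<dots>\<bar> \<le> (\<Sum>l<J. \<bar>f (x i + real (Suc l) * s) - f (x i + real l * s)\<bar>)" by (rule sum_abs)
    also have "\<dots> = (\<Sum>l<J. \<bar>f (x i + real l * s + s) - f (x i + real l * s)\<bar>)"
      by (simp add: algebra_simps)
    finally show "\<bar>f (x i + y) - f (x i)\<bar> \<le> (\<Sum>l<J. \<bar>f (x i + real l * s + s) - f (x i + real l * s)\<bar>)" .
  qed
  also have "\<dots> = (\<Sum>l<J. \<Sum>i\<in>I. \<bar>f (x i + real l * s + s) - f (x i + real l * s)\<bar>)"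
    by (rule sum.swap)
  also have "\<dots> \<le> (\<Sum>l<J. V)"
  proof (rule sum_mono)
    fix l
    show "(\<Sum>i\<in>I. \<bar>f (x i + real l * s + s) - f (x i + real l * s)\<bar>) \<le> V"
      by (rule sum_shift_le_V[where \<delta> = \<delta>]) (use I sep \<delta> s in auto)
  qed
  also have "\<dots> = V * real J" by simp
  also have "\<dots> \<le> V * (1 + y / \<delta>)" using J V_nonneg by (intro mult_left_mono)
  finally show ?thesis .
qed (use V_nonneg in simp)

lemma sum_shift_le:
  fixes x :: "'i \<Rightarrow> real"
  assumes I: "finite I" and sep: "\<And>i j. i \<in> I \<Longrightarrow> j \<in> I \<Longrightarrow> i \<noteq> j \<Longrightarrow> \<delta> \<le> int_dist (x i - x j)"
    and \<delta>: "0 < \<delta>" "\<delta> \<le> 1"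
  shows "(\<Sum>i\<in>I. \<bar>f (x i + y) - f (x i)\<bar>) \<le> V * (1 + int_dist y / \<delta>)"
proof -
  define n where "n = round y"
  have p: "f (t + of_int n) = f t" for t using periodic_of_int[of f] periodic by blast
  show ?thesis
  proof (cases "y \<ge> of_int n")
    case True
    have "f (x i + y) = f (x i + (y - of_int n))" for i using p[of "x i + (y - of_int n)"] by simp
    moreover have "int_dist y = y - of_int n" using True by (simp add: int_dist_def n_def)
    ultimately show ?thesis using sum_shift_le_steps[OF I sep \<delta>, where y = "y - of_int n"] True by simp
  next
    case False
    define s where "s = of_int n - y"
    have 1: "f (x i + y) = f (x i - s)" for i using p[of "x i - s"] by (simp add: s_def)
    have 2: "int_dist y = s" using False by (simp add: int_dist_def n_def s_def)
    have "(\<Sum>i\<in>I. \<bar>f ((x i - s) + s) - f (x i - s)\<bar>) \<le> V * (1 + s / \<delta>)"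
      by (rule sum_shift_le_steps[OF I _ \<delta>]) (use sep False in \<open>auto simp: s_def\<close>)
    thus ?thesis by (simp add: 1 2 abs_minus_commute)
  qed
qed

end

section \<open>Fourier coefficients and Fejer means\<close>

text \<open>The character \<open>e(x) = exp(2 \<pi> i x)\<close> of the circle.\<close>

definition echar :: "real \<Rightarrow> complex" where "echar x = cis (2 * pi * x)"

lemma echar_add: "echar (x + y) = echar x * echar y"
  by (simp add: echar_def cis_mult distrib_left)

lemma echar_0 [simp]: "echar 0 = 1" by (simp add: echar_def)

lemma echar_of_int [simp]: "echar (of_int n) = 1"
  unfolding echar_def by (rule cis_multiple_2pi) simp

lemma norm_echar [simp]: "norm (echar x) = 1" by (simp add: echar_def)

lemma cnj_echar: "cnj (echar x) = echar (- x)" by (simp add: echar_def cis_cnj)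

lemma echar_minus_mult [simp]: "echar (- x) * echar x = 1" "echar x * echar (- x) = 1"
  by (simp_all flip: echar_add)

lemma echar_half: "echar (1 / 2) = - 1" "echar (- (1 / 2)) = - 1" by (simp_all add: echar_def complex_eq_iff)

lemma continuous_on_echar [continuous_intros]:
  "continuous_on A g \<Longrightarrow> continuous_on A (\<lambda>x. echar (g x))"
  unfolding echar_def cis_conv_exp by (intro continuous_intros)

lemma exp_eq_echar: "exp (2 * of_real pi * \<i> * of_int m * of_real x) = echar (of_int m * x)"
  by (simp add: echar_def cis_conv_exp mult_ac)

lemma fourier_coeff_echar:
  "fourier_coeff f m = integral {0..1} (\<lambda>x. of_real (f x) * echar (- (of_int m * x)))"
  unfolding fourier_coeff_def by (simp add: echar_def cis_conv_exp mult_ac)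

lemma norm_1_minus_echar_sq: "(norm (1 - echar x))\<^sup>2 = 4 * (sin (pi * int_dist x))\<^sup>2"
proof -
  define t where "t = x - of_int (round x)"
  have "echar x = echar t"
    using echar_add[of t "of_int (round x)"] by (simp add: t_def)
  hence "(norm (1 - echar x))\<^sup>2 = (1 - cos (2 * (pi * t)))\<^sup>2 + (sin (2 * (pi * t)))\<^sup>2"
    by (simp add: echar_def cmod_power2 mult.assoc)
  also have "\<dots> = 2 * (1 - cos (2 * (pi * t)))"
  proof -
    have "(1 - c)\<^sup>2 + s\<^sup>2 = 2 * (1 - c)" if "s\<^sup>2 + c\<^sup>2 = 1" for s c :: real
      using that by (simp add: power2_eq_square algebra_simps)
    thus ?thesis using sin_cos_squared_add by blast
  qed
  also have "\<dots> = 4 * (sin (pi * t))\<^sup>2" by (simp add: cos_double_sin)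
  also have "(sin (pi * t))\<^sup>2 = (sin (pi * int_dist x))\<^sup>2"
    unfolding int_dist_def t_def[symmetric] by (cases "t \<ge> 0") auto
  finally show ?thesis .
qed

lemma x_cos_le_sin: assumes "0 \<le> x" "x \<le> pi" shows "x * cos x \<le> sin (x::real)"
proof -
  have "sin 0 - 0 * cos 0 \<le> sin x - x * cos (x::real)"
  proof (rule DERIV_nonneg_imp_nondecreasing[OF assms(1)])
    fix u :: real assume "0 \<le> u" "u \<le> x"
    hence "u * sin u \<ge> 0" using assms by (intro mult_nonneg_nonneg sin_ge_zero) auto
    moreover have "((\<lambda>x. sin x - x * cos x) has_real_derivative u * sin u) (at u)"
      by (auto intro!: derivative_eq_intros)
    ultimately show "\<exists>y. ((\<lambda>x. sin x - x * cos x) has_real_derivative y) (at u) \<and> 0 \<le> y" by blast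
  qed
  thus ?thesis by simp
qed

text \<open>The upper bound is \<open>x cos x \<le> sin x\<close>, squared and divided by \<open>x\<^sup>2 sin\<^sup>2 x\<close>. It makes the error in replacing
the squared small divisor \<open>1/|1 - e(x)|\<^sup>2\<close> by \<open>1/(2 \<pi> \<parallel>x\<parallel>)\<^sup>2\<close> bounded, uniformly in \<open>x\<close>.\<close>

lemma inverse_sin_sq_bounds:
  assumes "0 < x" "x \<le> pi / 2"
  shows "1 / x\<^sup>2 \<le> 1 / (sin x)\<^sup>2" "1 / (sin x)\<^sup>2 \<le> 1 / x\<^sup>2 + 1"
proof -
  have s: "sin x > 0" using assms by (intro sin_gt_zero) auto
  have "(sin x)\<^sup>2 \<le> x\<^sup>2" using s sin_x_le_x[of x] assms by (intro power_mono) auto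
  thus "1 / x\<^sup>2 \<le> 1 / (sin x)\<^sup>2" using s by (intro frac_le) auto
  have "0 \<le> x * cos x" using assms by (intro mult_nonneg_nonneg cos_ge_zero) auto
  hence "(x * cos x)\<^sup>2 \<le> (sin x)\<^sup>2" using x_cos_le_sin[of x] assms by (intro power_mono) auto
  hence "x\<^sup>2 * (1 - (sin x)\<^sup>2) \<le> (sin x)\<^sup>2" by (simp add: power_mult_distrib cos_squared_eq)
  thus "1 / (sin x)\<^sup>2 \<le> 1 / x\<^sup>2 + 1" using s assms by (simp add: divide_simps) (simp add: algebra_simps)
qed

lemma norm_1_minus_echar_bounds:
  assumes "int_dist x > 0"
  shows "1 / (pi\<^sup>2 * (int_dist x)\<^sup>2) \<le> 4 / (norm (1 - echar x))\<^sup>2"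
    and "4 / (norm (1 - echar x))\<^sup>2 \<le> 1 / (pi\<^sup>2 * (int_dist x)\<^sup>2) + 1"
    and "2 * int_dist x \<le> norm (1 - echar x)"
proof -
  define y where "y = pi * int_dist x"
  have y: "0 < y" "y \<le> pi / 2" using assms int_dist_le_half[of x] by (auto simp: y_def)
  have 1: "4 / (norm (1 - echar x))\<^sup>2 = 1 / (sin y)\<^sup>2" by (simp add: norm_1_minus_echar_sq y_def)
  have 2: "pi\<^sup>2 * (int_dist x)\<^sup>2 = y\<^sup>2" by (simp add: y_def power_mult_distrib)
  show "1 / (pi\<^sup>2 * (int_dist x)\<^sup>2) \<le> 4 / (norm (1 - echar x))\<^sup>2"
    "4 / (norm (1 - echar x))\<^sup>2 \<le> 1 / (pi\<^sup>2 * (int_dist x)\<^sup>2) + 1"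
    using inverse_sin_sq_bounds[OF y] unfolding 1 2 by auto
  have s: "sin y > 0" using y by (intro sin_gt_zero) auto
  have d: "0 < int_dist x" "int_dist x \<le> 1/2" using assms int_dist_le_half[of x] by auto
  have "y\<^sup>2 \<le> (1 + y\<^sup>2) * (sin y)\<^sup>2"
    using inverse_sin_sq_bounds(2)[OF y] s y by (simp add: divide_simps mult_ac split: if_splits)
  moreover have "(1 + y\<^sup>2) * (int_dist x)\<^sup>2 \<le> y\<^sup>2"
  proof -
    have "y\<^sup>2 \<le> (pi / 2)\<^sup>2" using y by (intro power_mono) auto
    moreover have "3 * 3 \<le> pi * pi" using pi_gt3 by (intro mult_mono) auto
    ultimately have "1 + y\<^sup>2 \<le> pi\<^sup>2" by (simp add: power2_eq_square)
    hence "(1 + y\<^sup>2) * (int_dist x)\<^sup>2 \<le> pi\<^sup>2 * (int_dist x)\<^sup>2" by (intro mult_right_mono) auto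
    thus ?thesis by (simp add: 2)
  qed
  ultimately have "(1 + y\<^sup>2) * (int_dist x)\<^sup>2 \<le> (1 + y\<^sup>2) * (sin y)\<^sup>2" by linarith
  hence "(int_dist x)\<^sup>2 \<le> (sin y)\<^sup>2" by (rule mult_left_le_imp_le) (auto simp: add_pos_nonneg)
  hence "(2 * int_dist x)\<^sup>2 \<le> (norm (1 - echar x))\<^sup>2"
    unfolding norm_1_minus_echar_sq y_def[symmetric] by (simp add: power_mult_distrib)
  thus "2 * int_dist x \<le> norm (1 - echar x)" by (rule power2_le_imp_le) simp
qed

lemma echar_ne_1: "int_dist x > 0 \<Longrightarrow> echar x \<noteq> 1"
  using norm_1_minus_echar_bounds(3)[of x] by auto

lemma sum_echar:
  assumes "int_dist x > 0"
  shows "(\<Sum>n=1..N. echar (real n * x)) = echar x * (1 - echar (real N * x)) / (1 - echar x)"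
proof -
  have "(1 - echar x) * (\<Sum>n=1..N. echar (real n * x)) = echar x * (1 - echar (real N * x))"
  proof (induction N)
    case (Suc N)
    define z w where "z = echar x" and "w = echar (real N * x)"
    define S where "S = (\<Sum>n=1..N. echar (real n * x))"
    have 1: "echar (real (Suc N) * x) = z * w" by (simp add: z_def w_def echar_add[symmetric] algebra_simps)
    have "(1 - z) * (S + z * w) = (1 - z) * S + (1 - z) * (z * w)" by (simp only: distrib_left)
    also have "(1 - z) * S = z * (1 - w)" using Suc by (simp only: z_def w_def S_def)
    also have "z * (1 - w) + (1 - z) * (z * w) = z * (1 - z * w)" by (simp add: algebra_simps)
    moreover have "(\<Sum>n=1..Suc N. echar (real n * x)) = S + z * w" unfolding S_def 1[symmetric] by simp
    ultimately show ?case by (simp only: 1 z_def)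
  qed simp
  thus ?thesis using echar_ne_1[OF assms] by (simp add: field_simps)
qed

lemma norm_sum_echar_le:
  assumes "int_dist x > 0"
  shows "norm (\<Sum>n=1..N. echar (real n * x)) \<le> 1 / int_dist x"
proof -
  have "norm (\<Sum>n=1..N. echar (real n * x)) = norm (1 - echar (real N * x)) / norm (1 - echar x)"
    unfolding sum_echar[OF assms] by (simp add: norm_mult norm_divide)
  also have "\<dots> \<le> 2 / (2 * int_dist x)"
    using norm_triangle_ineq4[of 1 "echar (real N * x)"] norm_1_minus_echar_bounds(3)[OF assms] assms
    by (intro frac_le) auto
  finally show ?thesis by simp
qed

lemma integrable_bounded_measurable:
  fixes g :: "real \<Rightarrow> 'a::euclidean_space"
  assumes "g \<in> borel_measurable borel" "\<And>x. x \<in> {a..b} \<Longrightarrow> norm (g x) \<le> B"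
  shows "g integrable_on {a..b}"
proof (rule measurable_bounded_by_integrable_imp_integrable)
  have "g \<in> borel_measurable lborel" using assms(1) by simp
  hence "g \<in> borel_measurable lebesgue" by (rule measurable_completion)
  thus "g \<in> borel_measurable (lebesgue_on {a..b})" by (rule measurable_restrict_space1)
  show "(\<lambda>_. B) integrable_on {a..b}" by auto
qed (use assms in auto)

lemma integral_periodic_shift:
  fixes g :: "real \<Rightarrow> 'a::euclidean_space"
  assumes per: "\<And>x. g (x + 1) = g x" and int: "\<And>a b. g integrable_on {a..b}"
  shows "integral {0..1} (\<lambda>x. g (x + t)) = integral {0..1} g"
proof -
  define s where "s = frac t"
  have s: "0 \<le> s" "s \<le> 1" using frac_lt_1[of t] by (auto simp: s_def less_imp_le)
  have "g (x + t) = g (x + s)" for x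
    using periodic_of_int[of g "x + s" "\<lfloor>t\<rfloor>"] per by (simp add: s_def frac_def)
  hence "integral {0..1} (\<lambda>x. g (x + t)) = integral {0..1} (\<lambda>x. g (x + s))" by simp
  also have "\<dots> = integral {s..1 + s} g" using integral_shift_real_ivl[where f = g and a = s and b = "1 + s" and c = s] by simp
  also have "\<dots> = integral {s..1} g + integral {1..1 + s} g"
    using Henstock_Kurzweil_Integration.integral_combine[where a = s and c = 1 and b = "1 + s" and f = g] s int by simp
  also have "integral {1..1 + s} g = integral {0..s} g"
    using integral_shift_real_ivl[where f = g and a = 1 and b = "1 + s" and c = 1] per by simp
  also have "integral {s..1} g + integral {0..s} g = integral {0..1} g"
    using Henstock_Kurzweil_Integration.integral_combine[where a = 0 and c = s and b = 1 and f = g] s int by (simp add: add.commute)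
  finally show ?thesis .
qed

lemma echar_measurable [measurable]: "echar \<in> borel_measurable borel"
  by (intro borel_measurable_continuous_onI continuous_intros)

lemma integral_echar:
  "integral {0..1} (\<lambda>y. echar (of_int m * y)) = (if m = 0 then 1 else 0)"
proof (cases "m = 0")
  case False
  define g where "g = (\<lambda>y::real. echar (of_int m * y))"
  have cont: "continuous_on A g" for A unfolding g_def by (intro continuous_intros)
  \<comment> \<open>Half a period of the character, so translation by h changes its sign.\<close>
  define h where "h = 1 / (2 * real_of_int m)"
  have gh: "g (y + h) = - g y" for y
    using False by (simp add: g_def h_def distrib_left echar_add echar_half)
  have "integral {0..1} (\<lambda>y. g (y + h)) = integral {0..1} g"
  proof (rule integral_periodic_shift)
    show "g (x + 1) = g x" for x by (simp add: g_def distrib_left echar_add)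
    show "g integrable_on {a..b}" for a b by (rule integrable_continuous_real[OF cont])
  qed
  hence "- integral {0..1} g = integral {0..1} g" by (simp add: gh)
  hence "integral {0..1} g = 0" by (simp add: neg_eq_iff_add_eq_0 flip: mult_2)
  thus ?thesis using False by (simp add: g_def)
qed simp

text \<open>Counting the representations of \<open>m\<close> as a difference produces the triangular Fejer weights.\<close>

lemma sum_differences:
  fixes g :: "int \<Rightarrow> complex"
  shows "(\<Sum>j<H. \<Sum>l<H. g (int j - int l)) = (\<Sum>m | \<bar>m\<bar> \<le> int H. of_int (int H - \<bar>m\<bar>) * g m)"
proof (induction H)
  case 0
  have "{m::int. \<bar>m\<bar> \<le> int 0} = {0}" by auto
  thus ?case by simp
next
  case (Suc H)
  have fin: "finite {m::int. \<bar>m\<bar> \<le> int H}"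
    by (rule finite_subset[of _ "{- int H..int H}"]) auto
  have split: "{m::int. \<bar>m\<bar> \<le> int (Suc H)} = insert (int (Suc H)) (insert (- int (Suc H)) {m. \<bar>m\<bar> \<le> int H})" by auto
  have "(\<Sum>m | \<bar>m\<bar> \<le> int (Suc H). of_int (int (Suc H) - \<bar>m\<bar>) * g m)
      = (\<Sum>m | \<bar>m\<bar> \<le> int H. of_int (int (Suc H) - \<bar>m\<bar>) * g m)"
    unfolding split by (subst sum.insert; (use fin in simp)?)+
  also have "\<dots> = (\<Sum>m | \<bar>m\<bar> \<le> int H. of_int (int H - \<bar>m\<bar>) * g m + g m)"
    by (intro sum.cong) (auto simp: algebra_simps)
  also have "\<dots> = (\<Sum>j<H. \<Sum>l<H. g (int j - int l)) + (\<Sum>m | \<bar>m\<bar> \<le> int H. g m)"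
    using Suc by (simp add: sum.distrib)
  also have "(\<Sum>m | \<bar>m\<bar> \<le> int H. g m) = (\<Sum>l<Suc H. g (int H - int l)) + (\<Sum>j<H. g (int j - int H))"
  proof -
    have e: "{m::int. \<bar>m\<bar> \<le> int H} = (\<lambda>l. int H - int l) ` {..<Suc H} \<union> (\<lambda>j. int j - int H) ` {..<H}"
    proof (intro equalityI subsetI)
      fix m assume m: "m \<in> {m::int. \<bar>m\<bar> \<le> int H}"
      show "m \<in> (\<lambda>l. int H - int l) ` {..<Suc H} \<union> (\<lambda>j. int j - int H) ` {..<H}"
      proof (cases "m \<ge> 0")
        case True
        hence "m = int H - int (nat (int H - m))" "nat (int H - m) < Suc H" using m by auto
        thus ?thesis by blast
      next
        case False
        hence "m = int (nat (m + int H)) - int H" "nat (m + int H) < H" using m by auto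
        thus ?thesis by blast
      qed
    qed auto
    show ?thesis unfolding e
      by (subst sum.union_disjoint) (auto simp: sum.reindex inj_on_def)
  qed
  finally show ?case by (simp add: sum.distrib algebra_simps)
qed

definition fejer :: "nat \<Rightarrow> real \<Rightarrow> real" where
  "fejer H y = (norm (\<Sum>j<H. echar (real j * y)))\<^sup>2 / real H"

definition fejer_weight :: "nat \<Rightarrow> int \<Rightarrow> real" where
  "fejer_weight H m = 1 - real_of_int \<bar>m\<bar> / real H"

lemma fejer_eq_sum:
  assumes "H \<ge> 1"
  shows "complex_of_real (fejer H y) = (\<Sum>m | \<bar>m\<bar> \<le> int H. of_real (fejer_weight H m) * echar (- (of_int m * y)))"
proof -
  define Z where "Z = (\<Sum>j<H. echar (real j * y))"
  have "complex_of_real ((norm Z)\<^sup>2) = cnj Z * Z" by (metis complex_norm_square mult.commute)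
  also have "\<dots> = (\<Sum>j<H. \<Sum>l<H. echar (- (of_int (int j - int l) * y)))"
    unfolding Z_def cnj_sum cnj_echar sum_product
    by (intro sum.cong refl) (simp add: echar_add[symmetric] algebra_simps)
  also have "\<dots> = (\<Sum>m | \<bar>m\<bar> \<le> int H. of_int (int H - \<bar>m\<bar>) * echar (- (of_int m * y)))"
    by (rule sum_differences[of "\<lambda>m. echar (- (of_int m * y))"])
  finally have "complex_of_real (fejer H y) = (\<Sum>m | \<bar>m\<bar> \<le> int H. of_int (int H - \<bar>m\<bar>) * echar (- (of_int m * y))) / of_nat H"
    by (simp add: fejer_def Z_def)
  also have "\<dots> = (\<Sum>m | \<bar>m\<bar> \<le> int H. of_real (fejer_weight H m) * echar (- (of_int m * y)))"
    unfolding sum_divide_distrib fejer_weight_def using assms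
    by (intro sum.cong) (auto simp: field_simps simp del: of_int_abs)
  finally show ?thesis .
qed

lemma fejer_nonneg: "fejer H y \<ge> 0" by (simp add: fejer_def)

lemma continuous_on_fejer: "continuous_on A (fejer H)"
  unfolding fejer_def by (cases "H = 0") (auto intro!: continuous_intros)

lemma integral_fejer:
  assumes "H \<ge> 1" shows "integral {0..1} (fejer H) = 1"
proof -
  have fin: "finite {m::int. \<bar>m\<bar> \<le> int H}"
    by (rule finite_subset[of _ "{- int H..int H}"]) auto
  have "complex_of_real (integral {0..1} (fejer H)) = integral {0..1} (\<lambda>y. complex_of_real (fejer H y))"
    by (rule integral_unique[symmetric], rule has_integral_of_real, rule integrable_integral,
        rule integrable_continuous_real, rule continuous_on_fejer)
  also have "\<dots> = (\<Sum>m | \<bar>m\<bar> \<le> int H. of_real (fejer_weight H m) * integral {0..1} (\<lambda>y. echar (of_int (-m) * y)))"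
    unfolding fejer_eq_sum[OF assms]
    by (subst integral_sum) (auto intro!: fin integrable_continuous_real continuous_intros)
  also have "\<dots> = (\<Sum>m | \<bar>m\<bar> \<le> int H. if m = 0 then 1 else 0)"
    unfolding integral_echar by (intro sum.cong) (auto simp: fejer_weight_def)
  also have "\<dots> = 1" using fin by (subst sum.delta) auto
  finally show ?thesis by simp
qed

text \<open>The product is at most both \<open>u\<close> and \<open>1/u\<close> for \<open>u = H \<parallel>y\<parallel>\<close>. The smooth majorant \<open>2u/(1 + u\<^sup>2)\<close> of \<open>min(u, 1/u)\<close> has an
elementary primitive, so no case distinction is left when it is integrated.\<close>

lemma fejer_mult_int_dist_le:
  assumes "H \<ge> 1"
  shows "int_dist y * fejer H y \<le> 2 * real H * int_dist y / (1 + (real H * int_dist y)\<^sup>2)"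
proof (cases "int_dist y = 0")
  case False
  hence d: "int_dist y > 0" using int_dist_nonneg[of y] by linarith
  define u where "u = real H * int_dist y"
  have u: "u > 0" using d assms by (simp add: u_def)
  have "norm (\<Sum>j<H. echar (real j * y)) \<le> (\<Sum>j<H. norm (echar (real j * y)))" by (rule norm_sum)
  hence n1: "norm (\<Sum>j<H. echar (real j * y)) \<le> real H" by simp
  have "(\<Sum>j<H. echar (real j * y)) = echar (-y) * (\<Sum>n=1..H. echar (real n * y))"
  proof -
    have "(\<Sum>n=1..H. echar (real n * y)) = (\<Sum>j<H. echar (real (Suc j) * y))"
      by (rule sum.reindex_bij_witness[of _ Suc "\<lambda>n. n - 1"]) auto
    also have "\<dots> = echar y * (\<Sum>j<H. echar (real j * y))"
      unfolding sum_distrib_left by (intro sum.cong) (auto simp: echar_add[symmetric] algebra_simps)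
    finally show ?thesis by (simp flip: mult.assoc)
  qed
  hence n2: "norm (\<Sum>j<H. echar (real j * y)) \<le> 1 / int_dist y"
    using norm_sum_echar_le[OF d, of H] by (simp add: norm_mult)
  have "fejer H y \<le> (real H)\<^sup>2 / real H"
    unfolding fejer_def using n1 by (intro divide_right_mono power_mono) auto
  hence 1: "int_dist y * fejer H y \<le> u"
    using d assms by (simp add: u_def power2_eq_square mult.commute mult_left_mono)
  have "fejer H y \<le> (1 / int_dist y)\<^sup>2 / real H"
    unfolding fejer_def using n2 by (intro divide_right_mono power_mono) auto
  hence "int_dist y * fejer H y \<le> int_dist y * ((1 / int_dist y)\<^sup>2 / real H)"
    using d by (intro mult_left_mono) auto
  also have "\<dots> = 1 / u" using d by (simp add: u_def power2_eq_square)
  finally have 2: "int_dist y * fejer H y \<le> 1 / u" .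
  have "int_dist y * fejer H y \<le> 2 * u / (1 + u\<^sup>2)"
  proof (cases "u \<le> 1")
    case True
    have "u * (1 + u\<^sup>2) \<le> u * 2" using True u by (intro mult_left_mono) (auto simp: power_le_one)
    hence "u \<le> 2 * u / (1 + u\<^sup>2)" by (simp add: pos_le_divide_eq add_pos_nonneg mult_ac)
    thus ?thesis using 1 by linarith
  next
    case False
    hence "1 * 1 \<le> u * u" by (intro mult_mono) auto
    hence "1 + u\<^sup>2 \<le> 2 * u * u" by (simp add: power2_eq_square)
    hence "1 / u \<le> 2 * u / (1 + u\<^sup>2)" using u by (simp add: divide_simps add_pos_nonneg mult_ac)
    thus ?thesis using 2 by linarith
  qed
  thus ?thesis by (simp add: u_def mult_ac)
qed simp

lemma integral_fejer_majorant:
  assumes "H \<ge> 1"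
  shows "((\<lambda>y. 2 * real H * y / (1 + (real H * y)\<^sup>2)) has_integral ln (1 + (real H)\<^sup>2) / real H) {0..1}"
proof -
  have "((\<lambda>y. 2 * real H * y / (1 + (real H * y)\<^sup>2)) has_integral
     ln (1 + (real H * 1)\<^sup>2) / real H - ln (1 + (real H * 0)\<^sup>2) / real H) {0..1}"
  proof (rule fundamental_theorem_of_calculus)
    fix y :: real assume "y \<in> {0..1}"
    have p: "1 + (real H * y)\<^sup>2 > 0" by (simp add: add_pos_nonneg)
    have "((\<lambda>y. ln (1 + (real H * y)\<^sup>2) / real H) has_real_derivative
        (1 / (1 + (real H * y)\<^sup>2) * (2 * (real H * y) * real H)) / real H) (at y within {0..1})"
      using p assms by (auto intro!: derivative_eq_intros)
    also have "(1 / (1 + (real H * y)\<^sup>2) * (2 * (real H * y) * real H)) / real H = 2 * real H * y / (1 + (real H * y)\<^sup>2)"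
      using assms by simp
    finally have "((\<lambda>y. ln (1 + (real H * y)\<^sup>2) / real H) has_real_derivative
        (2 * real H * y / (1 + (real H * y)\<^sup>2))) (at y within {0..1})" .
    thus "((\<lambda>y. ln (1 + (real H * y)\<^sup>2) / real H) has_vector_derivative
        (2 * real H * y / (1 + (real H * y)\<^sup>2))) (at y within {0..1})"
      by (simp add: has_real_derivative_iff_has_vector_derivative)
  qed simp
  thus ?thesis by simp
qed

context bv_periodic begin

lemma f_shift_mult_integrable:
  fixes g :: "real \<Rightarrow> complex"
  assumes "continuous_on UNIV g" "\<And>y. y \<in> {a..b} \<Longrightarrow> norm (g y) \<le> B"
  shows "(\<lambda>y. of_real (f (x + y)) * g y) integrable_on {a..b}"
proof (rule integrable_bounded_measurable)
  have "g \<in> borel_measurable borel" using assms(1) by (rule borel_measurable_continuous_onI)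
  thus "(\<lambda>y. complex_of_real (f (x + y)) * g y) \<in> borel_measurable borel" by measurable
  fix y assume "y \<in> {a..b}"
  thus "norm (of_real (f (x + y)) * g y) \<le> (\<bar>f 0\<bar> + V) * B"
    unfolding norm_mult norm_of_real using f_bounded[of "x + y"] assms(2) V_nonneg
    by (intro mult_mono) auto
qed

lemma f_shift_mult_integrable_real:
  assumes "continuous_on UNIV g" "\<And>y. y \<in> {a..b} \<Longrightarrow> \<bar>g y\<bar> \<le> B"
  shows "(\<lambda>y. f (x + y) * g y) integrable_on {a..b}"
proof (rule integrable_bounded_measurable)
  have "g \<in> borel_measurable borel" using assms(1) by (rule borel_measurable_continuous_onI)
  thus "(\<lambda>y. f (x + y) * g y) \<in> borel_measurable borel" by measurable
  fix y assume "y \<in> {a..b}"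
  thus "norm (f (x + y) * g y) \<le> (\<bar>f 0\<bar> + V) * B"
    unfolding real_norm_def abs_mult using f_bounded[of "x + y"] assms(2) V_nonneg
    by (intro mult_mono) auto
qed

lemma fourier_coeff_shift:
  "integral {0..1} (\<lambda>y. of_real (f (x + y)) * echar (- (of_int m * y)))
     = fourier_coeff f m * echar (of_int m * x)"
proof -
  define g where "g = (\<lambda>y. of_real (f y) * echar (- (of_int m * y)))"
  have "integral {0..1} (\<lambda>y. g (y + x)) = integral {0..1} g"
  proof (rule integral_periodic_shift)
    show "g (y + 1) = g y" for y
    proof -
      have "- (of_int m * (y + 1)) = - (of_int m * y) + of_int (- m)" by (simp add: algebra_simps)
      thus ?thesis unfolding g_def periodic by (simp only: echar_add echar_of_int mult_1_right)
    qed
    show "g integrable_on {a..b}" for a b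
      unfolding g_def using f_shift_mult_integrable[of "\<lambda>y. echar (- (of_int m * y))" a b 1 0]
      by (simp add: continuous_intros)
  qed
  hence "fourier_coeff f m = integral {0..1} (\<lambda>y. g (y + x))" by (simp add: fourier_coeff_echar g_def)
  also have "(\<lambda>y. g (y + x)) = (\<lambda>y. (of_real (f (x + y)) * echar (- (of_int m * y))) * echar (- (of_int m * x)))"
  proof
    fix y
    have "- (of_int m * (y + x)) = - (of_int m * y) + - (of_int m * x)" by (simp add: algebra_simps)
    thus "g (y + x) = (of_real (f (x + y)) * echar (- (of_int m * y))) * echar (- (of_int m * x))"
      unfolding g_def by (simp only: echar_add add.commute[of y x] mult.assoc)
  qed
  also have "integral {0..1} \<dots> = integral {0..1} (\<lambda>y. of_real (f (x + y)) * echar (- (of_int m * y))) * echar (- (of_int m * x))"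
    by (rule integral_mult_left)
  finally show ?thesis by (simp add: mult.assoc)
qed

text \<open>\<open>v(x) - V x\<close> is periodic, so its integral over a period does not change under translation.\<close>

lemma integral_increments:
  assumes "h \<ge> 0"
  shows "((\<lambda>x. v (x + h) - v x) has_integral h * V) {0..1}"
proof -
  define g where "g = (\<lambda>x. v x - V * x)"
  have intv: "(\<lambda>x. v (x + c)) integrable_on {a..b}" for a b c
  proof (rule integrable_bounded_measurable)
    show "(\<lambda>x. v (x + c)) \<in> borel_measurable borel" using borel_measurable_v by measurable
    show "norm (v (x + c)) \<le> \<bar>v (a + c)\<bar> + \<bar>v (b + c)\<bar>" if "x \<in> {a..b}" for x
    proof -
      have "v (a + c) \<le> v (x + c)" "v (x + c) \<le> v (b + c)" using that monoD[OF v_mono] by auto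
      thus ?thesis by (simp add: real_norm_def)
    qed
  qed
  have intg: "g integrable_on {a..b}" for a b
    using integrable_diff[OF intv[of 0 a b], of "\<lambda>x. V * x"] by (simp add: g_def integrable_continuous_real continuous_intros)
  have gs: "integral {0..1} (\<lambda>x. g (x + h)) = integral {0..1} g"
  proof (rule integral_periodic_shift)
    show "g (x + 1) = g x" for x by (simp add: g_def v_add_1 distrib_left)
  qed (rule intg)
  have intgh: "(\<lambda>x. g (x + h)) integrable_on {0..1}"
    using integrable_diff[OF intv[of h 0 1], of "\<lambda>x. V * (x + h)"] by (simp add: g_def integrable_continuous_real continuous_intros)
  have "((\<lambda>x. g (x + h) - g x + h * V) has_integral (integral {0..1} (\<lambda>x. g (x + h)) - integral {0..1} g + h * V)) {0..1}"
    using intgh intg has_integral_const_real[of "h * V" 0 1]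
    by (intro has_integral_add has_integral_diff) (auto simp: has_integral_integral)
  also have "(\<lambda>x. g (x + h) - g x + h * V) = (\<lambda>x. v (x + h) - v x)"
    by (simp add: g_def fun_eq_iff algebra_simps)
  finally show ?thesis by (simp add: gs)
qed

text \<open>Translation by half a period of \<open>e(m x)\<close> changes the sign of the character. Hence twice the coefficient is an
integral of increments of \<open>f\<close> over steps of length \<open>1/(2|m|)\<close>.\<close>

lemma norm_fourier_coeff_le:
  assumes "m \<noteq> 0"
  shows "norm (fourier_coeff f m) \<le> V / (4 * real_of_int \<bar>m\<bar>)"
proof -
  define h where "h = 1 / (2 * real_of_int \<bar>m\<bar>)"
  have h: "h > 0" using assms by (simp add: h_def)
  have mh: "of_int m * h = 1 / 2 \<or> of_int m * h = - (1 / 2)"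
    using assms by (cases "m > 0") (auto simp: h_def field_simps)
  hence eh: "echar (of_int m * h) = - 1" by (elim disjE) (simp_all only: echar_half)
  define E where "E = (\<lambda>y. echar (- (of_int m * y)))"
  have cont: "continuous_on UNIV E" unfolding E_def by (intro continuous_intros)
  have n1: "norm (E y) \<le> 1" for y by (simp add: E_def)
  have i0: "(\<lambda>y. of_real (f y) * E y) integrable_on {0..1}"
    using f_shift_mult_integrable[OF cont n1, where x = 0 and a = 0 and b = 1] by simp
  have ih: "(\<lambda>y. of_real (f (h + y)) * E y) integrable_on {0..1}"
    by (rule f_shift_mult_integrable[OF cont n1])
  have "2 * fourier_coeff f m = integral {0..1} (\<lambda>y. of_real (f y) * E y) - integral {0..1} (\<lambda>y. of_real (f (h + y)) * E y)"
    using fourier_coeff_shift[of h m] eh by (simp add: E_def fourier_coeff_echar)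
  also have "\<dots> = integral {0..1} (\<lambda>y. of_real (f y) * E y - of_real (f (h + y)) * E y)"
    using i0 ih by (rule integral_diff[symmetric])
  finally have "norm (2 * fourier_coeff f m) = norm (integral {0..1} (\<lambda>y. of_real (f y) * E y - of_real (f (h + y)) * E y))"
    by (rule arg_cong)
  also have "\<dots> \<le> integral {0..1} (\<lambda>y. v (y + h) - v y)"
  proof (rule integral_norm_bound_integral)
    show "(\<lambda>y. of_real (f y) * E y - of_real (f (h + y)) * E y) integrable_on {0..1}"
      using i0 ih by (rule integrable_diff)
    show "(\<lambda>y. v (y + h) - v y) integrable_on {0..1}"
      using integral_increments[of h] h by (auto simp: has_integral_iff)
    fix y :: real
    have "norm (of_real (f y) * E y - of_real (f (h + y)) * E y) = norm (of_real (f y - f (h + y)) * E y)"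
      by (simp add: left_diff_distrib)
    also have "\<dots> = \<bar>f (y + h) - f y\<bar>" by (simp add: norm_mult E_def add.commute abs_minus_commute del: of_real_diff)
    also have "\<dots> \<le> v (y + h) - v y" using h by (intro abs_diff_le_v) auto
    finally show "norm (of_real (f y) * E y - of_real (f (h + y)) * E y) \<le> v (y + h) - v y" .
  qed
  also have "\<dots> = h * V" using integral_increments[of h] h by (auto simp: has_integral_iff)
  finally show ?thesis by (simp add: norm_mult h_def field_simps)
qed

definition fejer_mean :: "nat \<Rightarrow> real \<Rightarrow> real" where
  "fejer_mean H x = integral {0..1} (\<lambda>y. f (x + y) * fejer H y)"

lemma fejer_bounded: "H \<ge> 1 \<Longrightarrow> \<bar>fejer H y\<bar> \<le> real H"
proof -
  assume H: "H \<ge> 1"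
  have "norm (\<Sum>j<H. echar (real j * y)) \<le> (\<Sum>j<H. norm (echar (real j * y)))" by (rule norm_sum)
  hence "norm (\<Sum>j<H. echar (real j * y)) \<le> real H" by simp
  hence "(norm (\<Sum>j<H. echar (real j * y)))\<^sup>2 / real H \<le> (real H)\<^sup>2 / real H"
    by (intro divide_right_mono power_mono) auto
  thus ?thesis using H by (simp add: fejer_def power2_eq_square)
qed

lemma fejer_mean_integrable: "H \<ge> 1 \<Longrightarrow> (\<lambda>y. f (x + y) * fejer H y) integrable_on {0..1}"
  by (rule f_shift_mult_integrable_real[where B = "real H"]) (auto intro: continuous_on_fejer fejer_bounded)

lemma fejer_mean_eq_sum:
  assumes "H \<ge> 1"
  shows "complex_of_real (fejer_mean H x) = (\<Sum>m | \<bar>m\<bar> \<le> int H. of_real (fejer_weight H m) * fourier_coeff f m * echar (of_int m * x))"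
proof -
  have fin: "finite {m::int. \<bar>m\<bar> \<le> int H}"
    by (rule finite_subset[of _ "{- int H..int H}"]) auto
  have int: "(\<lambda>y. complex_of_real (f (x + y)) * echar (- (of_int m * y))) integrable_on {0..1}" for m
    by (rule f_shift_mult_integrable[where B = 1]) (auto intro!: continuous_intros)
  have "complex_of_real (fejer_mean H x) = integral {0..1} (\<lambda>y. complex_of_real (f (x + y) * fejer H y))"
    unfolding fejer_mean_def
    by (rule integral_unique[symmetric], rule has_integral_of_real, rule integrable_integral, rule fejer_mean_integrable[OF assms])
  also have "(\<lambda>y. complex_of_real (f (x + y) * fejer H y))
     = (\<lambda>y. \<Sum>m | \<bar>m\<bar> \<le> int H. of_real (fejer_weight H m) * (of_real (f (x + y)) * echar (- (of_int m * y))))"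
    unfolding of_real_mult fejer_eq_sum[OF assms] sum_distrib_left by (simp add: mult_ac)
  also have "integral {0..1} \<dots> = (\<Sum>m | \<bar>m\<bar> \<le> int H. integral {0..1} (\<lambda>y. of_real (fejer_weight H m) * (of_real (f (x + y)) * echar (- (of_int m * y)))))"
    by (rule integral_sum[OF fin]) (rule integrable_on_mult_right[OF int])
  also have "\<dots> = (\<Sum>m | \<bar>m\<bar> \<le> int H. of_real (fejer_weight H m) * (fourier_coeff f m * echar (of_int m * x)))"
    by (simp add: fourier_coeff_shift)
  finally show ?thesis by (simp add: mult.assoc)
qed

text \<open>The error is an average over \<open>y\<close>, with respect to the kernel, of the change of the Birkhoff sum when all orbit
points are translated by \<open>y\<close>. That change is at most \<open>V (1 + \<parallel>y\<parallel>/\<delta>)\<close>, and the first moment of the kernel is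
\<open>O(log H / H)\<close>.\<close>

lemma birkhoff_fejer_error:
  assumes H: "H \<ge> 1" and \<delta>: "0 < \<delta>" "\<delta> \<le> 1"
    and sep: "\<And>n. 1 \<le> n \<Longrightarrow> n < N \<Longrightarrow> \<delta> \<le> int_dist (real n * \<alpha>)"
  shows "\<bar>birkhoff_sum \<alpha> f N - (\<Sum>n=1..N. fejer_mean H (real n * \<alpha>))\<bar>
           \<le> V * (1 + 2 * ln (1 + (real H)\<^sup>2) / (\<delta> * real H))"
proof -
  define \<phi> where "\<phi> = (\<lambda>y. 2 * real H * y / (1 + (real H * y)\<^sup>2))"
  have if_: "(\<lambda>y. c * fejer H y) integrable_on {0..1}" for c
    by (intro integrable_continuous_real continuous_intros continuous_on_fejer)
  have sepI: "\<delta> \<le> int_dist (real i * \<alpha> - real j * \<alpha>)" if "i \<in> {1..N}" "j \<in> {1..N}" "i \<noteq> j" for i j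
  proof (cases "j < i")
    case True
    hence "real i * \<alpha> - real j * \<alpha> = real (i - j) * \<alpha>" by (simp add: of_nat_diff algebra_simps)
    thus ?thesis using sep[of "i - j"] True that by simp
  next
    case False
    hence "real i * \<alpha> - real j * \<alpha> = - (real (j - i) * \<alpha>)" by (simp add: of_nat_diff algebra_simps)
    thus ?thesis using sep[of "j - i"] False that by simp
  qed
  have "birkhoff_sum \<alpha> f N - (\<Sum>n=1..N. fejer_mean H (real n * \<alpha>))
      = (\<Sum>n=1..N. f (real n * \<alpha>) - fejer_mean H (real n * \<alpha>))"
    by (simp add: birkhoff_sum_def sum_subtractf)
  also have "\<dots> = (\<Sum>n=1..N. integral {0..1} (\<lambda>y. f (real n * \<alpha>) * fejer H y - f (real n * \<alpha> + y) * fejer H y))"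
  proof (rule sum.cong[OF refl])
    fix n
    have "f (real n * \<alpha>) = integral {0..1} (\<lambda>y. f (real n * \<alpha>) * fejer H y)"
      by (simp add: integral_fejer[OF H])
    thus "f (real n * \<alpha>) - fejer_mean H (real n * \<alpha>) = integral {0..1} (\<lambda>y. f (real n * \<alpha>) * fejer H y - f (real n * \<alpha> + y) * fejer H y)"
      unfolding fejer_mean_def by (subst integral_diff[OF if_ fejer_mean_integrable[OF H]]) simp
  qed
  also have "\<dots> = integral {0..1} (\<lambda>y. \<Sum>n=1..N. f (real n * \<alpha>) * fejer H y - f (real n * \<alpha> + y) * fejer H y)"
    by (rule integral_sum[symmetric]) (auto intro!: integrable_diff if_ fejer_mean_integrable[OF H])
  finally have eq: "birkhoff_sum \<alpha> f N - (\<Sum>n=1..N. fejer_mean H (real n * \<alpha>)) = \<dots>" .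
  have \<phi>1: "(\<phi> has_integral ln (1 + (real H)\<^sup>2) / real H) {0..1}"
    unfolding \<phi>_def by (rule integral_fejer_majorant[OF H])
  have \<phi>2: "((\<lambda>y. \<phi> (1 - y)) has_integral ln (1 + (real H)\<^sup>2) / real H) {0..1}"
    using has_integral_affinity01[where f = \<phi> and m = "-1" and c = 1, OF \<phi>1] by simp
  have maj: "((\<lambda>y. V * fejer H y + (V / \<delta>) * (\<phi> y + \<phi> (1 - y))) has_integral
      V * 1 + (V / \<delta>) * (ln (1 + (real H)\<^sup>2) / real H + ln (1 + (real H)\<^sup>2) / real H)) {0..1}"
    using integrable_integral[OF integrable_continuous_real[OF continuous_on_fejer[of "{0..1}" H]]] integral_fejer[OF H]
    by (intro has_integral_add has_integral_mult_right \<phi>1 \<phi>2) auto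
  have "norm (integral {0..1} (\<lambda>y. \<Sum>n=1..N. f (real n * \<alpha>) * fejer H y - f (real n * \<alpha> + y) * fejer H y))
     \<le> integral {0..1} (\<lambda>y. V * fejer H y + (V / \<delta>) * (\<phi> y + \<phi> (1 - y)))"
  proof (rule integral_norm_bound_integral)
    show "(\<lambda>y. \<Sum>n=1..N. f (real n * \<alpha>) * fejer H y - f (real n * \<alpha> + y) * fejer H y) integrable_on {0..1}"
      by (rule integrable_sum) (auto intro!: integrable_diff if_ fejer_mean_integrable[OF H])
    show "(\<lambda>y. V * fejer H y + (V / \<delta>) * (\<phi> y + \<phi> (1 - y))) integrable_on {0..1}"
      using maj by (auto simp: has_integral_iff)
    fix y :: real assume y: "y \<in> {0..1}"
    have "norm (\<Sum>n=1..N. f (real n * \<alpha>) * fejer H y - f (real n * \<alpha> + y) * fejer H y)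
       \<le> (\<Sum>n=1..N. \<bar>f (real n * \<alpha> + y) - f (real n * \<alpha>)\<bar> * fejer H y)"
    proof (rule sum_norm_le)
      fix n
      have "f (real n * \<alpha>) * fejer H y - f (real n * \<alpha> + y) * fejer H y = - ((f (real n * \<alpha> + y) - f (real n * \<alpha>)) * fejer H y)"
        by (simp add: algebra_simps)
      thus "norm (f (real n * \<alpha>) * fejer H y - f (real n * \<alpha> + y) * fejer H y) \<le> \<bar>f (real n * \<alpha> + y) - f (real n * \<alpha>)\<bar> * fejer H y"
        by (simp only: real_norm_def abs_minus_cancel abs_mult abs_of_nonneg[OF fejer_nonneg] order_refl)
    qed
    also have "\<dots> = (\<Sum>n=1..N. \<bar>f (real n * \<alpha> + y) - f (real n * \<alpha>)\<bar>) * fejer H y"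
      by (simp add: sum_distrib_right)
    also have "\<dots> \<le> (V * (1 + int_dist y / \<delta>)) * fejer H y"
      by (intro mult_right_mono fejer_nonneg sum_shift_le) (use \<delta> sepI in auto)
    also have "\<dots> = V * fejer H y + (V / \<delta>) * (int_dist y * fejer H y)"
      by (simp add: algebra_simps)
    also have "int_dist y * fejer H y \<le> \<phi> y + \<phi> (1 - y)"
    proof -
      have nn: "\<phi> y \<ge> 0" "\<phi> (1 - y) \<ge> 0" using y by (auto simp: \<phi>_def)
      have "int_dist y = y \<or> int_dist y = 1 - y"
      proof (cases "y < 1/2")
        case True
        hence "round y = 0" using y by (intro round_unique) auto
        thus ?thesis using y by (simp add: int_dist_def)
      next
        case False
        hence "round y = 1" using y by (intro round_unique) auto
        thus ?thesis using y by (simp add: int_dist_def)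
      qed
      hence "int_dist y * fejer H y \<le> \<phi> y \<or> int_dist y * fejer H y \<le> \<phi> (1 - y)"
        using fejer_mult_int_dist_le[OF H, of y] by (auto simp: \<phi>_def)
      thus ?thesis using nn by linarith
    qed
    finally show "norm (\<Sum>n=1..N. f (real n * \<alpha>) * fejer H y - f (real n * \<alpha> + y) * fejer H y)
       \<le> V * fejer H y + (V / \<delta>) * (\<phi> y + \<phi> (1 - y))"
      using V_nonneg \<delta> by (simp add: mult_left_mono divide_right_mono)
  qed
  also have "\<dots> = V * (1 + 2 * ln (1 + (real H)\<^sup>2) / (\<delta> * real H))"
    using maj \<delta> H by (simp add: has_integral_iff field_simps)
  finally show ?thesis unfolding eq by simp
qed

end

section \<open>Resonances and quadratic means\<close>

text \<open>A bound, up to the factor \<open>V\<close>, for the coefficient at frequency \<open>m\<close> of a Birkhoff sum: \<open>1/|m|\<close> comes from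
the Fourier coefficient, and the distance to the nearest integer from the small divisor. At \<open>m = 0\<close> the value is \<open>0\<close>.\<close>

definition resonance :: "real \<Rightarrow> int \<Rightarrow> real" where
  "resonance \<alpha> m = 1 / (real_of_int \<bar>m\<bar> * int_dist (real_of_int m * \<alpha>))"

definition resonance_sum :: "real \<Rightarrow> nat \<Rightarrow> real" where
  "resonance_sum \<alpha> H = (\<Sum>m | m \<noteq> 0 \<and> \<bar>m\<bar> \<le> int H. resonance \<alpha> m)"

definition strong_resonance :: "real \<Rightarrow> real \<Rightarrow> int \<Rightarrow> real" where
  "strong_resonance \<alpha> \<tau> m = (if int_dist (real_of_int m * \<alpha>) < \<tau> then resonance \<alpha> m else 0)"

definition strong_resonance_sum :: "real \<Rightarrow> real \<Rightarrow> nat \<Rightarrow> real" where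
  "strong_resonance_sum \<alpha> \<tau> H = (\<Sum>m | m \<noteq> 0 \<and> \<bar>m\<bar> \<le> int H. strong_resonance \<alpha> \<tau> m)"

lemma resonance_nonneg [simp]: "resonance \<alpha> m \<ge> 0"
  by (simp add: resonance_def)

lemma strong_resonance_nonneg [simp]: "strong_resonance \<alpha> \<tau> m \<ge> 0"
  by (simp add: strong_resonance_def)

lemma resonance_minus [simp]: "resonance \<alpha> (- m) = resonance \<alpha> m"
  by (simp add: resonance_def)

lemma strong_resonance_minus [simp]: "strong_resonance \<alpha> \<tau> (- m) = strong_resonance \<alpha> \<tau> m"
  by (simp add: strong_resonance_def)

lemma finite_frequencies [simp]: "finite {m::int. m \<noteq> 0 \<and> \<bar>m\<bar> \<le> int H}"
  by (rule finite_subset[of _ "{- int H..int H}"]) auto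

lemma resonance_sum_nonneg: "resonance_sum \<alpha> H \<ge> 0"
  by (simp add: resonance_sum_def sum_nonneg)

lemma strong_resonance_sum_nonneg: "strong_resonance_sum \<alpha> \<tau> H \<ge> 0"
  by (simp add: strong_resonance_sum_def sum_nonneg)

lemma resonance_sum_mono: "H \<le> H' \<Longrightarrow> resonance_sum \<alpha> H \<le> resonance_sum \<alpha> H'"
  unfolding resonance_sum_def by (intro sum_mono2) auto

text \<open>Here \<open>K\<close> is the modulus of the correlation of the characters with frequencies \<open>m\<close> and \<open>m'\<close>. If not both frequencies
are strongly resonant, a factor \<open>1/U\<close> is gained: either \<open>\<parallel>(m - m') \<alpha>\<parallel>\<close> is at least \<open>U/(2M)\<close> and \<open>K\<close> is small, or
\<open>\<parallel>m \<alpha>\<parallel>\<close> and \<open>\<parallel>m' \<alpha>\<parallel>\<close> both are, and then the resonance at the larger of the two frequencies is traded for the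
resonance at \<open>m - m'\<close>.\<close>

lemma resonance_pair_le:
  assumes \<alpha>: "\<alpha> \<notin> \<rat>" and M: "M \<ge> 1" and U: "U > 0"
    and mn: "m \<noteq> 0" "m' \<noteq> 0" "m \<noteq> m'"
    and K: "0 \<le> K" "K \<le> 1" "K \<le> 1 / (real M * int_dist (real_of_int (m - m') * \<alpha>))"
  defines "g \<equiv> resonance \<alpha>" and "s \<equiv> strong_resonance \<alpha> (U / real M)"
  shows "g m * g m' * K \<le> s m * s m' + (2 * (g m * g m') + 4 * (g m * g (m - m')) + 4 * (g m' * g (m - m'))) / U"
proof -
  define x where "x = int_dist (real_of_int m * \<alpha>)"
  define x' where "x' = int_dist (real_of_int m' * \<alpha>)"
  define y where "y = int_dist (real_of_int (m - m') * \<alpha>)"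
  define n where "n = m - m'"
  have pos: "x > 0" "x' > 0" "y > 0"
    using int_dist_pos[OF \<alpha>] mn by (auto simp: x_def x'_def y_def simp del: of_int_diff)
  have tri: "x \<le> x' + y" "x' \<le> x + y"
    using int_dist_add_le[of "real_of_int m' * \<alpha>" "real_of_int (m - m') * \<alpha>"]
      int_dist_add_le[of "real_of_int m * \<alpha>" "- (real_of_int (m - m') * \<alpha>)"]
    unfolding int_dist_minus by (simp_all add: x_def x'_def y_def algebra_simps)
  have g: "g m = 1 / (real_of_int \<bar>m\<bar> * x)" "g m' = 1 / (real_of_int \<bar>m'\<bar> * x')" "g n = 1 / (real_of_int \<bar>n\<bar> * y)"
    by (simp_all add: g_def resonance_def x_def x'_def y_def n_def)
  have nn: "g i \<ge> 0" "s i \<ge> 0" for i by (auto simp: g_def s_def)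
  have ssnn: "s m * s m' \<ge> 0" using nn by simp
  define R where "R = (2 * (g m * g m') + 4 * (g m * g n) + 4 * (g m' * g n)) / U"
  have Rge: "2 * (g m * g m') / U \<le> R" "4 * (g m * g n) / U \<le> R" "4 * (g m' * g n) / U \<le> R"
    unfolding R_def using nn U by (auto intro!: divide_right_mono)
  have R0: "R \<ge> 0" using nn U by (simp add: R_def)
  have Mr: "real M > 0" using M by simp
  have xi: "1 / (real M * z) \<le> 2 / U" if "U / (2 * real M) \<le> z" for z
  proof -
    have "real M * (U / (2 * real M)) \<le> real M * z" using that Mr by (intro mult_left_mono) auto
    hence "U / 2 \<le> real M * z" using Mr by simp
    hence "1 / (real M * z) \<le> 1 / (U / 2)" using U by (intro frac_le) auto
    thus ?thesis by simp
  qed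
  consider (small) "x < U / real M" "x' < U / real M" | (far) "U / (2 * real M) \<le> y"
    | (near) "y < U / (2 * real M)" "U / real M \<le> x \<or> U / real M \<le> x'" by linarith
  hence "g m * g m' * K \<le> s m * s m' + R"
  proof cases
    case small
    have "s m = g m" "s m' = g m'" using small by (simp_all add: s_def g_def strong_resonance_def x_def x'_def)
    moreover have "g m * g m' * K \<le> g m * g m' * 1" using K nn by (intro mult_left_mono) auto
    ultimately show ?thesis using R0 by simp
  next
    case far
    have "K \<le> 1 / (real M * y)" using K(3) by (simp add: y_def)
    also have "\<dots> \<le> 2 / U" by (rule xi[OF far])
    finally have "g m * g m' * K \<le> g m * g m' * (2 / U)" using nn by (intro mult_left_mono) auto
    also have "\<dots> \<le> R" using Rge(1) by (simp add: mult_ac)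
    finally show ?thesis using ssnn by linarith
  next
    case near
    have e: "U / real M = U / (2 * real M) + U / (2 * real M)" by (simp add: field_simps)
    have xb: "U / (2 * real M) \<le> x" "U / (2 * real M) \<le> x'" using near tri e by linarith+
    have Ky: "K \<le> 1 / (real M * y)" using K(3) by (simp add: y_def)
    have key: "1 / (real_of_int \<bar>j\<bar> * z) * K \<le> 4 * g n / U"
      if "U / (2 * real M) \<le> z" "z > 0" "\<bar>n\<bar> \<le> 2 * \<bar>j\<bar>" "j \<noteq> 0" for j z
    proof -
      have n0: "n \<noteq> 0" using mn by (simp add: n_def)
      have "real_of_int \<bar>n\<bar> \<le> 2 * real_of_int \<bar>j\<bar>" using that(3) by linarith
      hence "2 / (2 * real_of_int \<bar>j\<bar>) \<le> 2 / real_of_int \<bar>n\<bar>" using n0 by (intro frac_le) auto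
      hence jn: "1 / real_of_int \<bar>j\<bar> \<le> 2 / real_of_int \<bar>n\<bar>" by simp
      have "1 / (real_of_int \<bar>j\<bar> * z) * K \<le> 1 / (real_of_int \<bar>j\<bar> * z) * (1 / (real M * y))"
        using Ky that by (intro mult_left_mono) auto
      also have "\<dots> = (1 / real_of_int \<bar>j\<bar>) * (1 / (real M * z)) * (1 / y)" by simp
      also have "\<dots> \<le> (2 / real_of_int \<bar>n\<bar>) * (2 / U) * (1 / y)"
        using jn xi[OF that(1)] pos U Mr that by (intro mult_mono mult_nonneg_nonneg) auto
      also have "\<dots> = 4 * g n / U" by (simp add: g)
      finally show ?thesis .
    qed
    show ?thesis
    proof (cases "\<bar>m\<bar> \<le> \<bar>m'\<bar>")
      case True
      have "g m' * K \<le> 4 * g n / U" unfolding g(2)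
        by (rule key) (use xb pos True mn in \<open>auto simp: n_def\<close>)
      hence "g m * (g m' * K) \<le> g m * (4 * g n / U)" using nn by (intro mult_left_mono) auto
      also have "\<dots> \<le> R" using Rge(2) by (simp add: mult_ac)
      finally show ?thesis using ssnn by (simp add: mult.assoc)
    next
      case False
      have "g m * K \<le> 4 * g n / U" unfolding g(1)
        by (rule key) (use xb pos False mn in \<open>auto simp: n_def\<close>)
      hence "g m' * (g m * K) \<le> g m' * (4 * g n / U)" using nn by (intro mult_left_mono) auto
      also have "\<dots> \<le> R" using Rge(3) by (simp add: mult_ac)
      finally show ?thesis using ssnn by (simp add: mult_ac)
    qed
  qed
  thus ?thesis by (simp add: R_def n_def)
qed

text \<open>The factor \<open>2H\<close> in the range of the resonance sum makes room for the differences \<open>m - m'\<close>.\<close>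

lemma resonance_bilinear_le:
  fixes H :: nat
  assumes \<alpha>: "\<alpha> \<notin> \<rat>" and M: "M \<ge> 1" and U: "U > 0"
    and K: "\<And>n. 0 \<le> K n" "\<And>n. K n \<le> 1" "\<And>n. n \<noteq> 0 \<Longrightarrow> K n \<le> 1 / (real M * int_dist (real_of_int n * \<alpha>))"
  defines "I \<equiv> {m::int. m \<noteq> 0 \<and> \<bar>m\<bar> \<le> int H}"
  shows "(\<Sum>m\<in>I. \<Sum>m'\<in>I - {m}. resonance \<alpha> m * resonance \<alpha> m' * K (m - m'))
     \<le> (strong_resonance_sum \<alpha> (U / real M) H)\<^sup>2 + 10 * (resonance_sum \<alpha> (2 * H))\<^sup>2 / U"
proof -
  define g where "g = resonance \<alpha>"
  define s where "s = strong_resonance \<alpha> (U / real M)"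
  define F where "F = resonance_sum \<alpha> (2 * H)"
  have fin: "finite I" by (simp add: I_def)
  have nn: "g i \<ge> 0" "s i \<ge> 0" for i by (auto simp: g_def s_def)
  have F0: "F \<ge> 0" by (simp add: F_def resonance_sum_nonneg)
  have gF: "sum g I \<le> F" using resonance_sum_mono[of H "2 * H" \<alpha>] by (simp add: F_def g_def I_def resonance_sum_def)
  have gF': "(\<Sum>m'\<in>I - {m}. g (m - m')) \<le> F" "(\<Sum>m'\<in>I - {m}. g (m' - m)) \<le> F" if "m \<in> I" for m
  proof -
    have "(\<Sum>m'\<in>I - {m}. g (m - m')) = sum g ((\<lambda>m'. m - m') ` (I - {m}))"
      by (subst sum.reindex) (auto simp: inj_on_def)
    also have "\<dots> \<le> F" unfolding F_def resonance_sum_def g_def using that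
      by (intro sum_mono2 finite_frequencies) (auto simp: I_def)
    finally show "(\<Sum>m'\<in>I - {m}. g (m - m')) \<le> F" .
    moreover have "g (m' - m) = g (m - m')" for m' using resonance_minus[of \<alpha> "m - m'"] by (simp add: g_def)
    ultimately show "(\<Sum>m'\<in>I - {m}. g (m' - m)) \<le> F" by simp
  qed
  have sub: "(\<Sum>m'\<in>I - {m}. h m') \<le> sum h I" if "\<And>i. h i \<ge> 0" for h :: "int \<Rightarrow> real" and m
    using that fin by (intro sum_mono2) auto
  have "(\<Sum>m\<in>I. \<Sum>m'\<in>I - {m}. g m * g m' * K (m - m'))
     \<le> (\<Sum>m\<in>I. \<Sum>m'\<in>I - {m}. s m * s m' + (2 * (g m * g m') + 4 * (g m * g (m - m')) + 4 * (g m' * g (m - m'))) / U)"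
  proof (intro sum_mono)
    fix m m' assume "m \<in> I" "m' \<in> I - {m}"
    thus "g m * g m' * K (m - m') \<le> s m * s m' + (2 * (g m * g m') + 4 * (g m * g (m - m')) + 4 * (g m' * g (m - m'))) / U"
      unfolding g_def s_def
      by (intro resonance_pair_le[OF \<alpha> M U] K) (auto simp: I_def)
  qed
  also have "\<dots> = (\<Sum>m\<in>I. s m * (\<Sum>m'\<in>I - {m}. s m'))
      + (2 * (\<Sum>m\<in>I. g m * (\<Sum>m'\<in>I - {m}. g m')) + 4 * (\<Sum>m\<in>I. g m * (\<Sum>m'\<in>I - {m}. g (m - m')))
         + 4 * (\<Sum>m\<in>I. \<Sum>m'\<in>I - {m}. g m' * g (m - m'))) / U"
    by (simp only: sum.distrib sum_divide_distrib[symmetric] sum_distrib_left[symmetric])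
  also have "(\<Sum>m\<in>I. \<Sum>m'\<in>I - {m}. g m' * g (m - m')) = (\<Sum>m'\<in>I. \<Sum>m\<in>I - {m'}. g m' * g (m - m'))"
  proof -
    have e: "I - {m} = {m' \<in> I. m' \<noteq> m}" "I - {m} = {m' \<in> I. m \<noteq> m'}" for m by auto
    have "(\<Sum>m\<in>I. \<Sum>m'\<in>{m' \<in> I. m' \<noteq> m}. g m' * g (m - m')) = (\<Sum>m'\<in>I. \<Sum>m\<in>{m \<in> I. m' \<noteq> m}. g m' * g (m - m'))"
      by (rule sum.swap_restrict[OF fin fin])
    thus ?thesis by (simp only: e(1)[symmetric] e(2)[symmetric])
  qed
  also have "\<dots> = (\<Sum>m'\<in>I. g m' * (\<Sum>m\<in>I - {m'}. g (m - m')))" by (simp add: sum_distrib_left)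
  also have "(\<Sum>m\<in>I. s m * (\<Sum>m'\<in>I - {m}. s m'))
      + (2 * (\<Sum>m\<in>I. g m * (\<Sum>m'\<in>I - {m}. g m')) + 4 * (\<Sum>m\<in>I. g m * (\<Sum>m'\<in>I - {m}. g (m - m')))
         + 4 * (\<Sum>m'\<in>I. g m' * (\<Sum>m\<in>I - {m'}. g (m - m')))) / U
    \<le> (\<Sum>m\<in>I. s m * sum s I) + (2 * (\<Sum>m\<in>I. g m * F) + 4 * (\<Sum>m\<in>I. g m * F) + 4 * (\<Sum>m\<in>I. g m * F)) / U"
  proof -
    have "(\<Sum>m\<in>I. s m * (\<Sum>m'\<in>I - {m}. s m')) \<le> (\<Sum>m\<in>I. s m * sum s I)"
      by (intro sum_mono mult_left_mono sub nn)
    moreover have "(\<Sum>m\<in>I. g m * (\<Sum>m'\<in>I - {m}. g m')) \<le> (\<Sum>m\<in>I. g m * F)"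
      by (intro sum_mono mult_left_mono nn order_trans[OF sub gF])
    moreover have "(\<Sum>m\<in>I. g m * (\<Sum>m'\<in>I - {m}. g (m - m'))) \<le> (\<Sum>m\<in>I. g m * F)"
      by (intro sum_mono mult_left_mono nn gF'(1))
    moreover have "(\<Sum>m'\<in>I. g m' * (\<Sum>m\<in>I - {m'}. g (m - m'))) \<le> (\<Sum>m\<in>I. g m * F)"
      by (intro sum_mono mult_left_mono nn gF'(2))
    ultimately show ?thesis using U by (intro add_mono divide_right_mono mult_left_mono) auto
  qed
  also have "\<dots> = (sum s I)\<^sup>2 + 10 * (sum g I * F) / U"
    by (simp add: sum_distrib_right[symmetric] power2_eq_square)
  also have "\<dots> \<le> (sum s I)\<^sup>2 + 10 * (F * F) / U"
    using gF F0 U by (intro add_left_mono divide_right_mono mult_left_mono mult_right_mono) auto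
  finally show ?thesis
    by (simp add: strong_resonance_sum_def s_def I_def F_def g_def power2_eq_square)
qed

text \<open>Expanding the square, the cross term is at most \<open>2B\<close> times the mean of \<open>|a|\<close>, which the Cauchy-Schwarz inequality
bounds by the root mean square.\<close>

lemma mean_square_perturbation:
  fixes a b :: "nat \<Rightarrow> complex"
  assumes M: "M \<ge> 1" and B: "\<And>N. N \<in> {1..M} \<Longrightarrow> norm (b N) \<le> B"
  shows "\<bar>(\<Sum>N=1..M. (norm (a N + b N))\<^sup>2) / real M - (\<Sum>N=1..M. (norm (a N))\<^sup>2) / real M\<bar>
       \<le> 2 * B * sqrt ((\<Sum>N=1..M. (norm (a N))\<^sup>2) / real M) + B\<^sup>2"
proof -
  have B0: "B \<ge> 0" using order_trans[OF norm_ge_zero B[of 1]] M by simp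
  define \<tau> where "\<tau> = sqrt ((\<Sum>N=1..M. (norm (a N))\<^sup>2) / real M)"
  have cs: "(\<Sum>N=1..M. norm (a N)) \<le> real M * \<tau>"
  proof -
    have "(\<Sum>N=1..M. norm (a N))\<^sup>2 \<le> (\<Sum>N=1..M. (norm (a N))\<^sup>2) * real (card {1..M})"
      by (rule sum_squared_le_sum_of_squares)
    also have "\<dots> = (real M * \<tau>)\<^sup>2"
      using M by (simp add: \<tau>_def power_mult_distrib sum_nonneg field_simps power2_eq_square)
    finally show ?thesis by (rule power2_le_imp_le) (simp add: \<tau>_def sum_nonneg)
  qed
  have "\<bar>(\<Sum>N=1..M. (norm (a N + b N))\<^sup>2) - (\<Sum>N=1..M. (norm (a N))\<^sup>2)\<bar>
     = \<bar>\<Sum>N=1..M. (norm (a N + b N))\<^sup>2 - (norm (a N))\<^sup>2\<bar>" by (simp add: sum_subtractf)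
  also have "\<dots> \<le> (\<Sum>N=1..M. 2 * B * norm (a N) + B\<^sup>2)"
  proof (rule order_trans[OF sum_abs], rule sum_mono)
    fix N assume N: "N \<in> {1..M}"
    define x y z where "x = norm (a N)" and "y = norm (a N + b N)" and "z = norm (b N)"
    have t: "\<bar>y - x\<bar> \<le> z" "z \<le> B" "0 \<le> x" "0 \<le> y" "0 \<le> z"
      using norm_triangle_ineq3[of "a N + b N" "a N"] B[OF N] by (auto simp: x_def y_def z_def)
    have "\<bar>y\<^sup>2 - x\<^sup>2\<bar> = \<bar>y - x\<bar> * (y + x)"
    proof -
      have "y\<^sup>2 - x\<^sup>2 = (y - x) * (y + x)" by (simp add: power2_eq_square algebra_simps)
      hence "\<bar>y\<^sup>2 - x\<^sup>2\<bar> = \<bar>y - x\<bar> * \<bar>y + x\<bar>" by (simp only: abs_mult)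
      thus ?thesis using t by simp
    qed
    also have "\<dots> \<le> B * (2 * x + B)" using t by (intro mult_mono) linarith+
    finally show "\<bar>(norm (a N + b N))\<^sup>2 - (norm (a N))\<^sup>2\<bar> \<le> 2 * B * norm (a N) + B\<^sup>2"
      by (simp add: x_def y_def power2_eq_square algebra_simps)
  qed
  also have "\<dots> = 2 * B * (\<Sum>N=1..M. norm (a N)) + real M * B\<^sup>2"
    by (simp add: sum.distrib sum_distrib_left)
  also have "\<dots> \<le> 2 * B * (real M * \<tau>) + real M * B\<^sup>2"
    using cs B0 by (intro add_right_mono mult_left_mono) auto
  finally have "\<bar>(\<Sum>N=1..M. (norm (a N + b N))\<^sup>2) - (\<Sum>N=1..M. (norm (a N))\<^sup>2)\<bar> / real M
      \<le> (2 * B * (real M * \<tau>) + real M * B\<^sup>2) / real M" by (intro divide_right_mono) auto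
  also have "\<dots> = 2 * B * \<tau> + B\<^sup>2" using M by (simp add: field_simps)
  finally show ?thesis by (simp add: \<tau>_def diff_divide_distrib[symmetric] abs_divide)
qed

lemma mean_square_centered:
  fixes a :: "nat \<Rightarrow> complex"
  assumes M: "M \<ge> 1"
  defines "\<mu> \<equiv> (\<Sum>N=1..M. a N) / of_nat M"
  shows "(\<Sum>N=1..M. (norm (a N - \<mu>))\<^sup>2) / real M = (\<Sum>N=1..M. (norm (a N))\<^sup>2) / real M - (norm \<mu>)\<^sup>2"
proof -
  have "complex_of_real (\<Sum>N=1..M. (norm (a N - \<mu>))\<^sup>2) = (\<Sum>N=1..M. (a N - \<mu>) * cnj (a N - \<mu>))"
    by (simp only: of_real_sum complex_norm_square)
  also have "\<dots> = (\<Sum>N=1..M. a N * cnj (a N) - \<mu> * cnj (a N) - cnj \<mu> * a N + \<mu> * cnj \<mu>)"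
    by (intro sum.cong refl) (simp add: algebra_simps)
  also have "\<dots> = (\<Sum>N=1..M. a N * cnj (a N)) - \<mu> * cnj (\<Sum>N=1..M. a N) - cnj \<mu> * (\<Sum>N=1..M. a N) + of_nat M * (\<mu> * cnj \<mu>)"
    by (simp only: sum.distrib sum_subtractf sum_distrib_left[symmetric] cnj_sum) simp
  also have "(\<Sum>N=1..M. a N) = of_nat M * \<mu>" using M by (simp add: \<mu>_def)
  also have "(\<Sum>N=1..M. a N * cnj (a N)) - \<mu> * cnj (of_nat M * \<mu>) - cnj \<mu> * (of_nat M * \<mu>) + of_nat M * (\<mu> * cnj \<mu>)
      = (\<Sum>N=1..M. a N * cnj (a N)) - of_nat M * (\<mu> * cnj \<mu>)" by (simp add: algebra_simps)
  also have "\<dots> = complex_of_real ((\<Sum>N=1..M. (norm (a N))\<^sup>2) - real M * (norm \<mu>)\<^sup>2)"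
    by (simp only: of_real_diff of_real_mult of_real_sum complex_norm_square of_real_of_nat_eq)
  finally have "(\<Sum>N=1..M. (norm (a N - \<mu>))\<^sup>2) = (\<Sum>N=1..M. (norm (a N))\<^sup>2) - real M * (norm \<mu>)\<^sup>2"
    by (simp only: of_real_eq_iff)
  thus ?thesis using M by (simp add: diff_divide_distrib)
qed

definition char_mean :: "real \<Rightarrow> nat \<Rightarrow> int \<Rightarrow> complex" where
  "char_mean \<alpha> M n = (\<Sum>N=1..M. echar (real N * (of_int n * \<alpha>))) / of_nat M"

lemma char_mean_0: "M \<ge> 1 \<Longrightarrow> char_mean \<alpha> M 0 = 1" by (simp add: char_mean_def)

lemma norm_char_mean_le_1: "norm (char_mean \<alpha> M n) \<le> 1"
proof -
  have "norm (\<Sum>N=1..M. echar (real N * (of_int n * \<alpha>))) \<le> (\<Sum>N=1..M. norm (echar (real N * (of_int n * \<alpha>))))"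
    by (rule norm_sum)
  thus ?thesis by (simp add: char_mean_def norm_divide divide_le_eq)
qed

lemma norm_char_mean_le:
  assumes "\<alpha> \<notin> \<rat>" "n \<noteq> 0" "M \<ge> 1"
  shows "norm (char_mean \<alpha> M n) \<le> 1 / (real M * int_dist (of_int n * \<alpha>))"
proof -
  have "norm (char_mean \<alpha> M n) = norm (\<Sum>N=1..M. echar (real N * (of_int n * \<alpha>))) / real M"
    by (simp add: char_mean_def norm_divide)
  also have "\<dots> \<le> (1 / int_dist (of_int n * \<alpha>)) / real M"
    by (intro divide_right_mono norm_sum_echar_le int_dist_pos) (use assms in auto)
  finally show ?thesis by (simp add: mult.commute)
qed

lemma mean_square_trig_poly:
  assumes M: "M \<ge> 1" and fin: "finite I"
  shows "complex_of_real ((\<Sum>N=1..M. (norm (\<Sum>m\<in>I. c m * echar (real N * (of_int m * \<alpha>))))\<^sup>2) / real M)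
     = (\<Sum>m\<in>I. \<Sum>m'\<in>I. c m * cnj (c m') * char_mean \<alpha> M (m - m'))"
proof -
  have "complex_of_real (\<Sum>N=1..M. (norm (\<Sum>m\<in>I. c m * echar (real N * (of_int m * \<alpha>))))\<^sup>2)
     = (\<Sum>N=1..M. (\<Sum>m\<in>I. c m * echar (real N * (of_int m * \<alpha>))) * cnj (\<Sum>m\<in>I. c m * echar (real N * (of_int m * \<alpha>))))"
    by (simp only: of_real_sum complex_norm_square)
  also have "\<dots> = (\<Sum>N=1..M. \<Sum>m\<in>I. \<Sum>m'\<in>I. c m * cnj (c m') * echar (real N * (of_int (m - m') * \<alpha>)))"
  proof (rule sum.cong[OF refl])
    fix N
    have "echar (real N * (of_int m * \<alpha>)) * echar (- (real N * (of_int m' * \<alpha>))) = echar (real N * (of_int (m - m') * \<alpha>))" for m m'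
      by (simp add: echar_add[symmetric] algebra_simps)
    hence "(c m * echar (real N * (of_int m * \<alpha>))) * (cnj (c m') * echar (- (real N * (of_int m' * \<alpha>))))
       = c m * cnj (c m') * echar (real N * (of_int (m - m') * \<alpha>))" for m m'
      by (metis (no_types, lifting) mult.assoc mult.left_commute)
    thus "(\<Sum>m\<in>I. c m * echar (real N * (of_int m * \<alpha>))) * cnj (\<Sum>m\<in>I. c m * echar (real N * (of_int m * \<alpha>)))
      = (\<Sum>m\<in>I. \<Sum>m'\<in>I. c m * cnj (c m') * echar (real N * (of_int (m - m') * \<alpha>)))"
      by (simp only: cnj_sum complex_cnj_mult cnj_echar sum_product)
  qed
  also have "\<dots> = (\<Sum>m\<in>I. \<Sum>m'\<in>I. \<Sum>N=1..M. c m * cnj (c m') * echar (real N * (of_int (m - m') * \<alpha>)))"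
    by (subst sum.swap, intro sum.cong refl, rule sum.swap)
  also have "\<dots> = (\<Sum>m\<in>I. \<Sum>m'\<in>I. c m * cnj (c m') * (of_nat M * char_mean \<alpha> M (m - m')))"
  proof -
    have "of_nat M * char_mean \<alpha> M n = (\<Sum>N=1..M. echar (real N * (of_int n * \<alpha>)))" for n
      using M by (simp add: char_mean_def)
    thus ?thesis by (simp only: sum_distrib_left)
  qed
  also have "\<dots> = of_nat M * (\<Sum>m\<in>I. \<Sum>m'\<in>I. c m * cnj (c m') * char_mean \<alpha> M (m - m'))"
    unfolding sum_distrib_left by (simp only: mult_ac)
  finally show ?thesis using M unfolding of_real_divide by simp
qed

section \<open>Mean and variance of Birkhoff sums\<close>

lemma sum_inverse_squares_le: "(\<Sum>n=1..H. 1 / (real n)\<^sup>2) \<le> 2"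
proof -
  have *: "(\<Sum>n=1..H. 1 / (real n)\<^sup>2) \<le> 2 - 1 / real H" if "H \<ge> 1" for H
    using that
  proof (induction H rule: nat_induct_at_least)
    case (Suc H)
    have "1 / (real (Suc H))\<^sup>2 \<le> 1 / (real H * real (Suc H))"
      using Suc by (intro frac_le) (auto simp: power2_eq_square)
    also have "\<dots> = 1 / real H - 1 / real (Suc H)" using Suc by (simp add: field_simps)
    finally show ?case using Suc by simp
  qed simp
  show ?thesis
  proof (cases "H \<ge> 1")
    case True
    have "1 / real H \<ge> 0" by simp
    thus ?thesis using *[OF True] by linarith
  qed (simp add: not_le)
qed

lemma sum_squares_le_square_sum:
  fixes s :: "'i \<Rightarrow> real"
  assumes "finite S" "\<And>i. i \<in> S \<Longrightarrow> s i \<ge> 0"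
  shows "(\<Sum>i\<in>S. (s i)\<^sup>2) \<le> (\<Sum>i\<in>S. s i)\<^sup>2"
proof -
  have "(\<Sum>i\<in>S. (s i)\<^sup>2) \<le> (\<Sum>i\<in>S. s i * (\<Sum>j\<in>S. s j))"
    unfolding power2_eq_square using assms by (intro sum_mono mult_left_mono member_le_sum) auto
  thus ?thesis by (simp add: sum_distrib_right[symmetric] power2_eq_square)
qed

lemma fejer_weight_bounds:
  assumes "\<bar>m\<bar> \<le> int H" "H \<ge> 1"
  shows "0 \<le> fejer_weight H m" "fejer_weight H m \<le> 1"
  using assms by (auto simp: fejer_weight_def divide_le_eq_1 simp flip: of_int_abs)

context bv_periodic begin

text \<open>For \<open>m \<noteq> 0\<close>, the coefficients of a trigonometric polynomial \<open>h\<close> with \<open>h(x) - h(x - \<alpha>) = -\<phi>(x)\<close>, where \<open>\<phi>\<close> is the Fejer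
mean of an \<open>f\<close> with integral \<open>0\<close>. The \<open>N\<close>-th Birkhoff sum of \<open>\<phi>\<close> is \<open>h(0) - h(N \<alpha>)\<close>.\<close>

definition cocycle_coeff :: "real \<Rightarrow> nat \<Rightarrow> int \<Rightarrow> complex" where
  "cocycle_coeff \<alpha> H m = of_real (fejer_weight H m) * fourier_coeff f m
      * (echar (of_int m * \<alpha>) / (1 - echar (of_int m * \<alpha>)))"

lemma norm_cocycle_coeff_le:
  assumes \<alpha>: "\<alpha> \<notin> \<rat>" and m: "m \<noteq> 0" "\<bar>m\<bar> \<le> int H" and H: "H \<ge> 1"
  shows "norm (cocycle_coeff \<alpha> H m) \<le> V * resonance \<alpha> m"
proof -
  define x where "x = int_dist (of_int m * \<alpha>)"
  have x: "x > 0" using int_dist_pos[OF \<alpha> m(1)] by (simp add: x_def)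
  have "norm (cocycle_coeff \<alpha> H m) = fejer_weight H m * (norm (fourier_coeff f m) * (1 / norm (1 - echar (of_int m * \<alpha>))))"
    using fejer_weight_bounds[OF m(2) H] by (simp add: cocycle_coeff_def norm_mult norm_divide)
  also have "\<dots> \<le> 1 * ((V / (4 * real_of_int \<bar>m\<bar>)) * (1 / (2 * x)))"
  proof (intro mult_mono mult_nonneg_nonneg)
    show "1 / norm (1 - echar (of_int m * \<alpha>)) \<le> 1 / (2 * x)"
      using norm_1_minus_echar_bounds(3)[of "of_int m * \<alpha>"] x by (intro frac_le) (auto simp: x_def)
  qed (use fejer_weight_bounds[OF m(2) H] norm_fourier_coeff_le[OF m(1)] V_nonneg x in auto)
  also have "\<dots> = V * resonance \<alpha> m / 8" by (simp add: resonance_def x_def)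
  also have "\<dots> \<le> V * resonance \<alpha> m" using V_nonneg by simp
  finally show ?thesis .
qed

lemma sum_fejer_mean_eq:
  assumes \<alpha>: "\<alpha> \<notin> \<rat>" and H: "H \<ge> 1" and f0: "integral {0..1} f = 0"
  defines "I \<equiv> {m::int. m \<noteq> 0 \<and> \<bar>m\<bar> \<le> int H}"
  shows "complex_of_real (\<Sum>n=1..N. fejer_mean H (real n * \<alpha>))
     = (\<Sum>m\<in>I. cocycle_coeff \<alpha> H m) - (\<Sum>m\<in>I. cocycle_coeff \<alpha> H m * echar (real N * (of_int m * \<alpha>)))"
proof -
  have "fourier_coeff f 0 = complex_of_real (integral {0..1} f)"
  proof -
    have "f integrable_on {0..1}"
      by (rule integrable_bounded_measurable[OF borel_measurable_f, where B = "\<bar>f 0\<bar> + V"]) (simp add: f_bounded)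
    hence "((\<lambda>x. complex_of_real (f x)) has_integral complex_of_real (integral {0..1} f)) {0..1}"
      by (intro has_integral_of_real integrable_integral)
    thus ?thesis by (simp add: fourier_coeff_echar integral_unique)
  qed
  hence f00: "fourier_coeff f 0 = 0" using f0 by simp
  have split: "{m::int. \<bar>m\<bar> \<le> int H} = insert 0 I" by (auto simp: I_def)
  have fin: "finite I" "0 \<notin> I" by (auto simp: I_def)
  have "complex_of_real (\<Sum>n=1..N. fejer_mean H (real n * \<alpha>))
     = (\<Sum>n=1..N. \<Sum>m\<in>I. of_real (fejer_weight H m) * fourier_coeff f m * echar (real n * (of_int m * \<alpha>)))"
    unfolding of_real_sum fejer_mean_eq_sum[OF H] split using fin f00 by (simp add: mult_ac)
  also have "\<dots> = (\<Sum>m\<in>I. of_real (fejer_weight H m) * fourier_coeff f m * (\<Sum>n=1..N. echar (real n * (of_int m * \<alpha>))))"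
    unfolding sum_distrib_left by (rule sum.swap)
  also have "\<dots> = (\<Sum>m\<in>I. cocycle_coeff \<alpha> H m - cocycle_coeff \<alpha> H m * echar (real N * (of_int m * \<alpha>)))"
  proof (rule sum.cong[OF refl])
    fix m assume m: "m \<in> I"
    have "int_dist (of_int m * \<alpha>) > 0" using int_dist_pos[OF \<alpha>] m by (simp add: I_def)
    from sum_echar[OF this, of N]
    show "of_real (fejer_weight H m) * fourier_coeff f m * (\<Sum>n=1..N. echar (real n * (of_int m * \<alpha>)))
        = cocycle_coeff \<alpha> H m - cocycle_coeff \<alpha> H m * echar (real N * (of_int m * \<alpha>))"
      by (simp only:) (simp add: cocycle_coeff_def algebra_simps diff_divide_distrib)
  qed
  finally show ?thesis by (simp add: sum_subtractf)
qed

text \<open>Three errors occur: the bounded one from replacing \<open>1/|1 - e(m \<alpha>)|\<^sup>2\<close> by \<open>1/(2 \<pi> \<parallel>m \<alpha>\<parallel>)\<^sup>2\<close>; the Fejer weights for \<open>m \<le> M\<close>, where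
\<open>1 - w\<^sup>2 \<le> 2m/H\<close>; and the whole term for \<open>M < m \<le> H\<close>. In the last two, strongly resonant frequencies are paid by
\<open>W\<^sup>2\<close>, and for the others one factor \<open>1/\<parallel>m \<alpha>\<parallel> \<le> M/U\<close> is given up.\<close>

lemma diagonal_sum_close:
  assumes \<alpha>: "\<alpha> \<notin> \<rat>" and M: "M \<ge> 1" "M \<le> H" and U: "U > 0"
  defines "W \<equiv> strong_resonance_sum \<alpha> (U / real M) H" and "F \<equiv> resonance_sum \<alpha> (2 * H)"
  shows "\<bar>(\<Sum>m | m \<noteq> 0 \<and> \<bar>m\<bar> \<le> int H. (norm (cocycle_coeff \<alpha> H m))\<^sup>2)
      - (\<Sum>m=1..M. (norm (fourier_coeff f (int m)))\<^sup>2 / (2 * pi\<^sup>2 * (int_dist (real m * \<alpha>))\<^sup>2))\<bar>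
     \<le> V\<^sup>2 * (1 + W\<^sup>2 + F / U)"
proof -
  define \<phi> where "\<phi> m = (norm (fourier_coeff f (int m)))\<^sup>2" for m
  define x where "x m = int_dist (real m * \<alpha>)" for m
  define z where "z m = (norm (1 - echar (real m * \<alpha>)))\<^sup>2" for m
  define w where "w m = fejer_weight H (int m)" for m
  define s where "s m = strong_resonance \<alpha> (U / real M) (int m)" for m
  define g where "g m = resonance \<alpha> (int m)" for m
  define t where "t m = (if m \<le> M then \<phi> m / (2 * pi\<^sup>2 * (x m)\<^sup>2) else 0)" for m
  have H1: "H \<ge> 1" using M by simp
  have fminus: "norm (fourier_coeff f (- m)) = norm (fourier_coeff f m)" for m
  proof -
    have "fourier_coeff f (- m) = cnj (fourier_coeff f m)"
      unfolding fourier_coeff_echar integral_cnj by (simp add: cnj_echar)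
    thus ?thesis by simp
  qed
  have zminus: "norm (1 - echar (- y)) = norm (1 - echar y)" for y
    by (metis cnj_echar complex_cnj_diff complex_cnj_one complex_mod_cnj)
  have csq: "(norm (cocycle_coeff \<alpha> H (int m)))\<^sup>2 = (w m)\<^sup>2 * \<phi> m / z m" for m
    by (simp add: cocycle_coeff_def norm_mult norm_divide power_mult_distrib power_divide w_def \<phi>_def z_def)
  have "(\<Sum>m | m \<noteq> 0 \<and> \<bar>m\<bar> \<le> int H. (norm (cocycle_coeff \<alpha> H m))\<^sup>2) = 2 * (\<Sum>m=1..H. (norm (cocycle_coeff \<alpha> H (int m)))\<^sup>2)"
    by (rule sum_symmetric_int)
      (simp add: cocycle_coeff_def norm_mult norm_divide fejer_weight_def fminus zminus)
  hence P: "(\<Sum>m | m \<noteq> 0 \<and> \<bar>m\<bar> \<le> int H. (norm (cocycle_coeff \<alpha> H m))\<^sup>2) = (\<Sum>m=1..H. 2 * ((w m)\<^sup>2 * \<phi> m / z m))"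
    by (simp add: csq sum_distrib_left)
  have T: "(\<Sum>m=1..M. (norm (fourier_coeff f (int m)))\<^sup>2 / (2 * pi\<^sup>2 * (int_dist (real m * \<alpha>))\<^sup>2)) = (\<Sum>m=1..H. t m)"
    unfolding t_def using M(2) by (subst sum.inter_filter[symmetric]) (auto simp: \<phi>_def x_def intro!: sum.cong)
  have termwise: "\<bar>2 * ((w m)\<^sup>2 * \<phi> m / z m) - t m\<bar> \<le> V\<^sup>2 * (1 / 2 * (1 / (real m)\<^sup>2) + (s m)\<^sup>2 + g m / U)"
    if m: "m \<in> {1..H}" for m
  proof -
    have x: "x m > 0" using int_dist_pos[OF \<alpha>, of "int m"] m by (simp add: x_def)
    have w: "0 \<le> w m" "w m \<le> 1" using fejer_weight_bounds[of "int m" H] m H1 by (auto simp: w_def)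
    have w2: "0 \<le> (w m)\<^sup>2" "(w m)\<^sup>2 \<le> 1" using w by (auto simp: power_le_one)
    have \<phi>0: "\<phi> m \<ge> 0" by (simp add: \<phi>_def)
    have "\<phi> m \<le> (V / (4 * real m))\<^sup>2"
      unfolding \<phi>_def using norm_fourier_coeff_le[of "int m"] m by (intro power_mono) auto
    hence \<phi>le: "\<phi> m \<le> V\<^sup>2 / (16 * (real m)\<^sup>2)" by (simp add: power_divide power_mult_distrib)
    \<comment> \<open>The error of the small divisor approximation, which lies between 0 and 1.\<close>
    define r where "r = 4 / z m - 1 / (pi\<^sup>2 * (x m)\<^sup>2)"
    have r: "0 \<le> r" "r \<le> 1"
      using norm_1_minus_echar_bounds(1,2)[of "real m * \<alpha>"] x by (auto simp: r_def z_def x_def)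
    have ze: "2 * ((w m)\<^sup>2 * \<phi> m / z m) = (w m)\<^sup>2 * \<phi> m * r / 2 + (w m)\<^sup>2 * (\<phi> m / (2 * pi\<^sup>2 * (x m)\<^sup>2))"
    proof -
      have "4 / z m = r + 1 / (pi\<^sup>2 * (x m)\<^sup>2)" by (simp add: r_def)
      moreover have "2 * ((w m)\<^sup>2 * \<phi> m / z m) = (w m)\<^sup>2 * \<phi> m * (4 / z m) / 2" by simp
      ultimately have "2 * ((w m)\<^sup>2 * \<phi> m / z m) = (w m)\<^sup>2 * \<phi> m * (r + 1 / (pi\<^sup>2 * (x m)\<^sup>2)) / 2" by simp
      thus ?thesis by (simp only: distrib_left add_divide_distrib) simp
    qed
    define Q where "Q = \<phi> m / (2 * pi\<^sup>2 * (x m)\<^sup>2)"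
    have Q0: "Q \<ge> 0" using \<phi>0 by (simp add: Q_def)
    have "Q \<le> (V\<^sup>2 / (16 * (real m)\<^sup>2)) / (1 * (x m)\<^sup>2)"
    proof -
      have "1 * 1 \<le> pi * pi" using pi_gt3 by (intro mult_mono) auto
      hence "1 \<le> 2 * pi\<^sup>2" by (simp add: power2_eq_square)
      hence "1 * (x m)\<^sup>2 \<le> 2 * pi\<^sup>2 * (x m)\<^sup>2" by (intro mult_right_mono) auto
      thus ?thesis unfolding Q_def using \<phi>le x \<phi>0 V_nonneg by (intro frac_le) auto
    qed
    also have "\<dots> = V\<^sup>2 * (g m)\<^sup>2 / 16" by (simp add: g_def resonance_def x_def power_mult_distrib power_divide)
    finally have Q: "Q \<le> V\<^sup>2 * (g m)\<^sup>2 / 16" .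
    have gnn: "g m \<ge> 0" by (simp add: g_def)
    have "\<bar>(w m)\<^sup>2 * Q - t m\<bar> \<le> V\<^sup>2 * ((s m)\<^sup>2 + g m / U)"
    proof (cases "x m < U / real M")
      case True
      have "s m = g m" using True by (simp add: s_def g_def x_def strong_resonance_def)
      have "0 \<le> (w m)\<^sup>2 * Q" "(w m)\<^sup>2 * Q \<le> Q" "0 \<le> t m" "t m \<le> Q"
        using w2 Q0 mult_left_le_one_le[OF Q0 w2] by (simp_all add: t_def Q_def[symmetric])
      hence "\<bar>(w m)\<^sup>2 * Q - t m\<bar> \<le> Q" by linarith
      also have "\<dots> \<le> V\<^sup>2 * (g m)\<^sup>2"
      proof -
        have "0 \<le> V\<^sup>2 * (g m)\<^sup>2" by simp
        thus ?thesis using Q by linarith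
      qed
      also have "\<dots> \<le> V\<^sup>2 * ((s m)\<^sup>2 + g m / U)" using \<open>s m = g m\<close> gnn U by (intro mult_left_mono) auto
      finally show ?thesis .
    next
      case False
      have Mr: "real M > 0" using M by simp
      have xi: "1 / x m \<le> real M / U" using False U Mr x by (simp add: field_simps)
      have gx: "g m = 1 / real m * (1 / x m)" by (simp add: g_def resonance_def x_def)
      have rm: "real m > 0" using m by simp
      \<comment> \<open>The loss factor common to the two ranges: \<open>1 - w\<^sup>2 \<le> 2 \<rho>\<close> for \<open>m \<le> M\<close>, and trivially 1 beyond.\<close>
      define \<rho> where "\<rho> = (if m \<le> M then real m / real M else 1)"
      have \<rho>g: "\<rho> * g m \<le> 1 / U"
      proof -
        have "\<rho> * g m = \<rho> / real m * (1 / x m)" by (simp add: gx)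
        also have "\<dots> \<le> 1 / real M * (real M / U)"
          using xi x rm Mr by (intro mult_mono) (auto simp: \<rho>_def field_simps)
        finally show ?thesis using Mr by simp
      qed
      have "\<bar>(w m)\<^sup>2 * Q - t m\<bar> \<le> 2 * (\<rho> * Q)"
      proof (cases "m \<le> M")
        case True
        have "1 - (w m)\<^sup>2 = (1 - w m) * (1 + w m)" by (simp add: power2_eq_square algebra_simps)
        also have "\<dots> \<le> (1 - w m) * 2" using w by (intro mult_left_mono) auto
        also have "1 - w m = real m / real H" by (simp add: w_def fejer_weight_def)
        also have "real m / real H \<le> \<rho>" unfolding \<rho>_def using True M Mr by (auto intro!: divide_left_mono)
        finally have "(1 - (w m)\<^sup>2) * Q \<le> (\<rho> * 2) * Q" using Q0 by (intro mult_right_mono) auto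
        moreover have "\<bar>(w m)\<^sup>2 * Q - t m\<bar> = (1 - (w m)\<^sup>2) * Q"
        proof -
          have "t m = Q" using True by (simp add: t_def Q_def)
          hence "(w m)\<^sup>2 * Q - t m = - ((1 - (w m)\<^sup>2) * Q)" by (simp add: algebra_simps)
          thus ?thesis using w2 Q0 by (simp add: abs_mult)
        qed
        ultimately show ?thesis by (simp add: mult_ac)
      next
        case False
        have "(w m)\<^sup>2 * Q \<le> 1 * Q" using w2 Q0 by (intro mult_right_mono) auto
        thus ?thesis using False w2 Q0 by (simp add: t_def \<rho>_def abs_mult)
      qed
      also have "\<dots> \<le> 2 * (\<rho> * (V\<^sup>2 * (g m)\<^sup>2 / 16))"
        using Q by (intro mult_left_mono) (auto simp: \<rho>_def)
      also have "\<dots> = V\<^sup>2 * ((\<rho> * g m) * g m) / 8" by (simp add: power2_eq_square)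
      also have "\<dots> \<le> V\<^sup>2 * ((\<rho> * g m) * g m)" using gnn by (simp add: \<rho>_def)
      also have "\<dots> \<le> V\<^sup>2 * (1 / U * g m)" using \<rho>g gnn by (intro mult_left_mono mult_right_mono) auto
      also have "\<dots> \<le> V\<^sup>2 * ((s m)\<^sup>2 + g m / U)" by (intro mult_left_mono) auto
      finally show ?thesis .
    qed
    moreover have "\<bar>(w m)\<^sup>2 * \<phi> m * r / 2\<bar> \<le> V\<^sup>2 * (1 / 2 * (1 / (real m)\<^sup>2))"
    proof -
      have "(w m)\<^sup>2 * \<phi> m * r \<le> 1 * (V\<^sup>2 / (16 * (real m)\<^sup>2)) * 1"
        using w2 \<phi>0 \<phi>le r V_nonneg by (intro mult_mono) auto
      also have "\<dots> = V\<^sup>2 * (1 / (real m)\<^sup>2) / 16" by simp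
      also have "\<dots> \<le> V\<^sup>2 * (1 / (real m)\<^sup>2)"
      proof -
        have shrink: "y / 16 \<le> y" if "y \<ge> 0" for y :: real using that by simp
        show ?thesis by (rule shrink) simp
      qed
      finally show ?thesis using w2 \<phi>0 r by (simp add: abs_mult)
    qed
    ultimately have "\<bar>(w m)\<^sup>2 * \<phi> m * r / 2 + (w m)\<^sup>2 * Q - t m\<bar> \<le> V\<^sup>2 * (1 / 2 * (1 / (real m)\<^sup>2)) + V\<^sup>2 * ((s m)\<^sup>2 + g m / U)"
      by linarith
    thus ?thesis unfolding ze Q_def[symmetric] by (simp only: distrib_left add.assoc)
  qed
  have "\<bar>(\<Sum>m=1..H. 2 * ((w m)\<^sup>2 * \<phi> m / z m)) - (\<Sum>m=1..H. t m)\<bar> = \<bar>\<Sum>m=1..H. 2 * ((w m)\<^sup>2 * \<phi> m / z m) - t m\<bar>"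
    by (simp add: sum_subtractf)
  also have "\<dots> \<le> (\<Sum>m=1..H. V\<^sup>2 * (1 / 2 * (1 / (real m)\<^sup>2) + (s m)\<^sup>2 + g m / U))"
    by (rule order_trans[OF sum_abs], rule sum_mono, rule termwise)
  also have "\<dots> = V\<^sup>2 * (1 / 2 * (\<Sum>m=1..H. 1 / (real m)\<^sup>2) + (\<Sum>m=1..H. (s m)\<^sup>2) + (\<Sum>m=1..H. g m) / U)"
    by (simp only: sum_distrib_left[symmetric] sum.distrib sum_divide_distrib[symmetric])
  also have "\<dots> \<le> V\<^sup>2 * (1 + W\<^sup>2 + F / U)"
  proof (intro mult_left_mono add_mono divide_right_mono)
    show "1 / 2 * (\<Sum>m=1..H. 1 / (real m)\<^sup>2) \<le> 1" using sum_inverse_squares_le[of H] by linarith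
    have "(\<Sum>m=1..H. s m) \<le> W"
    proof -
      have "W = 2 * (\<Sum>m=1..H. s m)"
        unfolding W_def strong_resonance_sum_def s_def by (rule sum_symmetric_int) simp
      thus ?thesis by (simp add: s_def sum_nonneg)
    qed
    hence "(\<Sum>m=1..H. s m)\<^sup>2 \<le> W\<^sup>2" by (intro power_mono) (auto simp: s_def sum_nonneg)
    thus "(\<Sum>m=1..H. (s m)\<^sup>2) \<le> W\<^sup>2"
      using sum_squares_le_square_sum[of "{1..H}" s] by (simp add: s_def)
    have "resonance_sum \<alpha> H = 2 * (\<Sum>m=1..H. g m)"
      unfolding resonance_sum_def g_def by (rule sum_symmetric_int) simp
    moreover have "(\<Sum>m=1..H. g m) \<ge> 0" by (simp add: g_def sum_nonneg)
    ultimately show "(\<Sum>m=1..H. g m) \<le> F"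
      using resonance_sum_mono[of H "2 * H" \<alpha>] by (simp add: F_def)
  qed (use U in auto)
  finally show ?thesis unfolding P T .
qed

text \<open>Everything that depends on \<open>f\<close> is contained in \<open>V\<close> and \<open>E\<close>, and everything that depends on the arithmetic of \<open>\<alpha>\<close> in
\<open>W\<close> and \<open>F\<close>.\<close>

lemma birkhoff_mean_variance_bound:
  assumes \<alpha>: "\<alpha> \<notin> \<rat>" and M: "M \<ge> 1" "M \<le> H" and U: "U > 0" and f0: "integral {0..1} f = 0"
    and E: "\<And>N. N \<in> {1..M} \<Longrightarrow> \<bar>birkhoff_sum \<alpha> f N - (\<Sum>n=1..N. fejer_mean H (real n * \<alpha>))\<bar> \<le> E"
  defines "W \<equiv> strong_resonance_sum \<alpha> (U / real M) H" and "F \<equiv> resonance_sum \<alpha> (2 * H)"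
  defines "\<Sigma> \<equiv> (\<Sum>m=1..M. (norm (fourier_coeff f (int m)))\<^sup>2 / (2 * pi\<^sup>2 * (int_dist (real m * \<alpha>))\<^sup>2))"
  defines "R \<equiv> V\<^sup>2 * (1 + 2 * W\<^sup>2 + F / U + 10 * F\<^sup>2 / U + (W + F / U)\<^sup>2)"
  shows "norm (complex_of_real (birkhoff_mean \<alpha> f M) - (\<Sum>m | m \<noteq> 0 \<and> \<bar>m\<bar> \<le> int H. cocycle_coeff \<alpha> H m))
           \<le> E + V * (W + F / U)" (is ?A)
    and "\<bar>birkhoff_variance \<alpha> f M - \<Sigma>\<bar> \<le> 4 * E * sqrt \<Sigma> + 8 * E\<^sup>2 + 2 * R" (is ?B)
proof -
  define I where "I = {m::int. m \<noteq> 0 \<and> \<bar>m\<bar> \<le> int H}"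
  define c where "c = cocycle_coeff \<alpha> H"
  define D where "D = (\<Sum>m\<in>I. c m)"
  define T where "T N = (\<Sum>m\<in>I. c m * echar (real N * (of_int m * \<alpha>)))" for N
  define \<epsilon> where "\<epsilon> N = complex_of_real (birkhoff_sum \<alpha> f N - (\<Sum>n=1..N. fejer_mean H (real n * \<alpha>)))" for N
  define \<mu> where "\<mu> = (\<Sum>N=1..M. T N) / of_nat M"
  define \<eta> where "\<eta> = (\<Sum>N=1..M. \<epsilon> N) / of_nat M"
  have fin: "finite I" by (simp add: I_def)
  have H1: "H \<ge> 1" and Mr: "real M > 0" using M by auto
  have nnW: "W \<ge> 0" "F \<ge> 0" "F / U \<ge> 0"
    using U by (auto simp: W_def F_def strong_resonance_sum_nonneg resonance_sum_nonneg)
  have cle: "norm (c m) \<le> V * resonance \<alpha> m" if "m \<in> I" for m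
    using norm_cocycle_coeff_le[OF \<alpha> _ _ H1] that by (simp add: c_def I_def)
  have S: "complex_of_real (birkhoff_sum \<alpha> f N) = D - T N + \<epsilon> N" for N
    unfolding \<epsilon>_def of_real_diff sum_fejer_mean_eq[OF \<alpha> H1 f0] D_def T_def c_def I_def by simp
  have \<epsilon>: "norm (\<epsilon> N) \<le> E" if "N \<in> {1..M}" for N
    using E[OF that] unfolding \<epsilon>_def norm_of_real .
  have "norm (\<Sum>N=1..M. \<epsilon> N) \<le> real M * E"
    using sum_norm_le[of "{1..M}" \<epsilon> "\<lambda>_. E"] \<epsilon> by simp
  hence \<eta>: "norm \<eta> \<le> E" using Mr by (simp add: \<eta>_def norm_divide divide_le_eq mult.commute)
  have E0: "E \<ge> 0" using \<eta> norm_ge_zero order_trans by blast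
  have A: "complex_of_real (birkhoff_mean \<alpha> f M) = D - \<mu> + \<eta>"
  proof -
    have "complex_of_real (birkhoff_mean \<alpha> f M) = (\<Sum>N=1..M. D - T N + \<epsilon> N) / of_nat M"
      unfolding birkhoff_mean_def S[symmetric] by simp
    thus ?thesis using Mr by (simp add: \<mu>_def \<eta>_def sum.distrib sum_subtractf add_divide_distrib diff_divide_distrib)
  qed
  have \<mu>: "norm \<mu> \<le> V * (W + F / U)"
  proof -
    have "\<mu> = (\<Sum>m\<in>I. c m * char_mean \<alpha> M m)"
    proof -
      have "(\<Sum>N=1..M. T N) = (\<Sum>m\<in>I. c m * (\<Sum>N=1..M. echar (real N * (of_int m * \<alpha>))))"
        unfolding T_def sum_distrib_left by (rule sum.swap)
      moreover have "(\<Sum>m\<in>I. c m * Z m) / of_nat M = (\<Sum>m\<in>I. c m * (Z m / of_nat M))" for Z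
        by (simp add: sum_divide_distrib)
      ultimately show ?thesis unfolding \<mu>_def char_mean_def by (simp only:)
    qed
    also have "norm \<dots> \<le> (\<Sum>m\<in>I. V * (strong_resonance \<alpha> (U / real M) m + resonance \<alpha> m / U))"
    proof (rule sum_norm_le)
      fix m assume m: "m \<in> I"
      define x where "x = int_dist (of_int m * \<alpha>)"
      have x: "x > 0" using int_dist_pos[OF \<alpha>] m by (simp add: x_def I_def)
      have "resonance \<alpha> m * norm (char_mean \<alpha> M m) \<le> strong_resonance \<alpha> (U / real M) m + resonance \<alpha> m / U"
      proof (cases "x < U / real M")
        case True
        have "resonance \<alpha> m * norm (char_mean \<alpha> M m) \<le> resonance \<alpha> m * 1"
          by (intro mult_left_mono norm_char_mean_le_1) auto
        also have "\<dots> \<le> strong_resonance \<alpha> (U / real M) m + resonance \<alpha> m / U"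
          using True U by (simp add: strong_resonance_def x_def)
        finally show ?thesis .
      next
        case False
        have "U \<le> real M * x" using False Mr by (simp add: not_less pos_divide_le_eq mult.commute)
        hence "1 / (real M * x) \<le> 1 / U" using U by (intro frac_le) auto
        hence "norm (char_mean \<alpha> M m) \<le> 1 / U"
          using norm_char_mean_le[OF \<alpha> _ M(1), of m] m by (simp add: x_def I_def)
        hence "resonance \<alpha> m * norm (char_mean \<alpha> M m) \<le> resonance \<alpha> m * (1 / U)"
          by (intro mult_left_mono) auto
        hence "resonance \<alpha> m * norm (char_mean \<alpha> M m) \<le> resonance \<alpha> m / U" by simp
        thus ?thesis using strong_resonance_nonneg[of \<alpha> "U / real M" m] by linarith
      qed
      hence "V * (resonance \<alpha> m * norm (char_mean \<alpha> M m)) \<le> V * (strong_resonance \<alpha> (U / real M) m + resonance \<alpha> m / U)"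
        using V_nonneg by (intro mult_left_mono)
      moreover have "norm (c m * char_mean \<alpha> M m) \<le> (V * resonance \<alpha> m) * norm (char_mean \<alpha> M m)"
        unfolding norm_mult using cle[OF m] by (intro mult_right_mono) auto
      ultimately show "norm (c m * char_mean \<alpha> M m) \<le> V * (strong_resonance \<alpha> (U / real M) m + resonance \<alpha> m / U)"
        by (simp add: mult.assoc)
    qed
    also have "\<dots> = V * (W + resonance_sum \<alpha> H / U)"
      by (simp only: sum_distrib_left[symmetric] sum.distrib sum_divide_distrib[symmetric]
          W_def strong_resonance_sum_def resonance_sum_def I_def)
    also have "\<dots> \<le> V * (W + F / U)"
      using V_nonneg U resonance_sum_mono[of H "2 * H" \<alpha>]
      by (intro mult_left_mono add_left_mono divide_right_mono) (auto simp: F_def)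
    finally show ?thesis .
  qed
  have "norm (\<eta> - \<mu>) \<le> E + V * (W + F / U)"
    using norm_triangle_ineq4[of \<eta> \<mu>] \<eta> \<mu> by linarith
  moreover have "complex_of_real (birkhoff_mean \<alpha> f M) - D = \<eta> - \<mu>" by (simp add: A)
  ultimately show ?A by (simp add: D_def c_def I_def)

  define P where "P = (\<Sum>m\<in>I. (norm (c m))\<^sup>2)"
  define T2 where "T2 = (\<Sum>N=1..M. (norm (T N))\<^sup>2) / real M"
  have off: "\<bar>T2 - P\<bar> \<le> V\<^sup>2 * (W\<^sup>2 + 10 * F\<^sup>2 / U)"
  proof -
    define K where "K n = norm (char_mean \<alpha> M n)" for n
    have "complex_of_real T2 = (\<Sum>m\<in>I. \<Sum>m'\<in>I. c m * cnj (c m') * char_mean \<alpha> M (m - m'))"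
      unfolding T2_def T_def by (rule mean_square_trig_poly[OF M(1) fin])
    also have "\<dots> = (\<Sum>m\<in>I. c m * cnj (c m) + (\<Sum>m'\<in>I - {m}. c m * cnj (c m') * char_mean \<alpha> M (m - m')))"
    proof (rule sum.cong[OF refl])
      fix m assume "m \<in> I"
      from sum.remove[OF fin this, of "\<lambda>m'. c m * cnj (c m') * char_mean \<alpha> M (m - m')"]
      show "(\<Sum>m'\<in>I. c m * cnj (c m') * char_mean \<alpha> M (m - m'))
          = c m * cnj (c m) + (\<Sum>m'\<in>I - {m}. c m * cnj (c m') * char_mean \<alpha> M (m - m'))"
        by (simp add: char_mean_0[OF M(1)])
    qed
    also have "\<dots> = complex_of_real P + (\<Sum>m\<in>I. \<Sum>m'\<in>I - {m}. c m * cnj (c m') * char_mean \<alpha> M (m - m'))"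
      unfolding P_def of_real_sum complex_norm_square by (rule sum.distrib)
    finally have "complex_of_real (T2 - P) = (\<Sum>m\<in>I. \<Sum>m'\<in>I - {m}. c m * cnj (c m') * char_mean \<alpha> M (m - m'))"
      by simp
    hence "\<bar>T2 - P\<bar> = norm (\<Sum>m\<in>I. \<Sum>m'\<in>I - {m}. c m * cnj (c m') * char_mean \<alpha> M (m - m'))"
      by (metis norm_of_real)
    also have "\<dots> \<le> (\<Sum>m\<in>I. \<Sum>m'\<in>I - {m}. V\<^sup>2 * (resonance \<alpha> m * resonance \<alpha> m' * K (m - m')))"
    proof (intro sum_norm_le)
      fix m m' assume m: "m \<in> I" "m' \<in> I - {m}"
      have "norm (c m * cnj (c m') * char_mean \<alpha> M (m - m')) = norm (c m) * norm (c m') * K (m - m')"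
        by (simp add: norm_mult K_def)
      also have "\<dots> \<le> (V * resonance \<alpha> m) * (V * resonance \<alpha> m') * K (m - m')"
        using cle[of m] cle[of m'] m V_nonneg by (intro mult_right_mono mult_mono) (auto simp: K_def)
      finally show "norm (c m * cnj (c m') * char_mean \<alpha> M (m - m')) \<le> V\<^sup>2 * (resonance \<alpha> m * resonance \<alpha> m' * K (m - m'))"
        by (simp add: power2_eq_square mult_ac)
    qed
    also have "\<dots> = V\<^sup>2 * (\<Sum>m\<in>I. \<Sum>m'\<in>I - {m}. resonance \<alpha> m * resonance \<alpha> m' * K (m - m'))"
      by (simp add: sum_distrib_left)
    also have "\<dots> \<le> V\<^sup>2 * (W\<^sup>2 + 10 * F\<^sup>2 / U)"
    proof (rule mult_left_mono)
      show "(\<Sum>m\<in>I. \<Sum>m'\<in>I - {m}. resonance \<alpha> m * resonance \<alpha> m' * K (m - m')) \<le> W\<^sup>2 + 10 * F\<^sup>2 / U"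
        unfolding W_def F_def I_def
        by (rule resonance_bilinear_le[OF \<alpha> M(1) U])
          (auto simp: K_def intro: norm_char_mean_le_1 norm_char_mean_le[OF \<alpha> _ M(1)])
    qed simp
    finally show ?thesis .
  qed
  have diag: "\<bar>P - \<Sigma>\<bar> \<le> V\<^sup>2 * (1 + W\<^sup>2 + F / U)"
    using diagonal_sum_close[OF \<alpha> M U] by (simp add: P_def c_def I_def \<Sigma>_def W_def F_def)
  define \<tau>2 where "\<tau>2 = (\<Sum>N=1..M. (norm (T N - \<mu>))\<^sup>2) / real M"
  have t2: "\<tau>2 = T2 - (norm \<mu>)\<^sup>2"
    unfolding \<tau>2_def T2_def \<mu>_def by (rule mean_square_centered[OF M(1)])
  have "(norm \<mu>)\<^sup>2 \<le> (V * (W + F / U))\<^sup>2" using \<mu> by (intro power_mono) auto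
  hence \<mu>2: "(norm \<mu>)\<^sup>2 \<le> V\<^sup>2 * (W + F / U)\<^sup>2" by (simp add: power_mult_distrib)
  have Req: "R = V\<^sup>2 * (1 + W\<^sup>2 + F / U) + V\<^sup>2 * (W\<^sup>2 + 10 * F\<^sup>2 / U) + V\<^sup>2 * (W + F / U)\<^sup>2"
    by (simp add: R_def algebra_simps)
  have t\<Sigma>: "\<bar>\<tau>2 - \<Sigma>\<bar> \<le> R"
    using off diag \<mu>2 t2 zero_le_power2[of "norm \<mu>"] unfolding Req by linarith
  have R0: "R \<ge> 0" using t\<Sigma> by linarith
  have \<Sigma>0: "\<Sigma> \<ge> 0" by (simp add: \<Sigma>_def sum_nonneg)
  have "birkhoff_variance \<alpha> f M = (\<Sum>N=1..M. (norm ((\<mu> - T N) + (\<epsilon> N - \<eta>)))\<^sup>2) / real M"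
  proof -
    have "(birkhoff_sum \<alpha> f N - birkhoff_mean \<alpha> f M)\<^sup>2 = (norm ((\<mu> - T N) + (\<epsilon> N - \<eta>)))\<^sup>2" for N
    proof -
      have "(\<mu> - T N) + (\<epsilon> N - \<eta>) = complex_of_real (birkhoff_sum \<alpha> f N - birkhoff_mean \<alpha> f M)"
        unfolding of_real_diff S A by simp
      thus ?thesis by (simp only: norm_of_real power2_abs)
    qed
    thus ?thesis by (simp add: birkhoff_variance_def)
  qed
  moreover have "\<tau>2 = (\<Sum>N=1..M. (norm (\<mu> - T N))\<^sup>2) / real M"
    by (simp add: \<tau>2_def norm_minus_commute)
  moreover have "norm (\<epsilon> N - \<eta>) \<le> 2 * E" if "N \<in> {1..M}" for N
    using norm_triangle_ineq4[of "\<epsilon> N" \<eta>] \<epsilon>[OF that] \<eta> by linarith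
  ultimately have bv: "\<bar>birkhoff_variance \<alpha> f M - \<tau>2\<bar> \<le> 2 * (2 * E) * sqrt \<tau>2 + (2 * E)\<^sup>2"
    using mean_square_perturbation[OF M(1), of "\<lambda>N. \<epsilon> N - \<eta>" "2 * E" "\<lambda>N. \<mu> - T N"] by simp
  have "sqrt \<tau>2 \<le> sqrt (\<Sigma> + R)" using t\<Sigma> by simp
  also have "\<dots> \<le> sqrt \<Sigma> + sqrt R" by (rule sqrt_add_le_add_sqrt[OF \<Sigma>0 R0])
  finally have "4 * E * sqrt \<tau>2 \<le> 4 * E * (sqrt \<Sigma> + sqrt R)" using E0 by (intro mult_left_mono) auto
  moreover have "4 * E * sqrt R \<le> 4 * E\<^sup>2 + R"
  proof -
    have "0 \<le> (2 * E - sqrt R)\<^sup>2" by simp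
    also have "\<dots> = 4 * E\<^sup>2 + R - 4 * E * sqrt R"
      using R0 by (simp add: power2_eq_square algebra_simps)
    finally show ?thesis by simp
  qed
  moreover have "4 * E * (sqrt \<Sigma> + sqrt R) = 4 * E * sqrt \<Sigma> + 4 * E * sqrt R" by (rule distrib_left)
  moreover have "2 * (2 * E) * sqrt \<tau>2 = 4 * E * sqrt \<tau>2" "(2 * E)\<^sup>2 = 4 * E\<^sup>2"
    by (simp_all add: power_mult_distrib)
  ultimately show ?B using bv t\<Sigma> by linarith
qed

end

section \<open>Continued fractions\<close>

text \<open>The product of the matrices with rows \<open>(a, 1)\<close> and \<open>(1, 0)\<close>, as \<open>(p, p', q, q')\<close> with rows \<open>(p, p')\<close> and \<open>(q, q')\<close>. Its
columns hold the last two convergents. The recursion follows that of \<open>cf_value\<close> from the front, and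
\<open>cf_matrix_snoc\<close> turns it into the classical recurrence from the back.\<close>

fun cf_matrix :: "int list \<Rightarrow> int \<times> int \<times> int \<times> int" where
  "cf_matrix [] = (1, 0, 0, 1)"
| "cf_matrix (a # as) = (case cf_matrix as of (p, p', q, q') \<Rightarrow> (a * p + q, a * p' + q', p, p'))"

lemma cf_matrix_snoc:
  "cf_matrix (as @ [x]) = (case cf_matrix as of (p, p', q, q') \<Rightarrow> (p * x + p', p, q * x + q', q))"
  by (induction as) (auto simp: algebra_simps split: prod.splits)

lemma cf_matrix_det:
  "cf_matrix as = (p, p', q, q') \<Longrightarrow> p * q' - p' * q = (-1) ^ length as"
  by (induction as arbitrary: p p' q q') (auto simp: algebra_simps split: prod.splits)

lemma cf_value_eq_matrix:
  assumes "as \<noteq> []" "\<forall>x\<in>set (tl as). x \<ge> 1" "cf_matrix as = (p, p', q, q')"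
  shows "q \<ge> 1 \<and> (hd as \<ge> 1 \<longrightarrow> p \<ge> 1) \<and> cf_value as = of_int p / of_int q"
  using assms
proof (induction as arbitrary: p p' q q' rule: cf_value.induct)
  case (3 a b as)
  obtain r r' s s' where m: "cf_matrix (b # as) = (r, r', s, s')" by (metis prod_cases4)
  have IH: "s \<ge> 1 \<and> r \<ge> 1 \<and> cf_value (b # as) = of_int r / of_int s"
    using "3.IH"[OF _ _ m] "3.prems"(2) by auto
  have e: "p = a * r + s" "q = r" using "3.prems"(3) m by (auto simp del: cf_matrix.simps(2) simp: cf_matrix.simps(2)[of a])
  have "a \<ge> 1 \<Longrightarrow> a * r \<ge> 0" using IH by simp
  hence "a \<ge> 1 \<Longrightarrow> a * r + s \<ge> 1" using IH by linarith
  thus ?case using IH by (auto simp: e field_simps)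
qed auto

text \<open>At index \<open>k\<close> the primed components are the numerator and denominator of the convergent with index \<open>k - 1\<close>; at \<open>k = 0\<close>
they are \<open>1\<close> and \<open>0\<close>.\<close>

definition cf_data :: "real \<Rightarrow> nat \<Rightarrow> int \<times> int \<times> int \<times> int" where
  "cf_data \<alpha> k = cf_matrix (map (cf_quot \<alpha>) [0..<Suc k])"

definition "cf_p \<alpha> k = fst (cf_data \<alpha> k)"
definition "cf_q \<alpha> k = fst (snd (snd (cf_data \<alpha> k)))"
definition "cf_p' \<alpha> k = fst (snd (cf_data \<alpha> k))"
definition "cf_q' \<alpha> k = snd (snd (snd (cf_data \<alpha> k)))"

lemma cf_data_eq: "cf_matrix (map (cf_quot \<alpha>) [0..<Suc k]) = (cf_p \<alpha> k, cf_p' \<alpha> k, cf_q \<alpha> k, cf_q' \<alpha> k)"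
  unfolding cf_data_def[symmetric] by (simp add: cf_p_def cf_q_def cf_p'_def cf_q'_def)

lemma cf_data_0:
  "cf_p \<alpha> 0 = cf_quot \<alpha> 0" "cf_p' \<alpha> 0 = 1" "cf_q \<alpha> 0 = 1" "cf_q' \<alpha> 0 = 0"
  by (simp_all add: cf_p_def cf_q_def cf_p'_def cf_q'_def cf_data_def)

lemma cf_data_Suc:
  "cf_p \<alpha> (Suc k) = cf_quot \<alpha> (Suc k) * cf_p \<alpha> k + cf_p' \<alpha> k" "cf_p' \<alpha> (Suc k) = cf_p \<alpha> k"
  "cf_q \<alpha> (Suc k) = cf_quot \<alpha> (Suc k) * cf_q \<alpha> k + cf_q' \<alpha> k" "cf_q' \<alpha> (Suc k) = cf_q \<alpha> k"
proof -
  have "map (cf_quot \<alpha>) [0..<Suc (Suc k)] = map (cf_quot \<alpha>) [0..<Suc k] @ [cf_quot \<alpha> (Suc k)]" by simp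
  hence "cf_data \<alpha> (Suc k) = (case cf_data \<alpha> k of (p, p', q, q') \<Rightarrow>
      (p * cf_quot \<alpha> (Suc k) + p', p, q * cf_quot \<alpha> (Suc k) + q', q))"
    unfolding cf_data_def by (simp only: cf_matrix_snoc)
  thus "cf_p \<alpha> (Suc k) = cf_quot \<alpha> (Suc k) * cf_p \<alpha> k + cf_p' \<alpha> k" "cf_p' \<alpha> (Suc k) = cf_p \<alpha> k"
  "cf_q \<alpha> (Suc k) = cf_quot \<alpha> (Suc k) * cf_q \<alpha> k + cf_q' \<alpha> k" "cf_q' \<alpha> (Suc k) = cf_q \<alpha> k"
    by (simp_all add: cf_p_def cf_q_def cf_p'_def cf_q'_def split: prod.splits)
qed

lemma cf_det: "cf_p \<alpha> k * cf_q' \<alpha> k - cf_p' \<alpha> k * cf_q \<alpha> k = (-1) ^ Suc k"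
  using cf_matrix_det[OF cf_data_eq[of \<alpha> k]] by simp

locale irrational_cf =
  fixes \<alpha> :: real
  assumes irrational: "\<alpha> \<notin> \<rat>"
begin

abbreviation "a \<equiv> cf_quot \<alpha>"
abbreviation "p \<equiv> cf_p \<alpha>"
abbreviation "q \<equiv> cf_q \<alpha>"
abbreviation "p' \<equiv> cf_p' \<alpha>"
abbreviation "q' \<equiv> cf_q' \<alpha>"

lemma frac_not_Rats: "x \<notin> \<rat> \<Longrightarrow> frac x \<notin> (\<rat> :: real set)"
  by (metis Rats_add Rats_of_int add.commute diff_add_cancel frac_def)

lemma cf_complete_irrational: "cf_complete \<alpha> k \<notin> \<rat>"
proof (induction k)
  case (Suc k)
  show ?case
  proof
    assume "cf_complete \<alpha> (Suc k) \<in> \<rat>"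
    hence "inverse (1 / frac (cf_complete \<alpha> k)) \<in> \<rat>" by (intro Rats_inverse) (simp only: cf_complete.simps)
    thus False using frac_not_Rats[OF Suc] by (simp only: inverse_divide div_by_1)
  qed
qed (use irrational in simp)

lemma frac_complete: "0 < frac (cf_complete \<alpha> k)" "frac (cf_complete \<alpha> k) < 1"
proof -
  show "frac (cf_complete \<alpha> k) < 1" by (rule frac_lt_1)
  have "frac (cf_complete \<alpha> k) \<noteq> 0"
    using frac_not_Rats[OF cf_complete_irrational[of k]] by (metis Rats_0)
  thus "0 < frac (cf_complete \<alpha> k)" using frac_ge_0[of "cf_complete \<alpha> k"] by linarith
qed

lemma cf_complete_Suc_gt_1: "cf_complete \<alpha> (Suc k) > 1"
  using frac_complete[of k] by simp

lemma a_ge_1: "k \<ge> 1 \<Longrightarrow> a k \<ge> 1"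
  using cf_complete_Suc_gt_1[of "k - 1"] by (simp add: cf_quot_def le_floor_iff)

lemma a_bounds: "a k \<le> cf_complete \<alpha> k" "cf_complete \<alpha> k < a k + 1"
  by (simp_all add: cf_quot_def)

lemma q_pos: "q k \<ge> 1" and q'_le: "0 \<le> q' k" "q' k \<le> q k"
proof -
  have "q k \<ge> 1 \<and> 0 \<le> q' k \<and> q' k \<le> q k"
  proof (induction k)
    case (Suc k)
    have "1 * q k \<le> a (Suc k) * q k" using a_ge_1[of "Suc k"] Suc by (intro mult_right_mono) auto
    thus ?case using Suc unfolding cf_data_Suc by linarith
  qed (simp add: cf_data_0)
  thus "q k \<ge> 1" "0 \<le> q' k" "q' k \<le> q k" by auto
qed

lemma q_mono_Suc: "q k \<le> q (Suc k)"
  using q'_le(2)[of "Suc k"] by (simp add: cf_data_Suc)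

lemma q_mono: "j \<le> k \<Longrightarrow> q j \<le> q k"
  by (rule lift_Suc_mono_le[of q]) (rule q_mono_Suc)

lemma q_Suc_Suc_ge: "2 * q k \<le> q (Suc (Suc k))"
proof -
  have "1 * q (Suc k) \<le> a (Suc (Suc k)) * q (Suc k)"
    using a_ge_1[of "Suc (Suc k)"] q_pos[of "Suc k"] by (intro mult_right_mono) auto
  thus ?thesis using q_mono_Suc[of k] cf_data_Suc(3)[of \<alpha> "Suc k"] cf_data_Suc(4)[of \<alpha> k] by linarith
qed

lemma q_growth: "2 ^ t * q j \<le> q (j + 2 * t)"
proof (induction t)
  case (Suc t)
  have "2 ^ Suc t * q j \<le> 2 * q (j + 2 * t)" using Suc by simp
  also have "\<dots> \<le> q (Suc (Suc (j + 2 * t)))" by (rule q_Suc_Suc_ge)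
  finally show ?case by simp
qed simp

lemma q_Suc_le: "q (Suc k) \<le> 2 * a (Suc k) * q k"
proof -
  have "1 * q k \<le> a (Suc k) * q k" using a_ge_1[of "Suc k"] q_pos[of k] by (intro mult_right_mono) auto
  thus ?thesis using q'_le(2)[of k] cf_data_Suc(3)[of \<alpha> k] by linarith
qed

lemma cf_denom_eq_q: "cf_denom \<alpha> k = q k"
proof -
  have "cf_value (map (cf_quot \<alpha>) [0..<Suc k]) = of_int (p k) / of_int (q k)"
  proof -
    have "\<forall>x\<in>set (tl (map a [0..<Suc k])). x \<ge> 1"
      using a_ge_1 by (auto simp: upt_conv_Cons simp del: upt_Suc)
    from cf_value_eq_matrix[OF _ this cf_data_eq] show ?thesis by simp
  qed
  hence "cf_convergent \<alpha> k = Fract (p k) (q k)"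
    by (simp add: cf_convergent_def Fract_of_int_quotient)
  moreover have "coprime (p k) (q k)"
  proof (rule coprimeI)
    fix c assume "c dvd p k" "c dvd q k"
    hence "c dvd p k * q' k - p' k * q k" by simp
    thus "is_unit c" unfolding cf_det using dvd_trans[of c "(-1) ^ Suc k" 1] by (metis dvd_minus_iff minus_one_power_iff)
  qed
  ultimately show ?thesis using q_pos[of k]
    by (simp add: cf_denom_def quotient_of_Fract normalize_stable)
qed

lemma alpha_eq: "\<alpha> * (cf_complete \<alpha> (Suc k) * q k + q' k) = cf_complete \<alpha> (Suc k) * p k + p' k"
proof (induction k)
  case 0
  have "frac \<alpha> > 0" using frac_complete[of 0] by simp
  thus ?case by (simp add: cf_data_0 cf_quot_def frac_def field_simps)
next
  case (Suc k)
  define x where "x = cf_complete \<alpha> (Suc k)"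
  define y where "y = cf_complete \<alpha> (Suc (Suc k))"
  have fr: "frac x > 0" using frac_complete[of "Suc k"] by (simp add: x_def)
  have y: "y = 1 / (x - a (Suc k))" by (simp add: y_def x_def cf_quot_def frac_def)
  have ne: "x - a (Suc k) > 0" using fr by (simp add: cf_quot_def x_def frac_def)
  have x: "x = a (Suc k) + 1 / y" using ne by (simp add: y)
  have y0: "y \<noteq> 0" using ne by (simp add: y)
  have "\<alpha> * (y * q (Suc k) + q' (Suc k)) = y * (\<alpha> * (x * q k + q' k))"
    unfolding cf_data_Suc using y0 by (subst x) (simp add: algebra_simps)
  also have "\<dots> = y * (x * p k + p' k)" using Suc by (simp add: x_def)
  also have "\<dots> = y * p (Suc k) + p' (Suc k)"
    unfolding cf_data_Suc using y0 by (subst x) (simp add: algebra_simps)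
  finally show ?case by (simp add: y_def)
qed

definition \<theta> :: "nat \<Rightarrow> real" where "\<theta> k = q k * \<alpha> - p k"

lemma theta_eq: "\<theta> k = (-1) ^ k / (cf_complete \<alpha> (Suc k) * q k + q' k)"
proof -
  define x where "x = cf_complete \<alpha> (Suc k)"
  have D: "x * q k + q' k > 0"
    using q_pos[of k] q'_le[of k] cf_complete_Suc_gt_1[of k]
    by (intro add_pos_nonneg mult_pos_pos) (auto simp: x_def simp del: cf_complete.simps)
  have "\<theta> k * (x * q k + q' k) = q k * (\<alpha> * (x * q k + q' k)) - p k * (x * q k + q' k)"
    by (simp add: \<theta>_def algebra_simps)
  also have "\<dots> = - real_of_int (p k * q' k - p' k * q k)"
    unfolding alpha_eq[of k, folded x_def] by (simp add: algebra_simps)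
  also have "\<dots> = (-1) ^ k" unfolding cf_det by simp
  finally show ?thesis using D by (simp add: x_def field_simps)
qed

lemma theta_denom_pos: "cf_complete \<alpha> (Suc k) * q k + q' k > 0"
  using q_pos[of k] q'_le[of k] cf_complete_Suc_gt_1[of k]
  by (intro add_pos_nonneg mult_pos_pos) (auto simp del: cf_complete.simps)

lemma abs_theta_ge: "\<bar>\<theta> k\<bar> \<ge> 1 / (2 * q (Suc k))"
proof -
  have "cf_complete \<alpha> (Suc k) * q k \<le> (real_of_int (a (Suc k)) + 1) * real_of_int (q k)"
    using a_bounds(2)[of "Suc k"] q_pos[of k] by (intro mult_right_mono) auto
  hence "cf_complete \<alpha> (Suc k) * q k + q' k \<le> real_of_int (q (Suc k)) + q k"
    by (simp add: cf_data_Suc algebra_simps)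
  also have "\<dots> \<le> 2 * q (Suc k)" using q_mono_Suc[of k] by simp
  finally have "1 / (2 * q (Suc k)) \<le> 1 / (cf_complete \<alpha> (Suc k) * q k + q' k)"
    using theta_denom_pos[of k] by (intro divide_left_mono) auto
  also have "\<dots> = \<bar>\<theta> k\<bar>" using theta_denom_pos[of k] by (simp add: theta_eq)
  finally show ?thesis .
qed

lemma theta_alternating: "\<theta> k * \<theta> (Suc k) < 0"
proof -
  have "\<theta> k * \<theta> (Suc k) = - (((-1) ^ k)\<^sup>2 / ((cf_complete \<alpha> (Suc k) * q k + q' k) * (cf_complete \<alpha> (Suc (Suc k)) * q (Suc k) + q' (Suc k))))"
    unfolding theta_eq[of k] theta_eq[of "Suc k"] power2_eq_square by simp
  thus ?thesis using theta_denom_pos[of k] theta_denom_pos[of "Suc k"] by (simp add: power_mult[symmetric] mult.commute[of k])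
qed

text \<open>Consecutive convergents form a unimodular basis of the integer lattice. Because \<open>0 < n < q(j+1)\<close>, the coordinates
\<open>u, w\<close> of \<open>(n, m)\<close> in it satisfy \<open>w \<noteq> 0\<close> and \<open>u w \<le> 0\<close>. Since the errors \<open>\<theta>\<close> alternate in sign, the two contributions to \<open>n \<alpha> - m\<close> do not
cancel.\<close>

lemma best_approximation:
  fixes n m :: int
  assumes "0 < n" "n < q (Suc j)"
  shows "\<bar>\<theta> j\<bar> \<le> \<bar>n * \<alpha> - m\<bar>"
proof -
  define e :: int where "e = (-1) ^ j"
  have e2: "e * e = 1" by (simp add: e_def power_mult_distrib[symmetric])
  have det: "p (Suc j) * q j - p j * q (Suc j) = e"
    using cf_det[of \<alpha> "Suc j"] by (simp add: cf_data_Suc(2,4) e_def)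
  \<comment> \<open>Cramer's rule for the basis given by the convergents with indices j + 1 and j.\<close>
  define u where "u = e * (m * q j - n * p j)"
  define w where "w = e * (n * p (Suc j) - m * q (Suc j))"
  have "u * q (Suc j) + w * q j = e * (n * (p (Suc j) * q j - p j * q (Suc j)))"
    by (simp add: u_def w_def algebra_simps)
  hence n: "n = u * q (Suc j) + w * q j" unfolding det using e2 by (simp add: algebra_simps)
  have "u * p (Suc j) + w * p j = e * (m * (p (Suc j) * q j - p j * q (Suc j)))"
    by (simp add: u_def w_def algebra_simps)
  hence m: "m = u * p (Suc j) + w * p j" unfolding det using e2 by (simp add: algebra_simps)
  have lin: "n * \<alpha> - m = u * \<theta> (Suc j) + w * \<theta> j"
    by (subst n, subst m) (simp add: \<theta>_def algebra_simps)
  have Q: "q (Suc j) \<ge> 1" "q j \<ge> 1" using q_pos by auto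
  have "w \<noteq> 0"
  proof
    assume "w = 0"
    hence *: "n = u * q (Suc j)" using n by simp
    hence "u \<ge> 1" using assms(1) Q by (simp add: zero_less_mult_iff)
    hence "1 * q (Suc j) \<le> u * q (Suc j)" using Q by (intro mult_right_mono) auto
    thus False using * assms(2) by simp
  qed
  have "u * w \<le> 0"
  proof (rule ccontr)
    assume "\<not> u * w \<le> 0"
    hence "(u \<ge> 1 \<and> w \<ge> 1) \<or> (u \<le> -1 \<and> w \<le> -1)" by (auto simp: mult_le_0_iff)
    thus False
    proof
      assume uw: "u \<ge> 1 \<and> w \<ge> 1"
      hence "1 * q (Suc j) \<le> u * q (Suc j)" "0 \<le> w * q j" using Q by (auto intro!: mult_right_mono mult_nonneg_nonneg)
      thus False using n assms by linarith
    next
      assume uw: "u \<le> -1 \<and> w \<le> -1"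
      hence "u * q (Suc j) \<le> 0" "w * q j \<le> 0" using Q by (auto intro!: mult_nonpos_nonneg)
      thus False using n assms by linarith
    qed
  qed
  hence same: "(u * \<theta> (Suc j)) * (w * \<theta> j) \<ge> 0"
  proof -
    have "(u * \<theta> (Suc j)) * (w * \<theta> j) = real_of_int (u * w) * (\<theta> j * \<theta> (Suc j))" by (simp add: algebra_simps)
    thus ?thesis using \<open>u * w \<le> 0\<close> theta_alternating[of j]
      by (simp only:) (intro mult_nonpos_nonpos, auto simp del: of_int_mult)
  qed
  have abs_add: "\<bar>y\<bar> \<le> \<bar>x + y\<bar>" if "x * y \<ge> 0" for x y :: real
    using that by (auto simp: zero_le_mult_iff)
  have "1 * \<bar>\<theta> j\<bar> \<le> \<bar>real_of_int w\<bar> * \<bar>\<theta> j\<bar>"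
    using \<open>w \<noteq> 0\<close> by (intro mult_right_mono) linarith+
  also have "\<dots> = \<bar>w * \<theta> j\<bar>" by (simp add: abs_mult)
  also have "\<dots> \<le> \<bar>u * \<theta> (Suc j) + w * \<theta> j\<bar>" by (rule abs_add) fact
  finally show ?thesis by (simp add: lin)
qed

lemma int_dist_ge_window:
  fixes X :: real
  assumes n: "0 < n" "real n \<le> X" and j: "q j \<le> X" "X < q (Suc j)"
  shows "int_dist (real n * \<alpha>) \<ge> 1 / (4 * a (Suc j) * X)"
proof -
  have n': "0 < int n" "int n < q (Suc j)" using n j by linarith+
  have a1: "a (Suc j) \<ge> 1" using a_ge_1 by simp
  have "real_of_int (q (Suc j)) \<le> 2 * real_of_int (a (Suc j)) * real_of_int (q j)"
    using q_Suc_le[of j] by (metis of_int_le_iff of_int_mult of_int_numeral)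
  also have "\<dots> \<le> (2 * real_of_int (a (Suc j))) * X" using a1 j by (intro mult_left_mono) auto
  finally have "1 / (4 * a (Suc j) * X) \<le> 1 / (2 * q (Suc j))"
    using q_pos[of "Suc j"] by (intro frac_le) (simp_all add: mult_ac)
  also have "\<dots> \<le> \<bar>\<theta> j\<bar>" by (rule abs_theta_ge)
  also have "\<dots> \<le> int_dist (real n * \<alpha>)"
    using best_approximation[OF n'] by (simp add: int_dist_def)
  finally show ?thesis .
qed

lemma q_ge_power_two: "q k \<ge> 2 ^ (k div 2)"
proof -
  have "2 ^ (k div 2) * 1 \<le> 2 ^ (k div 2) * q 0" using q_pos[of 0] by simp
  also have "\<dots> \<le> q (0 + 2 * (k div 2))" by (rule q_growth)
  also have "\<dots> \<le> q k" by (rule q_mono) simp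
  finally show ?thesis by simp
qed

lemma denom_bracket:
  fixes X :: real
  assumes "1 \<le> X"
  obtains j where "q j \<le> X" "X < q (Suc j)"
proof -
  have ex: "\<exists>j. X < q j"
  proof -
    obtain t where "X < 2 ^ t" using real_arch_pow[of 2 X] by auto
    also have "(2::real) ^ t = 2 ^ (2 * t div 2)" by simp
    also have "\<dots> \<le> q (2 * t)" using q_ge_power_two[of "2 * t"] by (metis of_int_le_iff of_int_numeral of_int_power)
    finally show ?thesis by blast
  qed
  define i where "i = (LEAST j. X < q j)"
  have i: "X < q i" unfolding i_def by (rule LeastI_ex[OF ex])
  have "i \<noteq> 0" using i assms by (auto simp: cf_data_0 intro: Nat.gr0I)
  then obtain j where j: "i = Suc j" by (cases i) auto
  have "\<not> X < q j" using not_less_Least[of j "\<lambda>j. X < q j"] j by (simp add: i_def[symmetric])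
  thus ?thesis using that[of j] i j by simp
qed

end

section \<open>Polynomially bounded partial quotients\<close>

lemma ln_3_gt_1: "ln 3 > (1::real)"
proof -
  have "exp 1 < (3::real)" using e_less_272 by simp
  hence "ln (exp 1) < ln (3::real)" by (subst ln_less_cancel_iff) auto
  thus ?thesis by simp
qed

lemma log_2_le_2_ln: "x \<ge> 1 \<Longrightarrow> log 2 x \<le> 2 * ln (x::real)"
proof -
  assume x: "x \<ge> 1"
  have "ln x * 1 \<le> ln x * (2 * ln 2)" using x ln2_ge_two_thirds by (intro mult_left_mono) auto
  thus ?thesis using ln2_ge_two_thirds by (simp add: log_def divide_le_eq mult_ac)
qed

text \<open>The scales attached to an orbit length: \<open>H\<close> is the order of the Fejer mean, and \<open>U/M\<close> the threshold below which a
frequency is strongly resonant.\<close>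

locale scale =
  fixes M :: nat and d :: real
  assumes M3: "M \<ge> 3" and d0: "d \<ge> 0"
begin

definition "L = ln (real M)"
definition "T = ln L"
definition "U = L powr (2 * d + 4)"
definition "H = nat \<lfloor>real M * L powr (2 * d + 1)\<rfloor>"

lemma L_ge: "L \<ge> ln 3" unfolding L_def using M3 by simp
lemma L1: "L > 1" using L_ge ln_3_gt_1 by linarith
lemma T_ge: "T \<ge> ln (ln 3)" unfolding T_def using L_ge ln_3_gt_1 by simp
lemma T_pos: "T > 0" unfolding T_def using L1 by simp
lemma T_le_L: "T \<le> L" unfolding T_def using ln_le_minus_one[of L] L1 by simp
lemma real_M_ge_3: "real M \<ge> 3" using M3 by simp

lemma L_powr_ge_1: "s \<ge> 0 \<Longrightarrow> L powr s \<ge> 1"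
  using L1 by (simp add: ge_one_powr_ge_zero)

lemma U1: "U \<ge> 1" unfolding U_def using d0 by (intro L_powr_ge_1) auto

lemma ln_L_powr: "ln (L powr s) = s * T" using L1 by (simp add: T_def ln_powr)

lemma H_bounds: "real H \<le> real M * L powr (2 * d + 1)" "real M * L powr (2 * d + 1) / 2 \<le> real H" "M \<le> H"
proof -
  define x where "x = real M * L powr (2 * d + 1)"
  have "L powr (2 * d + 1) \<ge> 1" using d0 by (intro L_powr_ge_1) auto
  hence x: "x \<ge> real M" using mult_left_mono[of 1 "L powr (2 * d + 1)" "real M"] by (simp add: x_def)
  have "real H \<le> x" "real H > x - 1" unfolding H_def x_def[symmetric] using x by linarith+
  thus "real H \<le> real M * L powr (2 * d + 1)" "real M * L powr (2 * d + 1) / 2 \<le> real H" "M \<le> H"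
    using x real_M_ge_3 unfolding x_def[symmetric] by linarith+
qed

lemma H1: "H \<ge> 1" "real H \<ge> 1" using H_bounds(3) M3 by auto

lemma ln_4H_le: "ln (4 * real H) \<le> (2 * d + 4) * L"
proof -
  have "4 * real H \<le> 4 * (real M * L powr (2 * d + 1))" using H_bounds(1) by simp
  hence "ln (4 * real H) \<le> ln (4 * (real M * L powr (2 * d + 1)))" using H1 by (intro ln_mono) auto
  also have "\<dots> = ln 4 + L + (2 * d + 1) * T"
    using real_M_ge_3 L1 by (simp add: ln_mult ln_powr T_def[symmetric] L_def[symmetric])
  also have "ln (4::real) \<le> 2"
  proof -
    have "ln (4::real) = 2 * ln 2" using ln_realpow[of "2::real" 2] by simp
    moreover have "ln (2::real) \<le> 1" using ln_le_minus_one[of "2::real"] by simp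
    ultimately show ?thesis by linarith
  qed
  also have "2 + L + (2 * d + 1) * T \<le> 2 * L + L + (2 * d + 1) * L"
    using L1 T_le_L d0 by (intro add_mono mult_left_mono) auto
  finally show ?thesis by (simp add: algebra_simps)
qed

lemma ln_2H_le: "ln (2 * real H) \<le> (2 * d + 4) * L"
proof -
  have "ln (2 * real H) \<le> ln (4 * real H)" using H1 by simp
  thus ?thesis using ln_4H_le by linarith
qed

end

locale diophantine_scale = scale +
  fixes \<alpha> b :: real
  assumes \<alpha>: "\<alpha> \<notin> \<rat>" and b1: "b \<ge> 1"
    and far: "\<And>n. 1 \<le> n \<Longrightarrow> n \<le> 4 * H \<Longrightarrow> 1 / ((b * L powr d) * real n) \<le> int_dist (real n * \<alpha>)"
begin

definition "B = b * L powr d"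

lemma B1: "B \<ge> 1"
  unfolding B_def using mult_mono[of 1 b 1 "L powr d"] b1 L_powr_ge_1[OF d0] by simp

lemma ln_B: "ln B = ln b + d * T" "ln b \<ge> 0"
  unfolding B_def using b1 L1 by (auto simp: ln_mult ln_powr T_def)

lemma resonance_eq_nat: "resonance \<alpha> (int m) = 1 / (real m * int_dist (real m * \<alpha>))"
  by (simp add: resonance_def)

lemma resonance_sum_le_scale: "resonance_sum \<alpha> (2 * H) \<le> 8 * b * (5 + ln b + 3 * d) * (10 + 4 * d) * L powr (d + 2)"
proof -
  have "resonance_sum \<alpha> (2 * H) = 2 * (\<Sum>m=1..2*H. resonance \<alpha> (int m))"
    unfolding resonance_sum_def by (rule sum_symmetric_int) simp
  also have "(\<Sum>m=1..2*H. resonance \<alpha> (int m)) = (\<Sum>m | 1 \<le> m \<and> m \<le> 2 * H \<and> 1 \<le> real m \<and> int_dist (real m * \<alpha>) \<le> 1 / 2.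
             1 / (real m * int_dist (real m * \<alpha>)))"
    by (intro sum.cong) (use int_dist_le_half in \<open>auto simp: resonance_eq_nat simp del: le_divide_eq_numeral1\<close>)
  also have "\<dots> \<le> 4 * B * (1 + ln (max 1 (2 * B * real (2 * H) * (1 / 2)))) * (2 + log 2 (real (2 * H) / 1))"
  proof (rule sum_resonances_le)
    fix n :: nat assume n: "1 \<le> n" "n \<le> 2 * (2 * H)"
    hence "max (real n) 1 = real n" by simp
    thus "1 / (B * max (real n) 1) \<le> int_dist (real n * \<alpha>)" using far[of n] n by (simp add: B_def)
  qed (use B1 H1 in auto)
  also have "max 1 (2 * B * real (2 * H) * (1 / 2)) = B * (2 * real H)"
  proof -
    have "1 * 1 \<le> B * (2 * real H)" using B1 H1 by (intro mult_mono) auto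
    moreover have "2 * B * real (2 * H) * (1 / 2) = B * (2 * real H)" by simp
    ultimately show ?thesis by (simp only: mult_1 max_absorb2)
  qed
  also have "ln (B * (2 * real H)) = ln B + ln (2 * real H)" using B1 H1 by (subst ln_mult) auto
  also have "4 * B * (1 + (ln B + ln (2 * real H))) * (2 + log 2 (real (2 * H) / 1))
      \<le> 4 * B * ((5 + ln b + 3 * d) * L) * ((10 + 4 * d) * L)"
  proof (intro mult_mono)
    have "ln b * 1 \<le> ln b * L" "d * T \<le> d * L" using ln_B(2) L1 d0 T_le_L by (intro mult_left_mono; simp)+
    thus "1 + (ln B + ln (2 * real H)) \<le> (5 + ln b + 3 * d) * L"
      using ln_2H_le L1 ln_B(1) by (simp add: algebra_simps)
    have "log 2 (2 * real H) \<le> 2 * ln (2 * real H)" using H1 by (intro log_2_le_2_ln) auto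
    thus "2 + log 2 (real (2 * H) / 1) \<le> (10 + 4 * d) * L" using ln_2H_le L1 by (simp add: algebra_simps)
    show "0 \<le> 2 + log 2 (real (2 * H) / 1)" using H1 by simp
  qed (use B1 ln_B(2) d0 L1 H1 in auto)
  finally have "resonance_sum \<alpha> (2 * H) \<le> 2 * (4 * B * ((5 + ln b + 3 * d) * L) * ((10 + 4 * d) * L))" by simp
  also have "\<dots> = 8 * b * (5 + ln b + 3 * d) * (10 + 4 * d) * (L powr d * L * L)" by (simp add: B_def)
  also have "L powr d * L * L = L powr (d + 2)" using L1 by (simp add: powr_add power2_eq_square)
  finally show ?thesis .
qed

text \<open>The exponent \<open>2d + 4\<close> in \<open>U\<close> is twice the exponent in the bound for the resonance sum.\<close>

lemma resonance_sum_over_U: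
  fixes K defines "K \<equiv> 8 * b * (5 + ln b + 3 * d) * (10 + 4 * d)"
  shows "(resonance_sum \<alpha> (2 * H))\<^sup>2 / U \<le> K\<^sup>2" "resonance_sum \<alpha> (2 * H) / U \<le> K"
proof -
  have K0: "K \<ge> 0" using b1 ln_B d0 by (simp add: K_def)
  have F: "resonance_sum \<alpha> (2 * H) \<le> K * L powr (d + 2)" using resonance_sum_le_scale by (simp add: K_def)
  have "(resonance_sum \<alpha> (2 * H))\<^sup>2 \<le> (K * L powr (d + 2))\<^sup>2"
    using F resonance_sum_nonneg by (intro power_mono) auto
  also have "\<dots> = K\<^sup>2 * U" by (simp add: U_def power_mult_distrib power2_eq_square flip: powr_add)
  finally show "(resonance_sum \<alpha> (2 * H))\<^sup>2 / U \<le> K\<^sup>2" using U1 by (simp add: divide_le_eq)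
  have "L powr (d + 2) \<le> U" unfolding U_def using L1 d0 by (intro powr_mono) auto
  hence "K * L powr (d + 2) \<le> K * U" using K0 by (intro mult_left_mono)
  hence "resonance_sum \<alpha> (2 * H) \<le> K * U" using F by linarith
  thus "resonance_sum \<alpha> (2 * H) / U \<le> K" using U1 by (simp add: divide_le_eq)
qed

text \<open>Strong resonance forces \<open>m \<ge> M/(B U)\<close>, so only the scales between that and \<open>H\<close> matter and their number is \<open>O(T)\<close>. The
harmonic sum within a block is logarithmic in a power of \<open>L\<close>, which gives the second factor \<open>T\<close>.\<close>

lemma strong_resonance_sum_le_scale:
  assumes A: "A > 0"
    and farA: "\<And>n. 1 \<le> n \<Longrightarrow> n \<le> 2 * H \<Longrightarrow> 1 / (A * max (real n) (real M / (B * U))) \<le> int_dist (real n * \<alpha>)"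
  shows "strong_resonance_sum \<alpha> (U / real M) H \<le> 16 * A * ((2 + ln b) + (5 * d + 8) * T)\<^sup>2"
proof -
  define Q0 where "Q0 = real M / (B * U)"
  \<comment> \<open>Taking the minimum keeps \<open>ln D\<close> of order T, however large A is.\<close>
  define D where "D = min A B"
  have BU: "B * U \<ge> 1" using mult_mono[of 1 B 1 U] B1 U1 by simp
  have Mp: "real M > 0" using real_M_ge_3 by linarith
  have Q0: "0 < Q0" "Q0 \<le> real M" using BU Mp by (auto simp: Q0_def divide_le_eq mult_le_cancel_left1)
  have D0: "D > 0" "D \<le> B" "D \<le> A" using A B1 by (auto simp: D_def)
  have farB: "1 / (B * real n) \<le> int_dist (real n * \<alpha>)" if "1 \<le> n" "n \<le> 4 * H" for n
    using far[OF that] by (simp add: B_def)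
  have farD: "1 / (D * max (real n) Q0) \<le> int_dist (real n * \<alpha>)" if n: "1 \<le> n" "n \<le> 2 * H" for n
  proof (cases "A \<le> B")
    case True thus ?thesis using farA[OF n] by (simp add: D_def Q0_def min_def)
  next
    case False
    have "B * real n \<le> B * max (real n) Q0" using B1 by (intro mult_left_mono) auto
    hence "1 / (B * max (real n) Q0) \<le> 1 / (B * real n)" using B1 n by (intro frac_le) auto
    also have "\<dots> \<le> int_dist (real n * \<alpha>)" by (rule farB) (use n in auto)
    finally show ?thesis using False by (simp add: D_def min_def)
  qed
  define \<tau> where "\<tau> = U / real M"
  have "strong_resonance_sum \<alpha> \<tau> H = 2 * (\<Sum>m=1..H. strong_resonance \<alpha> \<tau> (int m))"
    unfolding strong_resonance_sum_def by (rule sum_symmetric_int) simp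
  also have "(\<Sum>m=1..H. strong_resonance \<alpha> \<tau> (int m)) = (\<Sum>m\<in>{m \<in> {1..H}. int_dist (real m * \<alpha>) < \<tau>}. 1 / (real m * int_dist (real m * \<alpha>)))"
    by (subst sum.inter_filter) (auto simp: strong_resonance_def resonance_eq_nat intro!: sum.cong)
  also have "\<dots> \<le> (\<Sum>m | 1 \<le> m \<and> m \<le> H \<and> Q0 \<le> real m \<and> int_dist (real m * \<alpha>) \<le> \<tau>.
             1 / (real m * int_dist (real m * \<alpha>)))"
  proof (rule sum_mono2)
    show "finite {m. 1 \<le> m \<and> m \<le> H \<and> Q0 \<le> real m \<and> int_dist (real m * \<alpha>) \<le> \<tau>}"
      by (rule finite_subset[of _ "{..H}"]) auto
    have "Q0 \<le> real m" if m: "1 \<le> m" "m \<le> H" "int_dist (real m * \<alpha>) < \<tau>" for m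
    proof -
      have "1 / (B * real m) < U / real M" using farB[of m] m by (simp add: \<tau>_def)
      hence "real M < U * (B * real m)" using B1 m Mp by (simp add: divide_less_eq less_divide_eq mult_ac split: if_splits)
      thus ?thesis using BU B1 U1 by (simp add: Q0_def divide_le_eq mult_ac)
    qed
    thus "{m \<in> {1..H}. int_dist (real m * \<alpha>) < \<tau>} \<subseteq> {m. 1 \<le> m \<and> m \<le> H \<and> Q0 \<le> real m \<and> int_dist (real m * \<alpha>) \<le> \<tau>}"
      by auto
  qed auto
  also have "\<dots> \<le> 4 * D * (1 + ln (max 1 (2 * D * real H * \<tau>))) * (2 + log 2 (real H / Q0))"
    by (rule sum_resonances_le) (use D0 Q0 H_bounds(3) U1 Mp farD in \<open>auto simp: \<tau>_def\<close>)
  also have "\<dots> \<le> 4 * A * ((2 + ln b) + (5 * d + 8) * T) * (2 * ((2 + ln b) + (5 * d + 8) * T))"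
  proof (intro mult_mono)
    have HU: "real H \<le> real M * U"
    proof -
      have "L powr (2 * d + 1) \<le> U" unfolding U_def using L1 by (intro powr_mono) auto
      hence "real M * L powr (2 * d + 1) \<le> real M * U" by (intro mult_left_mono) auto
      thus ?thesis using H_bounds(1) by linarith
    qed
    define Y where "Y = B * U * U"
    have Y1: "Y \<ge> 1" using mult_mono[of 1 "B * U" 1 U] BU U1 by (simp add: Y_def)
    have lnY: "ln Y = ln b + (5 * d + 8) * T"
    proof -
      have "ln Y = ln B + ln U + ln U" using B1 U1 by (simp add: Y_def ln_mult)
      also have "ln U = (2 * d + 4) * T" unfolding U_def by (rule ln_L_powr)
      finally show ?thesis using ln_B(1) by (simp add: algebra_simps)
    qed
    have nn: "ln Y \<ge> 0" using Y1 by simp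
    have "2 * D * real H * \<tau> \<le> 2 * B * (real M * U) * \<tau>"
      using D0 HU U1 Mp B1 by (intro mult_mono mult_right_mono mult_nonneg_nonneg) (auto simp: \<tau>_def)
    also have "\<dots> = 2 * Y" using Mp by (simp add: \<tau>_def Y_def)
    finally have "max 1 (2 * D * real H * \<tau>) \<le> 2 * Y" using Y1 by simp
    hence "ln (max 1 (2 * D * real H * \<tau>)) \<le> ln (2 * Y)" by (intro ln_mono) auto
    also have "\<dots> = ln 2 + ln Y" using Y1 by (simp add: ln_mult)
    also have "ln (2::real) \<le> 1" using ln_le_minus_one[of "2::real"] by simp
    finally show "1 + ln (max 1 (2 * D * real H * \<tau>)) \<le> (2 + ln b) + (5 * d + 8) * T"
      unfolding lnY by linarith
    have q: "real H / Q0 \<le> Y"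
    proof -
      have "real H / Q0 = real H * (B * U) / real M" by (simp add: Q0_def)
      also have "\<dots> \<le> (real M * U) * (B * U) / real M"
        using HU BU Mp by (intro divide_right_mono mult_right_mono) auto
      also have "\<dots> = Y" using Mp by (simp add: Y_def)
      finally show ?thesis .
    qed
    have "real H / Q0 > 0" using H1 Q0 by simp
    hence "log 2 (real H / Q0) \<le> log 2 Y" using q by simp
    also have "\<dots> \<le> 2 * ln Y" by (rule log_2_le_2_ln[OF Y1])
    finally show "2 + log 2 (real H / Q0) \<le> 2 * ((2 + ln b) + (5 * d + 8) * T)"
      unfolding lnY by (simp add: algebra_simps)
    have "real H / Q0 \<ge> 1" using Q0 H_bounds(3) by simp
    hence "log 2 (real H / Q0) \<ge> 0" by simp
    thus "0 \<le> 2 + log 2 (real H / Q0)" by linarith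
    have "0 \<le> (2 + ln b) + (5 * d + 8) * T" using nn lnY by linarith
    thus "0 \<le> 4 * A * ((2 + ln b) + (5 * d + 8) * T)" using A by simp
  qed (use D0 A in auto)
  finally have fin: "strong_resonance_sum \<alpha> \<tau> H
     \<le> 2 * (4 * A * ((2 + ln b) + (5 * d + 8) * T) * (2 * ((2 + ln b) + (5 * d + 8) * T)))" by simp
  have "2 * (4 * A * Z * (2 * Z)) = 16 * A * Z\<^sup>2" for Z by (simp add: power2_eq_square)
  thus ?thesis using fin by (simp only: \<tau>_def)
qed

text \<open>The left-hand side is the bound of \<open>birkhoff_fejer_error\<close> for separation \<open>1/(B M)\<close>, divided by \<open>V\<close>. It is
\<open>1 + O(B L / L^(2d+1))\<close>, and \<open>B\<close> is of order \<open>L^d\<close>.\<close>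

lemma smoothing_error_le:
  "1 + 2 * ln (1 + (real H)\<^sup>2) / (1 / (B * real M) * real H) \<le> 1 + 8 * (2 * d + 4) * b"
proof -
  have Mp: "real M > 0" using real_M_ge_3 by linarith
  have Lp: "L powr (2 * d + 1) > 0" using L1 by simp
  have "1 * 1 \<le> real H * real H" using H1 by (intro mult_mono) auto
  hence "1 + (real H)\<^sup>2 \<le> (2 * real H)\<^sup>2" by (simp add: power2_eq_square)
  hence "ln (1 + (real H)\<^sup>2) \<le> ln ((2 * real H)\<^sup>2)" by (intro ln_mono) (auto simp: add_pos_nonneg)
  also have "\<dots> = 2 * ln (2 * real H)" using H1 by (subst ln_realpow) auto
  also have "\<dots> \<le> 2 * ((2 * d + 4) * L)" using ln_2H_le by simp
  finally have l: "ln (1 + (real H)\<^sup>2) \<le> 2 * ((2 * d + 4) * L)" .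
  have "B * real M / real H \<le> B * real M / (real M * L powr (2 * d + 1) / 2)"
    using H_bounds(2) Mp Lp B1 H1 by (intro divide_left_mono) auto
  also have "\<dots> = 2 * b * (L powr d / L powr (2 * d + 1))" using Mp by (simp add: B_def)
  also have "L powr d / L powr (2 * d + 1) = L powr (- d - 1)" by (simp add: powr_diff[symmetric])
  finally have h: "B * real M / real H \<le> 2 * b * L powr (- d - 1)" .
  have "2 * ln (1 + (real H)\<^sup>2) / (1 / (B * real M) * real H) = 2 * ln (1 + (real H)\<^sup>2) * (B * real M / real H)"
    using B1 Mp by simp
  also have "\<dots> \<le> 2 * (2 * ((2 * d + 4) * L)) * (2 * b * L powr (- d - 1))"
    using l h d0 L1 B1 Mp by (intro mult_mono mult_left_mono) auto
  also have "\<dots> = 8 * (2 * d + 4) * b * (L * L powr (- d - 1))" by simp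
  also have "L * L powr (- d - 1) = L powr (- d)"
    using L1 powr_add[of L 1 "- d - 1"] by simp
  also have "8 * (2 * d + 4) * b * L powr (- d) \<le> 8 * (2 * d + 4) * b * 1"
    using L1 d0 b1 powr_mono[of "- d" 0 L] by (intro mult_left_mono) auto
  finally show ?thesis by simp
qed

end

locale polynomial_cf = irrational_cf +
  fixes c d :: real
  assumes c1: "c \<ge> 1" and d_nonneg: "d \<ge> 0"
    and a_le: "\<And>k. k \<ge> 1 \<Longrightarrow> real_of_int (a k) \<le> c * real k powr d"
begin

text \<open>Denominators at least double every two steps; \<open>3\<close> exceeds \<open>2 / ln 2\<close>.\<close>

lemma index_diff_le:
  assumes "i \<le> j"
  shows "real j - real i \<le> 3 * ln (real_of_int (q j) / real_of_int (q i)) + 1"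
proof -
  define t where "t = (j - i) div 2"
  have "2 ^ t * q i \<le> q (i + 2 * t)" by (rule q_growth)
  also have "\<dots> \<le> q j" by (rule q_mono) (use assms in \<open>simp add: t_def\<close>)
  finally have "real_of_int (2 ^ t * q i) \<le> real_of_int (q j)" by (simp only: of_int_le_iff)
  hence "2 ^ t \<le> real_of_int (q j) / real_of_int (q i)"
    using q_pos[of i] by (simp add: le_divide_eq)
  hence "ln (2 ^ t) \<le> ln (real_of_int (q j) / real_of_int (q i))" by (intro ln_mono) auto
  hence "real t * ln 2 \<le> ln (real_of_int (q j) / real_of_int (q i))" by (simp add: ln_realpow)
  moreover have "real t * (2/3) \<le> real t * ln 2" using ln2_ge_two_thirds by (intro mult_left_mono) auto
  moreover have "real j - real i \<le> 2 * real t + 1" using assms unfolding t_def by linarith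
  ultimately show ?thesis by linarith
qed

lemma q_le_power:
  assumes "i \<le> k" shows "real_of_int (q i) \<le> (2 * c * real k powr d) ^ i"
  using assms
proof (induction i)
  case (Suc i)
  have "real_of_int (q (Suc i)) \<le> real_of_int (2 * a (Suc i) * q i)"
    using q_Suc_le[of i] by (simp only: of_int_le_iff)
  also have "\<dots> = 2 * real_of_int (a (Suc i)) * real_of_int (q i)" by simp
  also have "\<dots> \<le> (2 * c * real k powr d) * (2 * c * real k powr d) ^ i"
  proof (rule mult_mono)
    have "real (Suc i) powr d \<le> real k powr d" using Suc.prems d_nonneg by (intro powr_mono2) auto
    hence "c * real (Suc i) powr d \<le> c * real k powr d" using c1 by (intro mult_left_mono) auto
    thus "2 * real_of_int (a (Suc i)) \<le> 2 * c * real k powr d" using a_le[of "Suc i"] by simp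
  qed (use Suc c1 q_pos[of i] in auto)
  finally show ?case by simp
qed (simp add: cf_data_0)

end

definition diophantine_const :: "real \<Rightarrow> real \<Rightarrow> real" where
  "diophantine_const c d = 4 * c * (6 * d + 14) powr d"

definition window_const :: "real \<Rightarrow> real \<Rightarrow> real" where
  "window_const c d = 2 * (3 * ln (diophantine_const c d) + 2) + (9 * d + 12) * (2 * ln (2 * c + d) + 4)"

text \<open>The second argument of the maximum serves the index \<open>k = 1\<close>. There the window degenerates to a point, but
\<open>M < q(2)\<close> is bounded in terms of \<open>c\<close> and \<open>d\<close>.\<close>

definition window_factor :: "real \<Rightarrow> real \<Rightarrow> real" where
  "window_factor c d = max 4 (diophantine_const c d * (4 * (2 * c + d)) powr d)"

lemma diophantine_const_ge_4:
  assumes "c \<ge> 1" "d \<ge> 0" shows "diophantine_const c d \<ge> 4"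
proof -
  have "(6 * d + 14) powr d \<ge> 1" using assms by (intro ge_one_powr_ge_zero) auto
  hence "1 * 1 \<le> c * (6 * d + 14) powr d" using assms by (intro mult_mono) auto
  thus ?thesis by (simp add: diophantine_const_def)
qed

lemma window_const_pos: assumes "c \<ge> 1" "d \<ge> 0" shows "window_const c d > 0"
proof -
  have "ln (diophantine_const c d) \<ge> 0" "ln (2 * c + d) \<ge> 0"
    using diophantine_const_ge_4[OF assms] assms by auto
  hence "2 * (3 * ln (diophantine_const c d) + 2) > 0" "(9 * d + 12) * (2 * ln (2 * c + d) + 4) \<ge> 0"
    using assms by auto
  thus ?thesis unfolding window_const_def by linarith
qed

locale cf_scale = polynomial_cf \<alpha> c d + scale M d for \<alpha> c d :: real and M :: nat
begin

abbreviation "b \<equiv> diophantine_const c d"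

lemma b_ge_4: "b \<ge> 4"
  by (rule diophantine_const_ge_4[OF c1 d_nonneg])

text \<open>A denominator up to \<open>4H\<close> has index \<open>O(L)\<close>.\<close>

lemma a_le_scale:
  assumes "real_of_int (q j) \<le> 4 * real H"
  shows "4 * real_of_int (a (Suc j)) \<le> b * L powr d"
proof -
  have "real j - real 0 \<le> 3 * ln (real_of_int (q j) / real_of_int (q 0)) + 1"
    by (rule index_diff_le) simp
  also have "ln (real_of_int (q j) / real_of_int (q 0)) \<le> ln (4 * real H)"
    using assms q_pos[of j] by (intro ln_mono) (auto simp: cf_data_0)
  also have "\<dots> \<le> (2 * d + 4) * L" by (rule ln_4H_le)
  finally have "real (Suc j) \<le> (6 * d + 14) * L" using L1 by (simp add: algebra_simps)
  hence "real (Suc j) powr d \<le> ((6 * d + 14) * L) powr d" using d_nonneg by (intro powr_mono2) auto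
  also have "\<dots> = (6 * d + 14) powr d * L powr d" by (rule powr_mult)
  finally have "c * real (Suc j) powr d \<le> c * ((6 * d + 14) powr d * L powr d)"
    using c1 by (intro mult_left_mono) auto
  thus ?thesis using a_le[of "Suc j"] by (simp add: diophantine_const_def mult_ac)
qed

lemma badly_approximable_at_scale:
  assumes n: "1 \<le> n" "n \<le> 4 * H"
  shows "1 / ((b * L powr d) * real n) \<le> int_dist (real n * \<alpha>)"
proof -
  obtain j where j: "q j \<le> real n" "real n < q (Suc j)" using denom_bracket[of "real n"] n by auto
  have "real_of_int (q j) \<le> 4 * real H" using j n by linarith
  from a_le_scale[OF this] have A: "4 * real_of_int (a (Suc j)) * real n \<le> (b * L powr d) * real n"
    by (intro mult_right_mono) auto
  have "4 * real_of_int (a (Suc j)) * real n > 0" using a_ge_1[of "Suc j"] n by simp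
  hence "1 / ((b * L powr d) * real n) \<le> 1 / (4 * real_of_int (a (Suc j)) * real n)"
    using A by (intro frac_le) auto
  also have "\<dots> \<le> int_dist (real n * \<alpha>)"
    using int_dist_ge_window[OF _ order_refl j] n by simp
  finally show ?thesis .
qed

sublocale diophantine_scale M d \<alpha> b
  by unfold_locales (use irrational b_ge_4 badly_approximable_at_scale in auto)

text \<open>Denominators grow at most like \<open>exp(O(k log k))\<close>, so \<open>log M\<close> is polynomially bounded in \<open>k\<close>
and \<open>T = O(log k)\<close>.\<close>

lemma L_le_index:
  assumes "k \<ge> 1" "real M < q (Suc k)"
  shows "L \<le> (2 * c + d) * (real k + 1)\<^sup>2"
proof -
  have "real M \<le> (2 * c * real (Suc k) powr d) ^ Suc k" using q_le_power[of "Suc k" "Suc k"] assms by simp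
  hence "L \<le> ln ((2 * c * real (Suc k) powr d) ^ Suc k)" unfolding L_def using real_M_ge_3 by (intro ln_mono) auto
  also have "\<dots> = real (Suc k) * (ln (2 * c) + d * ln (real (Suc k)))"
    using c1 by (subst ln_realpow) (auto simp: ln_mult ln_powr)
  also have "\<dots> \<le> real (Suc k) * (2 * c * real (Suc k) + d * real (Suc k))"
  proof (intro mult_left_mono add_mono)
    have "ln (2 * c) \<le> 2 * c" using ln_le_minus_one[of "2 * c"] c1 by simp
    also have "\<dots> \<le> 2 * c * real (Suc k)" using c1 by simp
    finally show "ln (2 * c) \<le> 2 * c * real (Suc k)" .
    show "ln (real (Suc k)) \<le> real (Suc k)" using ln_le_minus_one[of "real (Suc k)"] by simp
  qed (use d_nonneg in auto)
  also have "\<dots> = (2 * c + d) * (real k + 1)\<^sup>2" by (simp add: power2_eq_square algebra_simps)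
  finally show ?thesis .
qed

lemma T_le_index:
  assumes "k \<ge> 2" "real M < q (Suc k)"
  shows "T \<le> (2 * ln (2 * c + d) + 4) * ln (real k)" "1 \<le> 2 * ln (real k)"
proof -
  have "ln 2 \<le> ln (real k)" using assms by simp
  thus k1: "1 \<le> 2 * ln (real k)" using ln2_ge_two_thirds by linarith
  have "T \<le> ln ((2 * c + d) * (real k + 1)\<^sup>2)"
    unfolding T_def using L_le_index[of k] assms L1 by (intro ln_mono) auto
  also have "\<dots> = ln (2 * c + d) + 2 * ln (real k + 1)"
    using c1 d_nonneg by (simp add: ln_mult ln_realpow)
  also have "ln (real k + 1) \<le> ln ((real k)\<^sup>2)"
  proof (rule ln_mono)
    have "2 * real k \<le> real k * real k" using assms by (intro mult_right_mono) auto
    moreover have "real k \<ge> 2" using assms by simp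
    ultimately show "real k + 1 \<le> (real k)\<^sup>2" unfolding power2_eq_square by linarith
  qed auto
  also have "ln ((real k)\<^sup>2) = 2 * ln (real k)" using assms by (subst ln_realpow) auto
  also have "ln (2 * c + d) + 2 * (2 * ln (real k)) \<le> ln (2 * c + d) * (2 * ln (real k)) + 2 * (2 * ln (real k))"
    using mult_left_mono[OF k1, of "ln (2 * c + d)"] c1 d_nonneg by simp
  finally show "T \<le> (2 * ln (2 * c + d) + 4) * ln (real k)" by (simp add: algebra_simps)
qed

text \<open>Both \<open>H/M\<close> and \<open>M/(M/(B U))\<close> are powers of \<open>L\<close>, and exponential growth of the denominators turns a ratio of sizes
into the logarithm of that ratio for indices.\<close>

lemma index_near:
  assumes k: "k \<ge> 1" and kM: "q k \<le> real M" "real M < q (Suc k)"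
    and j: "q j \<le> 2 * real H" "real M / (B * U) < q (Suc j)"
  shows "\<bar>real (Suc j) - real k\<bar> \<le> 3 * ln (B * U) + 2"
proof -
  have BU: "B * U \<ge> 1" using mult_mono[of 1 B 1 U] B1 U1 by simp
  have qp: "real_of_int (q i) > 0" for i using q_pos[of i] by simp
  show ?thesis
  proof (cases "k \<le> j")
    case True
    have "real_of_int (q k) \<le> 4 * real H" using kM H_bounds(3) by linarith
    hence ak: "4 * real_of_int (a (Suc k)) \<le> B" using a_le_scale by (simp add: B_def)
    have "real_of_int (q (Suc k)) \<le> real_of_int (2 * a (Suc k) * q k)"
      using q_Suc_le[of k] by (simp only: of_int_le_iff)
    also have "\<dots> = (2 * real_of_int (a (Suc k))) * real_of_int (q k)" by simp
    also have "\<dots> \<le> (B / 2) * real_of_int (q k)" using ak qp[of k] by (intro mult_right_mono) auto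
    finally have Mq: "real M \<le> (B / 2) * real_of_int (q k)" using kM by linarith
    have "L powr (2 * d + 1) \<le> U" unfolding U_def using L1 by (intro powr_mono) auto
    hence "real M * L powr (2 * d + 1) \<le> real M * U" by (intro mult_left_mono) auto
    hence "real_of_int (q j) \<le> 2 * (real M * U)" using j H_bounds(1) by linarith
    also have "\<dots> \<le> 2 * (((B / 2) * real_of_int (q k)) * U)" using Mq U1 by (intro mult_left_mono mult_right_mono) auto
    finally have "real_of_int (q j) / real_of_int (q k) \<le> B * U"
      using qp[of k] by (simp add: divide_le_eq mult_ac)
    hence "ln (real_of_int (q j) / real_of_int (q k)) \<le> ln (B * U)"
      using qp by (intro ln_mono divide_pos_pos) auto
    moreover have "ln (B * U) \<ge> 0" using BU by simp
    ultimately show ?thesis using index_diff_le[OF True] True by linarith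
  next
    case False
    hence le: "Suc j \<le> k" by simp
    have "real_of_int (q k) \<le> B * U * real_of_int (q (Suc j))"
      using j(2) kM(1) BU by (simp add: divide_less_eq mult_ac split: if_splits)
    hence "real_of_int (q k) / real_of_int (q (Suc j)) \<le> B * U"
      using qp[of "Suc j"] by (simp add: divide_le_eq mult_ac)
    hence "ln (real_of_int (q k) / real_of_int (q (Suc j))) \<le> ln (B * U)"
      using qp by (intro ln_mono divide_pos_pos) auto
    moreover have "ln (B * U) \<ge> 0" using BU by simp
    ultimately show ?thesis using index_diff_le[OF le] le by linarith
  qed
qed

text \<open>Between the scales \<open>M/(B U)\<close> and \<open>2H\<close> only partial quotients from the window around \<open>k\<close> govern the approximation of
\<open>0\<close> by multiples of \<open>\<alpha>\<close>.\<close>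

lemma badly_approximable_window:
  assumes k: "k \<ge> 1" and kM: "q k \<le> real M" "real M < q (Suc k)"
  defines "S \<equiv> {l::nat. l \<ge> 1 \<and> \<bar>real l - real k\<bar> \<le> window_const c d * ln (real k)}"
  defines "A \<equiv> (MAX l\<in>S. real_of_int (a l))"
  assumes n: "1 \<le> n" "n \<le> 2 * H"
  shows "1 / ((window_factor c d * A) * max (real n) (real M / (B * U))) \<le> int_dist (real n * \<alpha>)"
    and "A \<ge> 1" and "finite S" and "k \<in> S"
proof -
  have BU: "B * U \<ge> 1" using mult_mono[of 1 B 1 U] B1 U1 by simp
  define X where "X = max (real n) (real M / (B * U))"
  have lnk: "ln (real k) \<ge> 0" using k by simp
  show finS: "finite S"
    by (rule finite_subset[of _ "{..nat \<lceil>real k + window_const c d * ln (real k)\<rceil>}"])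
       (auto simp: S_def, linarith)
  show kS: "k \<in> S" using k lnk window_const_pos[OF c1 d_nonneg] by (simp add: S_def)
  have Age: "real_of_int (a l) \<le> A" if "l \<in> S" for l
    unfolding A_def using finS that by (intro Max_ge) auto
  show A1: "A \<ge> 1" using Age[OF kS] a_ge_1[OF k] by linarith
  have C4: "window_factor c d \<ge> 4" by (simp add: window_factor_def)
  have X: "real n \<le> X" "X \<le> 2 * real H" "1 \<le> X"
  proof -
    have "real M / (B * U) \<le> real M" using BU by (simp add: divide_le_eq mult_le_cancel_left1)
    thus "X \<le> 2 * real H" using n H_bounds(3) unfolding X_def by auto
  qed (use n in \<open>auto simp: X_def\<close>)
  obtain j where j: "q j \<le> X" "X < q (Suc j)" using denom_bracket[OF X(3)] by auto
  have "real_of_int (q j) \<le> 4 * real H" using j X by linarith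
  hence aB: "4 * real_of_int (a (Suc j)) \<le> b * L powr d" by (rule a_le_scale)
  have "4 * real_of_int (a (Suc j)) \<le> window_factor c d * A"
  proof (cases "k = 1")
    case True
    have "L \<le> 4 * (2 * c + d)" using L_le_index[OF k kM(2)] True by simp
    hence "L powr d \<le> (4 * (2 * c + d)) powr d" using L1 d_nonneg by (intro powr_mono2) auto
    hence "b * L powr d \<le> b * (4 * (2 * c + d)) powr d" using b_ge_4 by (intro mult_left_mono) auto
    also have "\<dots> \<le> window_factor c d" by (simp add: window_factor_def)
    also have "\<dots> \<le> window_factor c d * A" using A1 C4 by simp
    finally show ?thesis using aB by linarith
  next
    case False
    hence k2: "k \<ge> 2" using k by simp
    have "real M / (B * U) \<le> X" by (simp add: X_def)
    hence "\<bar>real (Suc j) - real k\<bar> \<le> 3 * ln (B * U) + 2"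
      using j X by (intro index_near k kM) linarith+
    also have "\<dots> = (3 * ln b + 2) + (9 * d + 12) * T"
    proof -
      have "ln (B * U) = ln B + ln U" using B1 U1 by (simp add: ln_mult)
      also have "ln U = (2 * d + 4) * T" unfolding U_def by (rule ln_L_powr)
      finally show ?thesis using ln_B(1) by (simp add: algebra_simps)
    qed
    also have "\<dots> \<le> (3 * ln b + 2) * (2 * ln (real k)) + (9 * d + 12) * ((2 * ln (2 * c + d) + 4) * ln (real k))"
    proof (intro add_mono mult_left_mono T_le_index(1)[OF k2 kM(2)])
      show "3 * ln b + 2 \<le> (3 * ln b + 2) * (2 * ln (real k))"
        using mult_left_mono[OF T_le_index(2)[OF k2 kM(2)], of "3 * ln b + 2"] ln_B(2) by simp
    qed (use d_nonneg in auto)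
    also have "\<dots> = window_const c d * ln (real k)" by (simp add: window_const_def algebra_simps)
    finally have "Suc j \<in> S" by (simp add: S_def)
    hence "4 * real_of_int (a (Suc j)) \<le> 4 * A" using Age by simp
    also have "\<dots> \<le> window_factor c d * A" using A1 C4 by (intro mult_right_mono) auto
    finally show ?thesis .
  qed
  hence le: "4 * real_of_int (a (Suc j)) * X \<le> (window_factor c d * A) * X" using X by (intro mult_right_mono) auto
  have "4 * real_of_int (a (Suc j)) * X > 0" using a_ge_1[of "Suc j"] X by simp
  hence "1 / ((window_factor c d * A) * X) \<le> 1 / (4 * real_of_int (a (Suc j)) * X)"
    using le by (intro frac_le) auto
  also have "\<dots> \<le> int_dist (real n * \<alpha>)"
    using int_dist_ge_window[OF _ X(1) j] n by simp
  finally show "1 / ((window_factor c d * A) * max (real n) (real M / (B * U))) \<le> int_dist (real n * \<alpha>)"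
    by (simp add: X_def)
qed

end

section \<open>The final estimates\<close>

text \<open>Since \<open>A \<ge> 1\<close> and \<open>T \<ge> \<tau> > 0\<close>, bounded quantities are absorbed into \<open>A T\<^sup>2\<close>. The next lemma does the same with
\<open>A\<^sup>2 T^4\<close> for the variance.\<close>

lemma average_bound_at_scale:
  fixes e V W K A T \<tau> w :: real
  assumes "0 \<le> V" "0 \<le> e" "0 \<le> K" "0 \<le> w" "1 \<le> A" "0 < \<tau>" "\<tau> \<le> T" "W \<le> w * A * T\<^sup>2" "X \<le> K"
  shows "e * V + V * (W + X) \<le> ((e + K) / \<tau>\<^sup>2 + w) * V * A * T\<^sup>2"
proof -
  have "\<tau>\<^sup>2 * 1 \<le> T\<^sup>2 * A" using assms by (intro mult_mono power_mono) auto
  hence "(e + K) * (\<tau>\<^sup>2 * 1) \<le> (e + K) * (T\<^sup>2 * A)" using assms by (intro mult_left_mono) auto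
  hence "e + K \<le> (e + K) * (T\<^sup>2 * A) / \<tau>\<^sup>2" using assms by (simp add: le_divide_eq)
  hence "e + (W + X) \<le> (e + K) * (T\<^sup>2 * A) / \<tau>\<^sup>2 + w * A * T\<^sup>2" using assms by linarith
  hence "V * (e + (W + X)) \<le> V * ((e + K) * (T\<^sup>2 * A) / \<tau>\<^sup>2 + w * A * T\<^sup>2)"
    using assms by (intro mult_left_mono)
  thus ?thesis by (simp add: algebra_simps)
qed

lemma variance_bound_at_scale:
  fixes e V W K A A2 T \<tau> w X Y :: real
  assumes "0 \<le> V" "0 \<le> e" "0 \<le> K" "0 \<le> w" "1 \<le> A" "A\<^sup>2 \<le> A2" "0 < \<tau>" "\<tau> \<le> T"
    "0 \<le> W" "W \<le> w * A * T\<^sup>2" "0 \<le> X" "X \<le> K" "Y \<le> K\<^sup>2"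
  shows "8 * (e * V)\<^sup>2 + 2 * (V\<^sup>2 * (1 + 2 * W\<^sup>2 + X + 10 * Y + (W + X)\<^sup>2))
      \<le> ((8 * e\<^sup>2 + 2 + 2 * K + 24 * K\<^sup>2) / \<tau> ^ 4 + 8 * w\<^sup>2) * (V\<^sup>2 * A2 * T ^ 4)"
proof -
  define G where "G = 8 * e\<^sup>2 + 2 + 2 * K + 24 * K\<^sup>2"
  have G0: "G \<ge> 0" using assms by (simp add: G_def)
  have "1 \<le> A\<^sup>2" using assms by simp
  hence A2: "1 \<le> A2" using assms by linarith
  have "\<tau> ^ 4 * 1 \<le> T ^ 4 * A2" using assms A2 by (intro mult_mono power_mono) auto
  hence "G * (\<tau> ^ 4 * 1) \<le> G * (T ^ 4 * A2)" using G0 by (intro mult_left_mono)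
  hence G: "G \<le> G * (T ^ 4 * A2) / \<tau> ^ 4" using assms by (simp add: le_divide_eq)
  have "W\<^sup>2 \<le> (w * A * T\<^sup>2)\<^sup>2" using assms by (intro power_mono) auto
  also have "\<dots> = w\<^sup>2 * A\<^sup>2 * T ^ 4" by (simp add: power_mult_distrib flip: power_mult)
  also have "\<dots> \<le> w\<^sup>2 * A2 * T ^ 4" using assms by (intro mult_right_mono mult_left_mono) auto
  finally have W2: "W\<^sup>2 \<le> w\<^sup>2 * A2 * T ^ 4" .
  have "X\<^sup>2 \<le> K\<^sup>2" using assms by (intro power_mono) auto
  moreover have "(W + X)\<^sup>2 \<le> 2 * W\<^sup>2 + 2 * X\<^sup>2"
    using zero_le_power2[of "W - X"] by (simp add: power2_eq_square algebra_simps)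
  ultimately have "8 * e\<^sup>2 + 2 * (1 + 2 * W\<^sup>2 + X + 10 * Y + (W + X)\<^sup>2) \<le> G + 8 * W\<^sup>2"
  proof -
    have combine: "8 * e2 + 2 * (1 + 2 * w2 + X + 10 * Y + Z) \<le> 8 * e2 + 2 + 2 * K + 24 * k2 + 8 * w2"
      if "x2 \<le> k2" "Z \<le> 2 * w2 + 2 * x2" "X \<le> K" "Y \<le> k2" for e2 w2 Z x2 k2 :: real
      using that by (simp add: distrib_left)
    show "X\<^sup>2 \<le> K\<^sup>2 \<Longrightarrow> (W + X)\<^sup>2 \<le> 2 * W\<^sup>2 + 2 * X\<^sup>2 \<Longrightarrow> ?thesis"
      unfolding G_def using assms by (intro combine)
  qed
  also have "\<dots> \<le> G * (T ^ 4 * A2) / \<tau> ^ 4 + 8 * (w\<^sup>2 * A2 * T ^ 4)" using G W2 by linarith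
  finally have "V\<^sup>2 * (8 * e\<^sup>2 + 2 * (1 + 2 * W\<^sup>2 + X + 10 * Y + (W + X)\<^sup>2))
      \<le> V\<^sup>2 * (G * (T ^ 4 * A2) / \<tau> ^ 4 + 8 * (w\<^sup>2 * A2 * T ^ 4))" by (intro mult_left_mono) auto
  moreover have "8 * (e * V)\<^sup>2 + 2 * (V\<^sup>2 * Z) = V\<^sup>2 * (8 * e\<^sup>2 + 2 * Z)" for Z
    by (simp add: power_mult_distrib algebra_simps)
  moreover have "V\<^sup>2 * (G * (T ^ 4 * A2) / \<tau> ^ 4 + 8 * (w\<^sup>2 * A2 * T ^ 4)) = (G / \<tau> ^ 4 + 8 * w\<^sup>2) * (V\<^sup>2 * A2 * T ^ 4)"
    by (simp add: algebra_simps)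
  ultimately show ?thesis by (simp only: G_def)
qed

definition "resonance_const c d =
  (let b = diophantine_const c d in 8 * b * (5 + ln b + 3 * d) * (10 + 4 * d))" for c d :: real
definition "smoothing_const c d = 1 + 8 * (2 * d + 4) * diophantine_const c d" for c d :: real
definition "strong_resonance_const c d =
  16 * window_factor c d * ((2 + ln (diophantine_const c d)) / ln (ln 3) + (5 * d + 8))\<^sup>2" for c d :: real

lemma consts_nonneg:
  assumes "c \<ge> 1" "d \<ge> 0"
  shows "0 \<le> resonance_const c d" "0 \<le> smoothing_const c d" "0 \<le> strong_resonance_const c d"
proof -
  have "diophantine_const c d \<ge> 4" by (rule diophantine_const_ge_4[OF assms])
  moreover from this have "ln (diophantine_const c d) \<ge> 0" by simp
  ultimately show "0 \<le> resonance_const c d" "0 \<le> smoothing_const c d" "0 \<le> strong_resonance_const c d"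
    using assms by (auto simp: resonance_const_def smoothing_const_def strong_resonance_const_def window_factor_def Let_def)
qed

context cf_scale begin

lemma ln_ln_3_pos: "ln (ln 3) > (0::real)" using ln_3_gt_1 by simp

lemma strong_resonance_sum_le_window:
  assumes k: "k \<ge> 1" and kM: "q k \<le> real M" "real M < q (Suc k)"
  defines "S \<equiv> {l::nat. l \<ge> 1 \<and> \<bar>real l - real k\<bar> \<le> window_const c d * ln (real k)}"
  defines "A \<equiv> (MAX l\<in>S. real_of_int (a l))"
  shows "strong_resonance_sum \<alpha> (U / real M) H \<le> strong_resonance_const c d * A * T\<^sup>2"
proof -
  note w = badly_approximable_window[OF k kM, folded S_def, folded A_def]
  have A1: "A \<ge> 1" using w(2)[of 1] H1 by simp
  have "strong_resonance_sum \<alpha> (U / real M) H \<le> 16 * (window_factor c d * A) * ((2 + ln b) + (5 * d + 8) * T)\<^sup>2"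
  proof (rule strong_resonance_sum_le_scale)
    show "window_factor c d * A > 0" using A1 by (simp add: window_factor_def)
  qed (rule w(1))
  also have "\<dots> \<le> 16 * (window_factor c d * A) * (((2 + ln b) / ln (ln 3) + (5 * d + 8)) * T)\<^sup>2"
  proof (intro mult_left_mono power_mono)
    have "(2 + ln b) * ln (ln 3) \<le> (2 + ln b) * T" using T_ge ln_B(2) by (intro mult_left_mono) auto
    hence "2 + ln b \<le> (2 + ln b) * T / ln (ln 3)" using ln_ln_3_pos by (simp add: le_divide_eq)
    thus "(2 + ln b) + (5 * d + 8) * T \<le> ((2 + ln b) / ln (ln 3) + (5 * d + 8)) * T"
      by (simp add: algebra_simps)
    show "0 \<le> (2 + ln b) + (5 * d + 8) * T" using ln_B(2) d_nonneg T_pos by simp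
    show "0 \<le> 16 * (window_factor c d * A)" using A1 by (simp add: window_factor_def)
  qed
  also have "\<dots> = strong_resonance_const c d * A * T\<^sup>2" by (simp add: strong_resonance_const_def power_mult_distrib)
  finally show ?thesis .
qed

end

theorem proposition22:
  fixes c d :: real
  assumes "c \<ge> 0" and "d \<ge> 0"
  shows "\<exists>C>0. \<exists>C'>0. \<forall>(f :: real \<Rightarrow> real) (\<alpha> :: real).
    (\<forall>x. f (x + 1) = f x) \<longrightarrow>
    bounded_variation f 0 1 \<longrightarrow>
    integral {0..1} f = 0 \<longrightarrow>
    \<alpha> \<notin> \<rat> \<longrightarrow>
    (\<forall>k::nat. k \<ge> 1 \<longrightarrow> real_of_int (cf_quot \<alpha> k) \<le> c * real k powr d) \<longrightarrow>
    (\<forall>(k::nat) (M::nat). k \<ge> 1 \<longrightarrow> M \<ge> 3 \<longrightarrow>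
       cf_denom \<alpha> k \<le> int M \<longrightarrow> int M < cf_denom \<alpha> (k + 1) \<longrightarrow>
       norm (complex_of_real (birkhoff_mean \<alpha> f M) -
          (\<Sum>m | m \<noteq> 0 \<and> real_of_int \<bar>m\<bar> < real M * ln (real M) powr (2 * d + 1).
             of_real (1 - real_of_int \<bar>m\<bar> / real_of_int \<lfloor>real M * ln (real M) powr (2 * d + 1)\<rfloor>)
             * fourier_coeff f m
             * (exp (2 * of_real pi * \<i> * of_int m * of_real \<alpha>)
                / (1 - exp (2 * of_real pi * \<i> * of_int m * of_real \<alpha>)))))
         \<le> C * total_variation f 0 1
             * (MAX l \<in> {l::nat. l \<ge> 1 \<and> \<bar>real l - real k\<bar> \<le> C' * ln (real k)}. real_of_int (cf_quot \<alpha> l))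
             * (ln (ln (real M)))\<^sup>2 \<and>
       \<bar>birkhoff_variance \<alpha> f M -
          (\<Sum>m=1..M. (norm (fourier_coeff f (int m)))\<^sup>2 / (2 * pi\<^sup>2 * (int_dist (real m * \<alpha>))\<^sup>2))\<bar>
         \<le> C * (total_variation f 0 1
                   * sqrt (\<Sum>m=1..M. (norm (fourier_coeff f (int m)))\<^sup>2 / (int_dist (real m * \<alpha>))\<^sup>2)
                + (total_variation f 0 1)\<^sup>2
                   * (MAX l \<in> {l::nat. l \<ge> 1 \<and> \<bar>real l - real k\<bar> \<le> C' * ln (real k)}. (real_of_int (cf_quot \<alpha> l))\<^sup>2)
                   * (ln (ln (real M))) ^ 4))"
proof -
  \<comment> \<open>Raising c to at least 1 keeps the logarithms in the constants nonnegative.\<close>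
  define c\<^sub>1 where "c\<^sub>1 = max 1 c"
  have c1: "c\<^sub>1 \<ge> 1" "c \<le> c\<^sub>1" by (auto simp: c\<^sub>1_def)
  define K where "K = resonance_const c\<^sub>1 d"
  define e where "e = smoothing_const c\<^sub>1 d"
  define w where "w = strong_resonance_const c\<^sub>1 d"
  define C' where "C' = window_const c\<^sub>1 d"
  define \<tau> :: real where "\<tau> = ln (ln 3)"
  define C1 where "C1 = (e + K) / \<tau>\<^sup>2 + w"
  define C2 where "C2 = (8 * e\<^sup>2 + 2 + 2 * K + 24 * K\<^sup>2) / \<tau> ^ 4 + 8 * w\<^sup>2"
  have \<tau>: "\<tau> > 0" unfolding \<tau>_def using ln_3_gt_1 by simp
  have const: "c\<^sub>1 \<ge> 1" "d \<ge> 0" using c1 assms by auto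
  have nn: "0 \<le> K" "0 \<le> e" "0 \<le> w"
    using consts_nonneg[OF const] by (simp_all add: K_def e_def w_def)
  have C12: "0 \<le> C1" "0 \<le> C2" using nn \<tau> by (auto simp: C1_def C2_def)
  define C where "C = 1 + C1 + 4 * e + C2"
  have C: "C > 0" "C1 \<le> C" "4 * e \<le> C" "C2 \<le> C" using C12 nn by (auto simp: C_def)
  show ?thesis
  proof (rule exI[of _ C], rule conjI[OF C(1)], rule exI[of _ C'], intro conjI allI impI)
    show "0 < C'" unfolding C'_def by (rule window_const_pos[OF const])
  next
    fix f :: "real \<Rightarrow> real" and \<alpha> :: real and k M :: nat
    assume per: "\<forall>x. f (x + 1) = f x" and bv: "bounded_variation f 0 1" and f0: "integral {0..1} f = 0"
      and \<alpha>: "\<alpha> \<notin> \<rat>" and ak: "\<forall>k\<ge>1. real_of_int (cf_quot \<alpha> k) \<le> c * real k powr d"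
      and k: "1 \<le> k" and M: "3 \<le> M" and kM: "cf_denom \<alpha> k \<le> int M" "int M < cf_denom \<alpha> (k + 1)"
    interpret bv_periodic f by unfold_locales (use per bv in auto)
    interpret S: cf_scale \<alpha> c\<^sub>1 d M
    proof unfold_locales
      fix l :: nat assume l: "1 \<le> l"
      have "c * real l powr d \<le> c\<^sub>1 * real l powr d" using c1 by (intro mult_right_mono) auto
      thus "real_of_int (cf_quot \<alpha> l) \<le> c\<^sub>1 * real l powr d"
        using ak[rule_format, OF l] by (rule order_trans[rotated])
    qed (use const \<alpha> M in auto)
    define S where "S = {l::nat. l \<ge> 1 \<and> \<bar>real l - real k\<bar> \<le> C' * ln (real k)}"
    define A where "A = (MAX l\<in>S. real_of_int (cf_quot \<alpha> l))"
    define A2 where "A2 = (MAX l\<in>S. (real_of_int (cf_quot \<alpha> l))\<^sup>2)"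
    define W where "W = strong_resonance_sum \<alpha> (S.U / real M) S.H"
    define F where "F = resonance_sum \<alpha> (2 * S.H)"
    define \<Sigma> where "\<Sigma> = (\<Sum>m=1..M. (norm (fourier_coeff f (int m)))\<^sup>2 / (2 * pi\<^sup>2 * (int_dist (real m * \<alpha>))\<^sup>2))"
    define \<Sigma>' where "\<Sigma>' = (\<Sum>m=1..M. (norm (fourier_coeff f (int m)))\<^sup>2 / (int_dist (real m * \<alpha>))\<^sup>2)"
    have q: "cf_q \<alpha> k \<le> real M" "real M < cf_q \<alpha> (Suc k)"
      using kM by (simp_all add: S.cf_denom_eq_q)
    have A1: "A \<ge> 1" and finS: "finite S" and neS: "S \<noteq> {}"
      using S.badly_approximable_window(2-4)[OF k q, of 1] S.H1 unfolding A_def S_def C'_def by auto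
    have AA2: "A\<^sup>2 \<le> A2"
    proof -
      have "A \<in> (\<lambda>l. real_of_int (cf_quot \<alpha> l)) ` S" unfolding A_def using finS neS by (intro Max_in) auto
      then obtain l where "l \<in> S" "A = real_of_int (cf_quot \<alpha> l)" by auto
      thus ?thesis unfolding A2_def using finS by (auto intro!: Max_ge)
    qed
    have W: "0 \<le> W" "W \<le> w * A * S.T\<^sup>2"
      using S.strong_resonance_sum_le_window[OF k q] by (simp_all add: W_def strong_resonance_sum_nonneg w_def A_def S_def C'_def)
    have F: "F\<^sup>2 / S.U \<le> K\<^sup>2" "F / S.U \<le> K" "0 \<le> F / S.U"
      using S.resonance_sum_over_U S.U1 resonance_sum_nonneg[of \<alpha> "2 * S.H"]
      by (simp_all add: F_def K_def resonance_const_def Let_def)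
    have T: "\<tau> \<le> S.T" "S.T = ln (ln (real M))" using S.T_ge by (simp_all add: \<tau>_def S.T_def S.L_def)
    have err: "\<bar>birkhoff_sum \<alpha> f N - (\<Sum>n=1..N. fejer_mean S.H (real n * \<alpha>))\<bar> \<le> e * V" if N: "N \<in> {1..M}" for N
    proof -
      have BM: "1 \<le> S.B * real M" using mult_mono[of 1 S.B 1 "real M"] S.B1 S.real_M_ge_3 by simp
      have "\<bar>birkhoff_sum \<alpha> f N - (\<Sum>n=1..N. fejer_mean S.H (real n * \<alpha>))\<bar>
         \<le> V * (1 + 2 * ln (1 + (real S.H)\<^sup>2) / (1 / (S.B * real M) * real S.H))"
      proof (rule birkhoff_fejer_error[OF S.H1(1)])
        show "0 < 1 / (S.B * real M)" using BM by simp
        show "1 / (S.B * real M) \<le> 1" using BM by simp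
        fix n assume n: "1 \<le> n" "n < N"
        have "S.B * real n \<le> S.B * real M" using n N S.B1 by (intro mult_left_mono) auto
        hence "1 / (S.B * real M) \<le> 1 / (S.B * real n)" using n S.B1 by (intro frac_le) auto
        also have "\<dots> \<le> int_dist (real n * \<alpha>)"
          unfolding S.B_def by (rule S.badly_approximable_at_scale) (use n N S.H_bounds(3) in auto)
        finally show "1 / (S.B * real M) \<le> int_dist (real n * \<alpha>)" .
      qed
      also have "\<dots> \<le> V * e" unfolding e_def smoothing_const_def
        using S.smoothing_error_le V_nonneg by (intro mult_left_mono) auto
      finally show ?thesis by (simp add: mult.commute)
    qed
    have M1: "1 \<le> M" and U0: "0 < S.U" using M S.U1 by auto
    note bounds = birkhoff_mean_variance_bound[OF \<alpha> M1 S.H_bounds(3) U0 f0 err,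
        folded \<Sigma>_def, folded W_def, folded F_def]
    have floor_H: "\<lfloor>real M * ln (real M) powr (2 * d + 1)\<rfloor> = int S.H"
      by (simp add: S.H_def S.L_def)
    have D: "(\<Sum>m | m \<noteq> 0 \<and> real_of_int \<bar>m\<bar> < real M * ln (real M) powr (2 * d + 1).
             of_real (1 - real_of_int \<bar>m\<bar> / real_of_int \<lfloor>real M * ln (real M) powr (2 * d + 1)\<rfloor>)
             * fourier_coeff f m
             * (exp (2 * of_real pi * \<i> * of_int m * of_real \<alpha>)
                / (1 - exp (2 * of_real pi * \<i> * of_int m * of_real \<alpha>))))
        = (\<Sum>m | m \<noteq> 0 \<and> \<bar>m\<bar> \<le> int S.H. cocycle_coeff \<alpha> S.H m)"
    proof (rule sum.mono_neutral_cong_left)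
      show "{m::int. m \<noteq> 0 \<and> real_of_int \<bar>m\<bar> < real M * ln (real M) powr (2 * d + 1)} \<subseteq> {m. m \<noteq> 0 \<and> \<bar>m\<bar> \<le> int S.H}"
        unfolding floor_H[symmetric] by (auto simp: le_floor_iff)
      show "\<forall>m\<in>{m. m \<noteq> 0 \<and> \<bar>m\<bar> \<le> int S.H} - {m. m \<noteq> 0 \<and> real_of_int \<bar>m\<bar> < real M * ln (real M) powr (2 * d + 1)}.
          cocycle_coeff \<alpha> S.H m = 0"
      proof
        fix m assume m: "m \<in> {m. m \<noteq> 0 \<and> \<bar>m\<bar> \<le> int S.H} - {m. m \<noteq> 0 \<and> real_of_int \<bar>m\<bar> < real M * ln (real M) powr (2 * d + 1)}"
        hence "real S.H \<le> real_of_int \<bar>m\<bar>" using S.H_bounds(1) by (auto simp: S.L_def)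
        \<comment> \<open>Only the frequencies at which the Fejer weight vanishes distinguish the two ranges of summation.\<close>
        hence "\<bar>m\<bar> = int S.H" using m by auto
        thus "cocycle_coeff \<alpha> S.H m = 0" using S.H1(1)
          by (simp add: cocycle_coeff_def fejer_weight_def flip: of_int_abs)
      qed
    qed (auto simp: cocycle_coeff_def fejer_weight_def floor_H exp_eq_echar)
    have "e * V + V * (W + F / S.U) \<le> C1 * V * A * S.T\<^sup>2"
      unfolding C1_def using V_nonneg nn A1 \<tau> T(1) W(2) F(2) by (intro average_bound_at_scale)
    also have "\<dots> \<le> C * V * A * S.T\<^sup>2"
      using C(2) V_nonneg A1 by (intro mult_right_mono) auto
    finally have avg: "e * V + V * (W + F / S.U) \<le> C * V * A * (ln (ln (real M)))\<^sup>2" by (simp add: T(2))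
    show "norm (complex_of_real (birkhoff_mean \<alpha> f M) -
          (\<Sum>m | m \<noteq> 0 \<and> real_of_int \<bar>m\<bar> < real M * ln (real M) powr (2 * d + 1).
             of_real (1 - real_of_int \<bar>m\<bar> / real_of_int \<lfloor>real M * ln (real M) powr (2 * d + 1)\<rfloor>)
             * fourier_coeff f m
             * (exp (2 * of_real pi * \<i> * of_int m * of_real \<alpha>)
                / (1 - exp (2 * of_real pi * \<i> * of_int m * of_real \<alpha>)))))
         \<le> C * total_variation f 0 1
             * (MAX l \<in> {l::nat. l \<ge> 1 \<and> \<bar>real l - real k\<bar> \<le> C' * ln (real k)}. real_of_int (cf_quot \<alpha> l))
             * (ln (ln (real M)))\<^sup>2"
      unfolding D S_def[symmetric] A_def[symmetric]
      using bounds(1) avg by linarith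
    have \<Sigma>le: "sqrt \<Sigma> \<le> sqrt \<Sigma>'"
      unfolding \<Sigma>_def \<Sigma>'_def
    proof (intro real_sqrt_le_mono sum_mono)
      fix m assume "m \<in> {1..M}"
      hence x: "int_dist (real m * \<alpha>) > 0" using int_dist_pos[OF \<alpha>, of "int m"] by simp
      have "1 * 1 \<le> pi * pi" using pi_gt3 by (intro mult_mono) auto
      hence "1 * (int_dist (real m * \<alpha>))\<^sup>2 \<le> 2 * pi\<^sup>2 * (int_dist (real m * \<alpha>))\<^sup>2"
        by (intro mult_right_mono) (auto simp: power2_eq_square)
      thus "(norm (fourier_coeff f (int m)))\<^sup>2 / (2 * pi\<^sup>2 * (int_dist (real m * \<alpha>))\<^sup>2)
          \<le> (norm (fourier_coeff f (int m)))\<^sup>2 / (int_dist (real m * \<alpha>))\<^sup>2"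
        using x by (intro frac_le) auto
    qed
    have s0: "0 \<le> sqrt \<Sigma>'" unfolding \<Sigma>'_def by (simp add: sum_nonneg)
    have "4 * (e * V) * sqrt \<Sigma> \<le> 4 * (e * V) * sqrt \<Sigma>'"
      using \<Sigma>le nn V_nonneg by (intro mult_left_mono) auto
    also have "\<dots> = (4 * e) * (V * sqrt \<Sigma>')" by simp
    also have "\<dots> \<le> C * (V * sqrt \<Sigma>')" using C(3) V_nonneg s0 by (intro mult_right_mono) auto
    finally have b1: "4 * (e * V) * sqrt \<Sigma> \<le> C * (V * sqrt \<Sigma>')" .
    have "8 * (e * V)\<^sup>2 + 2 * (V\<^sup>2 * (1 + 2 * W\<^sup>2 + F / S.U + 10 * (F\<^sup>2 / S.U) + (W + F / S.U)\<^sup>2))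
        \<le> C2 * (V\<^sup>2 * A2 * S.T ^ 4)"
      unfolding C2_def using V_nonneg nn A1 AA2 \<tau> T(1) W F by (intro variance_bound_at_scale)
    also have "\<dots> \<le> C * (V\<^sup>2 * A2 * S.T ^ 4)"
    proof (rule mult_right_mono[OF C(4)])
      have "0 \<le> A2" using AA2 zero_le_power2[of A] by linarith
      thus "0 \<le> V\<^sup>2 * A2 * S.T ^ 4" using S.T_pos by simp
    qed
    finally have b2: "8 * (e * V)\<^sup>2 + 2 * (V\<^sup>2 * (1 + 2 * W\<^sup>2 + F / S.U + 10 * F\<^sup>2 / S.U + (W + F / S.U)\<^sup>2))
        \<le> C * (V\<^sup>2 * A2 * (ln (ln (real M))) ^ 4)" by (simp add: T(2))
    show "\<bar>birkhoff_variance \<alpha> f M -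
          (\<Sum>m=1..M. (norm (fourier_coeff f (int m)))\<^sup>2 / (2 * pi\<^sup>2 * (int_dist (real m * \<alpha>))\<^sup>2))\<bar>
         \<le> C * (total_variation f 0 1
                   * sqrt (\<Sum>m=1..M. (norm (fourier_coeff f (int m)))\<^sup>2 / (int_dist (real m * \<alpha>))\<^sup>2)
                + (total_variation f 0 1)\<^sup>2
                   * (MAX l \<in> {l::nat. l \<ge> 1 \<and> \<bar>real l - real k\<bar> \<le> C' * ln (real k)}. (real_of_int (cf_quot \<alpha> l))\<^sup>2)
                   * (ln (ln (real M))) ^ 4)"
      unfolding \<Sigma>_def[symmetric] \<Sigma>'_def[symmetric] S_def[symmetric] A2_def[symmetric] distrib_left
      using bounds(2) b1 b2 by linarith
  qed
qed

end
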